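(* Let $N,R_r,K_c,S$ be feasible parameters of the robust dynamic coded distributed storage (RDCDS) problem with partially storage constrained servers (all terms are defined in the context), and let \[ \Omega=\begin{cases}R_r-S-1,& S<K_c,\\ R_r-K_c,& S\ge K_c.\end{cases} \] For a dropout set $\mathcal{D}^{(t)}\subset[N]$ let $\mathcal{V}_r$ be the set of vectors $(D_1,\dots,D_N)\in\mathbb{R}_+^N$ such that \[ \sum_{n\in[N]\setminus\mathcal{X}\setminus\mathcal{D}^{(t)}}D_n\ge 1\quad\text{for all }\mathcal{X}\subset[N]\setminus\mathcal{D}^{(t)}\text{ with }|\mathcal{X}|=\Omega, \qquad D_n\le \tfrac{1}{K_c}\quad\text{for all }n\in[S]\setminus\mathcal{D}^{(t)}, \] and, for a dropout set $\mathcal{D}^{(t)}$ and a security level $X^{(t)}$, let $\mathcal{V}_u$ be the set of vectors $(U_1,\dots,U_N)\in\mathbb{R}_+^N$ such that \[ \sum_{n\in\mathcal{R}\setminus\mathcal{X}}U_n\ge 1\quad\text{for all }\mathcal{R}\subset[N]\setminus\mathcal{D}^{(t)},\ |\mathcal{R}|=R_r-|\mathcal{D}^{(t)}|,\ \text{and all }\mathcal{X}\subset\mathcal{R},\ |\mathcal{X}|=X^{(t)}, \] \[ U_n\le \tfrac{1}{K_c}\quad\text{for all }n\in[S]\setminus\mathcal{D}^{(t)}. \] (Converse.) For every RDCDS scheme in steady state, i.e. at every time slot $t>t_0$, \[ R_u^{(t)}\ge N-\Omega+X^{(t)},\qquad C_r^{(t)}\ge\min_{(D_1,\dots,D_N)\in\mathcal{V}_r}\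 \sum_{n\in[N]\setminus\mathcal{D}^{(t)}}D_n,\qquad C_u^{(t)}\ge\min_{(U_1,\dots,U_N)\in\mathcal{V}_u}\ \sum_{n\in[N]\setminus\mathcal{D}^{(t)}}U_n, \] where the bounds on $R_u^{(t)}$ and $C_u^{(t)}$ refer to time slots at which the update operation is executed and the bound on $C_r^{(t)}$ to time slots at which the read operation is executed. (Achievability.) For some message length $L$ and some finite field $\mathbb{F}_q$ there exists a single RDCDS scheme that attains all three bounds with equality simultaneously, at every time slot $t$ (not only for $t>t_0$). That is, its update threshold is $R_u^{(t)}=N-\Omega+X^{(t)}$ (for every $0\le X^{(t)}\le\Omega$); every read operation has $C_r^{(t)}$ equal to the first minimum for the realized $\mathcal{D}^{(t)}$; and every update operation has $C_u^{(t)}$ equal to the second minimum for the realized $\mathcal{D}^{(t)}$ and $X^{(t)}$.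
   Context: **Notation.** $[M]=\{1,\dots,M\}$; $\mathbb{N}=\{0,1,2,\dots\}$, $\mathbb{N}^*=\mathbb{N}\setminus\{0\}$; $\mathbb{R}_+$ is the set of nonnegative reals. $H(\cdot)$ and $I(\cdot\,;\cdot)$ are Shannon entropy and mutual information in $q$-ary units (logarithms to base $q$). **Parameters.** Integers $N\ge R_r\ge 1$ ($N$ servers, read threshold $R_r$), $K_c\in\mathbb{N}^*$, $0\le S\le N$. The storage constrained servers are the servers $1,\dots,S$; servers $S+1,\dots,N$ have no storage limit. Parameters are feasible if: $S<R_r$ when $S<K_c$, and $K_c\le R_r$ when $S\ge K_c$ (these are forced by the requirement that the message be recoverable from the storage of any $R_r$ servers). **Storage.** At each time slot $t\in\mathbb{N}$ there is a message $\mathbf{W}^{(t)}$ consisting of $L$ i.i.d. uniform symbols from the finite field $\mathbb{F}_q$, and server $n$ stores a random variable $\mathbf{S}_n^{(t)}$. The storage must at all $t\in\mathbb{N}$ be a $(K_c,R_r,N,S)$ (partially constrained) coded distributed storage of $\mathbf{W}^{(t)}$, i.e. - ($R_r$-recoverability) $H(\mathbf{W}^{(t)}\mid(\mathbf{S}_n^{(t)})_{n\in\mathcal{R}})=0$ for all $\mathcal{R}\subset[N]$ with $|\mathcal{R}|=R_r$; - ($(K_c,S)$-storage cost) $H(\mathbf{S}_n^{(t)})\le L/K_c$ for all $n\in[S]$. The initial $\mathbf{W}^{(0)}$ and $(\mathbf{S}_n^{(0)})_{n\in[N]}$ are set up by a global coordinator (possibly using randomness). **Operations.** At each time slot $t$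 a user executes either a read or an update operation, while a set $\mathcal{D}^{(t)}\subset[N]$ of dropout servers is inaccessible; $\mathcal{D}^{(t)}$ is arbitrary subject to $|\mathcal{D}^{(t)}|\le N-R_r$ for reads and $N-|\mathcal{D}^{(t)}|\ge R_u^{(t)}$ for updates (with $R_u^{(t)}$ the update threshold), and known to the user and the available servers during slot $t$. Operations are memoryless: the user's actions may depend on the current $\mathcal{D}^{(t)}$ (and, for updates, on $X^{(t)}$, the increment and fresh local randomness), but not on the time index or on past operations or dropout states. *Read operation* (must be supported whenever $|\mathcal{D}^{(t)}|\le N-R_r$). The user downloads $\mathbf{A}_n^{(t)}$ from each $n\in[N]\setminus\mathcal{D}^{(t)}$, where - $H(\mathbf{A}_n^{(t)}\mid\mathbf{S}_n^{(t)})=0$ for all $n\in[N]\setminus\mathcal{D}^{(t)}$; - $H(\mathbf{W}^{(t)}\mid(\mathbf{A}_n^{(t)})_{n\in[N]\setminus\mathcal{D}^{(t)}})=0$; - $\mathbf{S}_n^{(t+1)}=\mathbf{S}_n^{(t)}$ for all $n\in[N]$, and $\mathbf{W}^{(t+1)}=\mathbf{W}^{(t)}$. The normalized download cost is $C_r^{(t)}=\frac1L\sum_{n\in[N]\setminus\mathcal{D}^{(t)}}H(\mathbf{A}_n^{(t)})$. *Update operation.* The user has an increment $\boldsymbol{\Delta}^{(t)}$ of $L$ i.i.d. uniform symbols of $\mathbb{F}_q$ and chooses a security level $X^{(t)}$, $0\le X^{(t)}<R_r$. The user uploads $\mathbf{Q}_n^{(t)}$ to each $n\in[N]\setminus\mathcal{D}^{(t)}$,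 where - (correctness) $\mathbf{W}^{(t+1)}=\mathbf{W}^{(t)}+\boldsymbol{\Delta}^{(t)}$; - ($X^{(t)}$-security) $I(\boldsymbol{\Delta}^{(t)};(\mathbf{Q}_n^{(t)})_{n\in\mathcal{X}})=0$ for all $\mathcal{X}\subset[N]\setminus\mathcal{D}^{(t)}$ with $|\mathcal{X}|=X^{(t)}$; - (storage transition) $H(\mathbf{S}_n^{(t+1)}\mid\mathbf{S}_n^{(t)},\mathbf{Q}_n^{(t)})=0$ for all $n\in[N]\setminus\mathcal{D}^{(t)}$, and $\mathbf{S}_n^{(t+1)}=\mathbf{S}_n^{(t)}$ for all $n\in\mathcal{D}^{(t)}$; - (independence) $I(\boldsymbol{\Delta}^{(t)},(\mathbf{Q}_n^{(t)})_{n\in[N]\setminus\mathcal{D}^{(t)}};(\mathbf{S}_n^{(t)})_{n\in[N]})=0$. The normalized upload cost is $C_u^{(t)}=\frac1L\sum_{n\in[N]\setminus\mathcal{D}^{(t)}}H(\mathbf{Q}_n^{(t)})$. **Update threshold.** For a scheme and a security level $X^{(t)}$, $R_u^{(t)}$ is the minimum number such that for every realization of $\mathcal{D}^{(t)}$ with $N-|\mathcal{D}^{(t)}|\ge R_u^{(t)}$ the update operation at slot $t$ satisfies the correctness, $X^{(t)}$-security, storage transition and independence conditions of the update operation, and the storage at slot $t+1$ is again a $(K_c,R_r,N,S)$ coded distributed storage of $\mathbf{W}^{(t+1)}$, i.e. $H(\mathbf{W}^{(t+1)}\mid(\mathbf{S}_n^{(t+1)})_{n\in\mathcal{R}})=0$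 for all $\mathcal{R}\subset[N]$ with $|\mathcal{R}|=R_r$ and $H(\mathbf{S}_n^{(t+1)})\le L/K_c$ for all $n\in[S]$. Updates are executed only when $N-|\mathcal{D}^{(t)}|\ge R_u^{(t)}$. **Steady state.** $t_0$ denotes a time slot by which the system has experienced all possible dropout states and security levels: for every $\mathcal{D}\subset[N]$ and every integer $X\ge0$ with $|\mathcal{D}|+X\le\Omega$ (the pairs not excluded by the lower bound $R_u^{(\tau)}\ge N-\Omega+X^{(\tau)}$ on the update threshold), an update operation with $\mathcal{D}^{(\tau)}=\mathcal{D}$ and $X^{(\tau)}=X$ has been executed at some slot $\tau\le t_0$. *)

theory Defs
  imports "HOL-Probability.Probability" "HOL-Algebra.Ring"
begin

text \<open>
  The library's entropies (theory Information) are used for random variables that are arbitrary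
  functions on the support of a pmf. Restricting the sample space to the support makes every such
  function simple as soon as the support is finite, whatever the type of its values. The last three
  definitions are literally the library abbreviations for \<open>\<H>(X)\<close>, \<open>\<H>(X | Y)\<close> and \<open>\<I>(X ; Y)\<close>.
\<close>

definition support_space :: "'w pmf \<Rightarrow> 'w measure" where
  "support_space p = restrict_space (measure_pmf p) (set_pmf p)"

definition ent :: "real \<Rightarrow> 'w pmf \<Rightarrow> ('w \<Rightarrow> 'x) \<Rightarrow> real" where
  "ent b p X = prob_space.entropy (support_space p) b (count_space (X ` space (support_space p))) X"

definition cond_ent :: "real \<Rightarrow> 'w pmf \<Rightarrow> ('w \<Rightarrow> 'x) \<Rightarrow> ('w \<Rightarrow> 'y) \<Rightarrow> real" where
  "cond_ent b p X Y = prob_space.conditional_entropy (support_space p) b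
     (count_space (X ` space (support_space p))) (count_space (Y ` space (support_space p))) X Y"

definition mut_inf :: "real \<Rightarrow> 'w pmf \<Rightarrow> ('w \<Rightarrow> 'x) \<Rightarrow> ('w \<Rightarrow> 'y) \<Rightarrow> real" where
  "mut_inf b p X Y = prob_space.mutual_information (support_space p) b
     (count_space (X ` space (support_space p))) (count_space (Y ` space (support_space p))) X Y"

lemma space_support_space: "space (support_space p) = set_pmf p"
  by (simp add: support_space_def space_restrict_space)

lemma prob_space_support_space: "prob_space (support_space p)"
proof (rule prob_spaceI)
  have "emeasure (support_space p) (set_pmf p) = emeasure (measure_pmf p) (set_pmf p)"
    unfolding support_space_def by (rule emeasure_restrict_space) auto
  also have "\<dots> = 1"
    by (metis emeasure_pmf)
  finally show "emeasure (support_space p) (space (support_space p)) = 1"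
    by (simp add: space_support_space)
qed

lemma information_space_support_space: "1 < b \<Longrightarrow> information_space (support_space p) b"
  by (simp add: information_space_def information_space_axioms_def prob_space_support_space)

lemma simple_function_support_space:
  "finite (set_pmf p) \<Longrightarrow> simple_function (support_space p) X"
  by (auto simp: simple_function_def space_support_space)
    (auto simp: support_space_def sets_restrict_space)

definition messages :: "'f ring \<Rightarrow> nat \<Rightarrow> 'f list set" where
  "messages F L = {w. length w = L \<and> set w \<subseteq> carrier F}"

definition add_msg :: "'f ring \<Rightarrow> 'f list \<Rightarrow> 'f list \<Rightarrow> 'f list" where
  "add_msg F w d = map2 (\<lambda>x y. x \<oplus>\<^bsub>F\<^esub> y) w d"

abbreviation qq :: "'f ring \<Rightarrow> real" where
  "qq F \<equiv> real (card (carrier F))"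

text \<open>
  A memoryless scheme. Vectors indexed by servers are functions on \<open>nat\<close>, of which only the
  components in \<open>{1..N}\<close> matter.
  \<^item> \<open>init_law\<close>: joint law of the initial message and the initial storages;
  \<^item> \<open>answer D n\<close>: the answer of server \<open>n\<close> as a function of its storage, for the dropout set \<open>D\<close>;
  \<^item> \<open>upload D X d\<close>: joint law of the uploads given the increment \<open>d\<close>, i.e. the effect of the user's
    fresh local randomness, for the dropout set \<open>D\<close> and the security level \<open>X\<close>;
  \<^item> \<open>transition D X n\<close>: the new storage of server \<open>n\<close> as a function of its old storage and of the
    upload it receives.
  Answers and transitions are maps, since \<open>H(A_n | S_n) = 0\<close> and \<open>H(S_n' | S_n, Q_n) = 0\<close> say that they
  are functions of their arguments; that these maps and the law of the uploads do not depend on the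
  slot is memorylessness.
\<close>

record ('f, 's, 'u, 'a) scheme =
  init_law :: "('f list \<times> (nat \<Rightarrow> 's)) pmf"
  answer :: "nat set \<Rightarrow> nat \<Rightarrow> 's \<Rightarrow> 'a"
  upload :: "nat set \<Rightarrow> nat \<Rightarrow> 'f list \<Rightarrow> (nat \<Rightarrow> 'u) pmf"
  transition :: "nat set \<Rightarrow> nat \<Rightarrow> nat \<Rightarrow> 's \<Rightarrow> 'u \<Rightarrow> 's"

definition next_storage ::
  "nat \<Rightarrow> ('f, 's, 'u, 'a) scheme \<Rightarrow> nat set \<Rightarrow> nat \<Rightarrow> (nat \<Rightarrow> 's) \<Rightarrow> (nat \<Rightarrow> 'u) \<Rightarrow> nat \<Rightarrow> 's" where
  "next_storage N sch D X s u =
     (\<lambda>n. if n \<in> {1..N} - D then transition sch D X n (s n) (u n) else s n)"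

text \<open>
  Joint law of message, storages, increment and uploads in a slot with an update, when \<open>\<sigma>\<close> is the
  law of message and storages at the beginning of the slot. The increment and the user's local
  randomness are fresh.
\<close>

definition update_law :: "'f ring \<Rightarrow> nat \<Rightarrow> ('f, 's, 'u, 'a) scheme \<Rightarrow>
    ('f list \<times> (nat \<Rightarrow> 's)) pmf \<Rightarrow> nat set \<Rightarrow> nat \<Rightarrow>
    ('f list \<times> (nat \<Rightarrow> 's) \<times> 'f list \<times> (nat \<Rightarrow> 'u)) pmf" where
  "update_law F L sch \<sigma> D X =
     bind_pmf \<sigma> (\<lambda>(w, s).
     bind_pmf (pmf_of_set (messages F L)) (\<lambda>d.
     bind_pmf (upload sch D X d) (\<lambda>u.
     return_pmf (w, s, d, u))))"

text \<open>
  In the following definition \<open>W\<close> and \<open>St\<close> are the message and the storages as random variables on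
  the sample space of \<open>p\<close>.
\<close>

definition coded_storage :: "nat \<Rightarrow> nat \<Rightarrow> nat \<Rightarrow> nat \<Rightarrow> 'f ring \<Rightarrow> nat \<Rightarrow>
    'w pmf \<Rightarrow> ('w \<Rightarrow> 'f list) \<Rightarrow> ('w \<Rightarrow> nat \<Rightarrow> 's) \<Rightarrow> bool" where
  "coded_storage N Rr Kc S F L p W St \<longleftrightarrow>
     (\<forall>R. R \<subseteq> {1..N} \<and> card R = Rr \<longrightarrow> cond_ent (qq F) p W (\<lambda>\<omega>. restrict (St \<omega>) R) = 0) \<and>
     (\<forall>n\<in>{1..S}. ent (qq F) p (\<lambda>\<omega>. St \<omega> n) \<le> real L / real Kc)"

definition read_ok :: "nat \<Rightarrow> 'f ring \<Rightarrow> ('f, 's, 'u, 'a) scheme \<Rightarrow>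
    ('f list \<times> (nat \<Rightarrow> 's)) pmf \<Rightarrow> nat set \<Rightarrow> bool" where
  "read_ok N F sch \<sigma> D \<longleftrightarrow>
     (\<forall>n\<in>{1..N} - D. cond_ent (qq F) \<sigma> (\<lambda>(w, s). answer sch D n (s n)) (\<lambda>(w, s). s n) = 0) \<and>
     cond_ent (qq F) \<sigma> (\<lambda>(w, s). w)
       (\<lambda>(w, s). restrict (\<lambda>n. answer sch D n (s n)) ({1..N} - D)) = 0"

text \<open>
  The message of the next slot is by definition the sum of the current message and the increment, so
  correctness is the recoverability of that sum. The conditions on transition and independence hold
  by construction and are kept for the correspondence with the model.
\<close>

definition update_ok :: "nat \<Rightarrow> nat \<Rightarrow> nat \<Rightarrow> nat \<Rightarrow> 'f ring \<Rightarrow> nat \<Rightarrow> ('f, 's, 'u, 'a) scheme \<Rightarrow>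
    ('f list \<times> (nat \<Rightarrow> 's)) pmf \<Rightarrow> nat set \<Rightarrow> nat \<Rightarrow> bool" where
  "update_ok N Rr Kc S F L sch \<sigma> D X \<longleftrightarrow> (let p = update_law F L sch \<sigma> D X in
     (\<forall>Y. Y \<subseteq> {1..N} - D \<and> card Y = X \<longrightarrow>
        mut_inf (qq F) p (\<lambda>(w, s, d, u). d) (\<lambda>(w, s, d, u). restrict u Y) = 0) \<and>
     (\<forall>n\<in>{1..N} - D.
        cond_ent (qq F) p (\<lambda>(w, s, d, u). next_storage N sch D X s u n)
          (\<lambda>(w, s, d, u). (s n, u n)) = 0) \<and>
     mut_inf (qq F) p (\<lambda>(w, s, d, u). (d, restrict u ({1..N} - D)))
       (\<lambda>(w, s, d, u). restrict s {1..N}) = 0 \<and>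
     coded_storage N Rr Kc S F L p (\<lambda>(w, s, d, u). add_msg F w d)
       (\<lambda>(w, s, d, u). next_storage N sch D X s u))"

text \<open>
  The threshold depends on the law \<open>\<sigma>\<close> at the beginning of the slot and on the security level. All
  dropout sets that could occur in the slot are considered, not only the one that does occur. The
  minimum exists, since \<open>N + 1\<close> satisfies the condition vacuously.
\<close>

definition update_threshold :: "nat \<Rightarrow> nat \<Rightarrow> nat \<Rightarrow> nat \<Rightarrow> 'f ring \<Rightarrow> nat \<Rightarrow>
    ('f, 's, 'u, 'a) scheme \<Rightarrow> ('f list \<times> (nat \<Rightarrow> 's)) pmf \<Rightarrow> nat \<Rightarrow> nat" where
  "update_threshold N Rr Kc S F L sch \<sigma> X =
     (LEAST r. \<forall>D. D \<subseteq> {1..N} \<and> N - card D \<ge> r \<longrightarrow> update_ok N Rr Kc S F L sch \<sigma> D X)"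

definition read_cost :: "nat \<Rightarrow> 'f ring \<Rightarrow> nat \<Rightarrow> ('f, 's, 'u, 'a) scheme \<Rightarrow>
    ('f list \<times> (nat \<Rightarrow> 's)) pmf \<Rightarrow> nat set \<Rightarrow> real" where
  "read_cost N F L sch \<sigma> D =
     (\<Sum>n\<in>{1..N} - D. ent (qq F) \<sigma> (\<lambda>(w, s). answer sch D n (s n))) / real L"

definition update_cost :: "nat \<Rightarrow> 'f ring \<Rightarrow> nat \<Rightarrow> ('f, 's, 'u, 'a) scheme \<Rightarrow>
    ('f list \<times> (nat \<Rightarrow> 's)) pmf \<Rightarrow> nat set \<Rightarrow> nat \<Rightarrow> real" where
  "update_cost N F L sch \<sigma> D X =
     (\<Sum>n\<in>{1..N} - D. ent (qq F) (update_law F L sch \<sigma> D X) (\<lambda>(w, s, d, u). u n)) / real L"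

datatype operation = Read "nat set" | Update "nat set" nat

primrec state_law :: "nat \<Rightarrow> 'f ring \<Rightarrow> nat \<Rightarrow> ('f, 's, 'u, 'a) scheme \<Rightarrow> (nat \<Rightarrow> operation) \<Rightarrow>
    nat \<Rightarrow> ('f list \<times> (nat \<Rightarrow> 's)) pmf" where
  "state_law N F L sch ops 0 = init_law sch"
| "state_law N F L sch ops (Suc t) =
     (case ops t of
        Read D \<Rightarrow> state_law N F L sch ops t
      | Update D X \<Rightarrow>
          map_pmf (\<lambda>(w, s, d, u). (add_msg F w d, next_storage N sch D X s u))
            (update_law F L sch (state_law N F L sch ops t) D X))"

definition admissible :: "nat \<Rightarrow> nat \<Rightarrow> nat \<Rightarrow> nat \<Rightarrow> 'f ring \<Rightarrow> nat \<Rightarrow> ('f, 's, 'u, 'a) scheme \<Rightarrow>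
    (nat \<Rightarrow> operation) \<Rightarrow> bool" where
  "admissible N Rr Kc S F L sch ops \<longleftrightarrow>
     (\<forall>t. case ops t of
        Read D \<Rightarrow> D \<subseteq> {1..N} \<and> card D \<le> N - Rr
      | Update D X \<Rightarrow> D \<subseteq> {1..N} \<and> X < Rr \<and>
          N - card D \<ge> update_threshold N Rr Kc S F L sch (state_law N F L sch ops t) X)"

text \<open>
  All alphabets are finite, so that the entropies are those of simple functions. The message is
  uniform in every slot, because it is so in slot 0 and the increments are fresh. Reads have to be supported in every state that can be reached.
\<close>

definition rdcds_scheme :: "nat \<Rightarrow> nat \<Rightarrow> nat \<Rightarrow> nat \<Rightarrow> 'f ring \<Rightarrow> nat \<Rightarrow>
    ('f, 's, 'u, 'a) scheme \<Rightarrow> bool" where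
  "rdcds_scheme N Rr Kc S F L sch \<longleftrightarrow>
     finite (set_pmf (init_law sch)) \<and>
     (\<forall>D X d. finite (set_pmf (upload sch D X d))) \<and>
     map_pmf fst (init_law sch) = pmf_of_set (messages F L) \<and>
     (\<forall>ops t. admissible N Rr Kc S F L sch ops \<longrightarrow>
        coded_storage N Rr Kc S F L (state_law N F L sch ops t) fst snd \<and>
        (\<forall>D. D \<subseteq> {1..N} \<and> card D \<le> N - Rr \<longrightarrow> read_ok N F sch (state_law N F L sch ops t) D))"

definition feasible :: "nat \<Rightarrow> nat \<Rightarrow> nat \<Rightarrow> nat \<Rightarrow> bool" where
  "feasible N Rr Kc S \<longleftrightarrow> 1 \<le> Rr \<and> Rr \<le> N \<and> 1 \<le> Kc \<and> S \<le> N \<and>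
     (S < Kc \<longrightarrow> S < Rr) \<and> (S \<ge> Kc \<longrightarrow> Kc \<le> Rr)"

definition Om :: "nat \<Rightarrow> nat \<Rightarrow> nat \<Rightarrow> nat" where
  "Om Rr Kc S = (if S < Kc then Rr - S - 1 else Rr - Kc)"

definition steady_by :: "nat \<Rightarrow> nat \<Rightarrow> nat \<Rightarrow> nat \<Rightarrow> (nat \<Rightarrow> operation) \<Rightarrow> nat \<Rightarrow> bool" where
  "steady_by N Rr Kc S ops t0 \<longleftrightarrow>
     (\<forall>D X. D \<subseteq> {1..N} \<and> card D + X \<le> Om Rr Kc S \<longrightarrow> (\<exists>\<tau>\<le>t0. ops \<tau> = Update D X))"

definition V_read :: "nat \<Rightarrow> nat \<Rightarrow> nat \<Rightarrow> nat \<Rightarrow> nat set \<Rightarrow> (nat \<Rightarrow> real) set" where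
  "V_read N Rr Kc S D = {v \<in> {1..N} \<rightarrow>\<^sub>E {0..}.
     (\<forall>Y. Y \<subseteq> {1..N} - D \<and> card Y = Om Rr Kc S \<longrightarrow> (\<Sum>n\<in>{1..N} - Y - D. v n) \<ge> 1) \<and>
     (\<forall>n\<in>{1..S} - D. v n \<le> 1 / real Kc)}"

definition V_update :: "nat \<Rightarrow> nat \<Rightarrow> nat \<Rightarrow> nat \<Rightarrow> nat set \<Rightarrow> nat \<Rightarrow> (nat \<Rightarrow> real) set" where
  "V_update N Rr Kc S D X = {v \<in> {1..N} \<rightarrow>\<^sub>E {0..}.
     (\<forall>R Y. R \<subseteq> {1..N} - D \<and> int (card R) = int Rr - int (card D) \<and> Y \<subseteq> R \<and> card Y = X \<longrightarrow>
        (\<Sum>n\<in>R - Y. v n) \<ge> 1) \<and>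
     (\<forall>n\<in>{1..S} - D. v n \<le> 1 / real Kc)}"

definition is_min_over :: "nat \<Rightarrow> nat set \<Rightarrow> (nat \<Rightarrow> real) set \<Rightarrow> real \<Rightarrow> bool" where
  "is_min_over N D V m \<longleftrightarrow>
     (\<exists>v. is_arg_min (\<lambda>v. \<Sum>n\<in>{1..N} - D. v n) (\<lambda>v. v \<in> V) v \<and> m = (\<Sum>n\<in>{1..N} - D. v n))"

end

theory Submission
  imports "HOL-Number_Theory.Residues" Defs "HOL-Computational_Algebra.Polynomial"
begin

text \<open>
  Converse. Given all old storages and the uploads to any \<open>X\<close> servers, the increment is still
  uniform, but the new storages of a read set reveal it. So the servers outside the dropouts and
  the \<open>X\<close> servers carry \<open>L\<close> units in total, each at most its upload and at most its new storage. For
  reads, an update with dropout set \<open>Y\<close> makes the message uniform given the storages in \<open>Y\<close>, and later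
  updates preserve this. Both bounds are the same linear program: every \<open>k\<close> available servers sum to
  at least 1, under the storage caps; its optimum is explicit.

  Achievability. The storage is a uniformly random codeword of a linear code over \<open>\<int>/p\<close>, and an
  update adds a random codeword with the increment as its message that vanishes on the dropouts.
  Hence the law of the state is stationary, and the converse supplies all lower bounds. A
  codeword consists of columns, each evaluating a polynomial at one point per server. The message
  symbols are sums along chains of coefficients that run through the columns in a staircase, and
  partial sums of the chains reappear as high coefficients. A read that contacts many
  servers decodes only few columns because the partial sums summarise the others; an update with
  few dropouts and low security writes only few columns. Evaluation points for which all the
  square systems involved are nonsingular are chosen greedily modulo a large prime.
\<close>

subsection \<open>Entropies of functions on a finitely supported pmf\<close>

text \<open>Both programs see an operation only through the number \<open>k\<close> of servers whose
  data must suffice: \<open>N - card D - Om\<close> for a read, \<open>Rr - card D - X\<close> for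
  an update. The obstacle is that one storage must suit every \<open>k\<close>. For
  \<open>k \<ge> Kc\<close> a server should handle \<open>L / k\<close> symbols, so the same array
  has to contain each message symbol once in \<open>k\<close> rows and \<open>L / k\<close> columns
  for all such \<open>k\<close> at the same time; hence the staircase, and hence the factorial in
  \<open>L\<close>, which makes these quotients integral. For \<open>k < Kc\<close> the constrained
  servers are full. With \<open>c\<close> of them available and \<open>k' = k - c\<close>, an
  unconstrained server has to handle \<open>(L / Kc) * (1 + (Kc - k) / k')\<close> symbols: the
  whole main block and a \<open>1 / k'\<close> share of each of \<open>Kc - k\<close> further
  blocks. This dictates the extra blocks and their staircases starting from one row. A column has
  \<open>Om\<close> free symbols more than chain ends; they pay for dropouts and security in
  updates, and a read loses as many servers. Decoding and encoding both reduce to injectivity of a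
  linear map modulo \<open>p\<close>, solved column by column in opposite orders.\<close>

lemma simple_distributed_support_space:
  assumes "finite (set_pmf p)"
  shows "simple_distributed (support_space p) X (\<lambda>x. pmf (map_pmf X p) x)"
proof -
  interpret prob_space "support_space p" by (rule prob_space_support_space)
  have "measure (support_space p) (X -` {x} \<inter> space (support_space p)) = pmf (map_pmf X p) x" for x
  proof -
    have "measure (support_space p) (X -` {x} \<inter> set_pmf p) = measure (measure_pmf p) (X -` {x} \<inter> set_pmf p)"
      unfolding support_space_def by (rule measure_restrict_space) auto
    also have "\<dots> = measure (measure_pmf p) (X -` {x})"
      by (simp add: measure_Int_set_pmf)
    finally show ?thesis by (simp add: space_support_space pmf_map)
  qed
  then show ?thesis
    by (intro simple_distributedI simple_function_support_space assms) auto
qed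

context
  fixes b :: real and p :: "'w pmf"
  assumes b: "1 < b" and fin: "finite (set_pmf p)"
begin

interpretation information_space "support_space p" b
  by (rule information_space_support_space[OF b])

lemmas sfun = simple_function_support_space[OF fin]
lemmas sdist = simple_distributed_support_space[OF fin]

lemma ent_eq: "ent b p X = - (\<Sum>x\<in>set_pmf (map_pmf X p). pmf (map_pmf X p) x * log b (pmf (map_pmf X p) x))"
  unfolding ent_def by (subst entropy_simple_distributed[OF sdist]) (simp add: space_support_space)

lemma ent_Pair: "ent b p (\<lambda>\<omega>. (X \<omega>, Y \<omega>)) = ent b p X + cond_ent b p Y X"
  unfolding ent_def cond_ent_def by (rule entropy_chain_rule) (auto intro: sfun)

lemma cond_ent_nonneg: "0 \<le> cond_ent b p X Y"
  unfolding cond_ent_def by (rule conditional_entropy_nonneg) (auto intro: sfun)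

lemma cond_ent_le: "cond_ent b p X Y \<le> ent b p X"
  unfolding cond_ent_def ent_def by (rule conditional_entropy_less_eq_entropy) (auto intro: sfun)

lemma ent_nonneg: "0 \<le> ent b p X"
  using cond_ent_nonneg[of X X] cond_ent_le[of X X] by linarith

lemma mut_inf_eq: "mut_inf b p X Y = ent b p X + ent b p Y - ent b p (\<lambda>\<omega>. (Y \<omega>, X \<omega>))"
proof -
  have "mut_inf b p X Y = ent b p X - cond_ent b p X Y"
    unfolding mut_inf_def cond_ent_def ent_def
    by (rule mutual_information_eq_entropy_conditional_entropy) (auto intro: sfun)
  then show ?thesis using ent_Pair[of Y X] by simp
qed

lemma ent_comp_le: "ent b p (\<lambda>\<omega>. f (X \<omega>)) \<le> ent b p X"
  using entropy_data_processing[OF sfun, of f X] unfolding ent_def by (simp add: comp_def)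

lemma ent_fun_le:
  assumes "\<And>\<omega>. \<omega> \<in> set_pmf p \<Longrightarrow> Y \<omega> = f (X \<omega>)"
  shows "ent b p Y \<le> ent b p X"
proof -
  have "map_pmf Y p = map_pmf (\<lambda>\<omega>. f (X \<omega>)) p"
    using assms by (intro map_pmf_cong) auto
  then have "ent b p Y = ent b p (\<lambda>\<omega>. f (X \<omega>))" by (simp add: ent_eq)
  then show ?thesis using ent_comp_le[of f X] by simp
qed

lemma ent_le_log_card:
  assumes "X ` set_pmf p \<subseteq> A" "finite A"
  shows "ent b p X \<le> log b (card A)"
proof -
  have "ent b p X \<le> log b (card (X ` set_pmf p))"
    using entropy_le_card[OF sdist, of X] unfolding ent_def space_support_space .
  also have "\<dots> \<le> log b (card A)"
    using assms b fin set_pmf_not_empty[of p]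
    by (subst log_le_cancel_iff) (auto simp: card_gt_0_iff intro!: card_mono)
  finally show ?thesis .
qed

lemma ent_uniform:
  assumes "map_pmf X p = pmf_of_set A" "finite A" "A \<noteq> {}"
  shows "ent b p X = log b (card A)"
  using assms b by (simp add: ent_eq card_gt_0_iff log_divide)

lemma cond_ent_fun_eq_0:
  assumes "\<And>\<omega>. \<omega> \<in> set_pmf p \<Longrightarrow> X \<omega> = f (Y \<omega>)"
  shows "cond_ent b p X Y = 0"
proof -
  have "ent b p (\<lambda>\<omega>. (Y \<omega>, X \<omega>)) \<le> ent b p Y"
    by (rule ent_fun_le[where f = "\<lambda>y. (y, f y)"]) (use assms in auto)
  with ent_Pair[of Y X] cond_ent_nonneg[of X Y] show ?thesis by simp
qed

text \<open>All summands of the conditional entropy have the same sign, so each vanishes, and every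
  pair in the support has the same mass as its second component. Two values of \<open>X\<close> over
  one value of \<open>Y\<close> would exceed that mass.\<close>

lemma cond_ent_eq_0_fun:
  assumes "cond_ent b p X Y = 0"
  shows "\<exists>f. \<forall>\<omega>\<in>set_pmf p. X \<omega> = f (Y \<omega>)"
proof -
  let ?XY = "\<lambda>\<omega>. (X \<omega>, Y \<omega>)"
  let ?q = "\<lambda>z. pmf (map_pmf ?XY p) z" and ?r = "\<lambda>y. pmf (map_pmf Y p) y"
  have le: "?q (x, y) \<le> ?r y" for x y
  proof -
    have "?q (x, y) = measure (measure_pmf p) (?XY -` {(x, y)})" by (simp add: pmf_map)
    also have "\<dots> \<le> measure (measure_pmf p) (Y -` {y})"
      by (rule measure_pmf.finite_measure_mono) auto
    finally show ?thesis by (simp add: pmf_map)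
  qed
  have pos: "?q z > 0" if "z \<in> ?XY ` set_pmf p" for z
    using that by (simp add: pmf_positive)
  have "(\<Sum>(x, y)\<in>?XY ` set_pmf p. ?q (x, y) * log b (?q (x, y) / ?r y)) = 0"
    using assms unfolding cond_ent_def
    by (subst (asm) conditional_entropy_eq[OF sdist sdist]) (simp add: space_support_space)
  then have "(\<Sum>z\<in>?XY ` set_pmf p. - (?q z * log b (?q z / ?r (snd z)))) = 0"
    by (simp add: sum_negf split_beta)
  moreover have "0 \<le> - (?q z * log b (?q z / ?r (snd z)))" if "z \<in> ?XY ` set_pmf p" for z
  proof -
    have "?r (snd z) > 0" using pos[OF that] le[of "fst z" "snd z"] by simp
    then have "?q z / ?r (snd z) \<le> 1" using le[of "fst z" "snd z"] by (simp add: divide_le_eq_1_pos)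
    then have "log b (?q z / ?r (snd z)) \<le> 0"
      using pos[OF that] \<open>?r (snd z) > 0\<close> b by (subst log_le_zero_cancel_iff) auto
    then show ?thesis using pos[OF that] by (simp add: mult_nonneg_nonpos)
  qed
  ultimately have zero: "- (?q z * log b (?q z / ?r (snd z))) = 0" if "z \<in> ?XY ` set_pmf p" for z
    using that fin by (subst (asm) sum_nonneg_eq_0_iff) auto
  have eq: "?q (X \<omega>, Y \<omega>) = ?r (Y \<omega>)" if "\<omega> \<in> set_pmf p" for \<omega>
  proof -
    have q: "?q (X \<omega>, Y \<omega>) > 0" using pos that by auto
    with le[of "X \<omega>" "Y \<omega>"] have r: "?r (Y \<omega>) > 0" by linarith
    from zero[of "(X \<omega>, Y \<omega>)"] that q have "log b (?q (X \<omega>, Y \<omega>) / ?r (Y \<omega>)) = 0" by auto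
    then have "?q (X \<omega>, Y \<omega>) / ?r (Y \<omega>) = 1"
      using q r by (intro inj_onD[OF log_inj[OF b], of _ 1]) (simp_all only: log_one greaterThan_iff divide_pos_pos zero_less_one)
    then show ?thesis using r by simp
  qed
  have "X \<omega> = X \<omega>'" if "\<omega> \<in> set_pmf p" "\<omega>' \<in> set_pmf p" "Y \<omega> = Y \<omega>'" for \<omega> \<omega>'
  proof (rule ccontr)
    assume ne: "X \<omega> \<noteq> X \<omega>'"
    have "?q (X \<omega>, Y \<omega>) + ?q (X \<omega>', Y \<omega>) =
      measure (measure_pmf p) (?XY -` {(X \<omega>, Y \<omega>)} \<union> ?XY -` {(X \<omega>', Y \<omega>)})"
      using ne by (subst measure_pmf.finite_measure_Union) (auto simp: pmf_map)
    also have "\<dots> \<le> measure (measure_pmf p) (Y -` {Y \<omega>})"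
      by (rule measure_pmf.finite_measure_mono) auto
    also have "\<dots> = ?r (Y \<omega>)" by (simp add: pmf_map)
    finally have "?q (X \<omega>', Y \<omega>') \<le> 0" using eq[OF that(1)] that(3) by simp
    moreover have "?q (X \<omega>', Y \<omega>') > 0" by (rule pos) (use that in auto)
    ultimately show False by simp
  qed
  then have "X \<omega> = X (SOME \<omega>'. \<omega>' \<in> set_pmf p \<and> Y \<omega>' = Y \<omega>)" if "\<omega> \<in> set_pmf p" for \<omega>
    using that someI[of "\<lambda>\<omega>'. \<omega>' \<in> set_pmf p \<and> Y \<omega>' = Y \<omega>" \<omega>] by metis
  then show ?thesis
    by (intro exI[of _ "\<lambda>y. X (SOME \<omega>'. \<omega>' \<in> set_pmf p \<and> Y \<omega>' = y)"]) auto
qed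

lemma mut_inf_indep_eq_0:
  assumes "map_pmf (\<lambda>\<omega>. (X \<omega>, Y \<omega>)) p = pair_pmf (map_pmf X p) (map_pmf Y p)"
  shows "mut_inf b p X Y = 0"
  unfolding mut_inf_def
  by (rule mutual_information_eq_0_simple[OF sdist sdist sdist]) (simp add: assms pmf_pair)

lemma ent_Pair_indep:
  assumes "map_pmf (\<lambda>\<omega>. (X \<omega>, Y \<omega>)) p = pair_pmf (map_pmf X p) (map_pmf Y p)"
  shows "ent b p (\<lambda>\<omega>. (Y \<omega>, X \<omega>)) = ent b p X + ent b p Y"
  using mut_inf_indep_eq_0[OF assms] mut_inf_eq[of X Y] by simp

text \<open>Subadditivity with a side variable \<open>Z\<close>; carrying \<open>Z\<close> along
  replaces conditioning on it in the cut bounds.\<close>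

lemma ent_restrict_le:
  assumes "finite A"
  shows "ent b p (\<lambda>\<omega>. (Z \<omega>, restrict (\<lambda>n. T n \<omega>) A)) \<le> ent b p Z + (\<Sum>n\<in>A. ent b p (T n))"
  using assms
proof (induction A rule: finite_induct)
  case empty
  then show ?case by (auto intro!: ent_fun_le[where f = "\<lambda>z. (z, restrict undefined {})"] simp: restrict_def)
next
  case (insert a A)
  let ?V = "\<lambda>\<omega>. (Z \<omega>, restrict (\<lambda>n. T n \<omega>) A)"
  have "ent b p (\<lambda>\<omega>. (Z \<omega>, restrict (\<lambda>n. T n \<omega>) (insert a A))) \<le> ent b p (\<lambda>\<omega>. (?V \<omega>, T a \<omega>))"
    by (rule ent_fun_le[where f = "\<lambda>((z, r), v). (z, r(a := v))"]) auto
  also have "\<dots> = ent b p ?V + cond_ent b p (T a) ?V" by (rule ent_Pair)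
  also have "\<dots> \<le> ent b p ?V + ent b p (T a)" using cond_ent_le by simp
  finally show ?case using insert.IH sum.insert[OF insert.hyps, of "\<lambda>n. ent b p (T n)"] by linarith
qed

end

lemma ent_map_eq:
  assumes "1 < b" "finite (set_pmf p)" "finite (set_pmf q)" "map_pmf X p = map_pmf Y q"
  shows "ent b p X = ent b q Y"
  using assms by (simp add: ent_eq)

lemma cond_ent_eq_0_iff:
  assumes "1 < b" "finite (set_pmf p)"
  shows "cond_ent b p X Y = 0 \<longleftrightarrow> (\<exists>f. \<forall>\<omega>\<in>set_pmf p. X \<omega> = f (Y \<omega>))"
  using cond_ent_eq_0_fun[OF assms] cond_ent_fun_eq_0[OF assms] by metis

lemma cond_ent_eq_0I:
  assumes "1 < b" "finite (set_pmf p)"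
    and det: "\<And>\<omega> \<omega>'. \<omega> \<in> set_pmf p \<Longrightarrow> \<omega>' \<in> set_pmf p \<Longrightarrow> Y \<omega> = Y \<omega>' \<Longrightarrow> X \<omega> = X \<omega>'"
  shows "cond_ent b p X Y = 0"
  unfolding cond_ent_eq_0_iff[OF assms(1,2)]
proof (intro exI ballI)
  fix \<omega> assume \<omega>: "\<omega> \<in> set_pmf p"
  let ?P = "\<lambda>\<omega>'. \<omega>' \<in> set_pmf p \<and> Y \<omega>' = Y \<omega>"
  have "?P (SOME \<omega>'. ?P \<omega>')" by (rule someI[of ?P \<omega>]) (use \<omega> in simp)
  then show "X \<omega> = (\<lambda>y. X (SOME \<omega>'. \<omega>' \<in> set_pmf p \<and> Y \<omega>' = y)) (Y \<omega>)"
    by (intro det) (use \<omega> in auto)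
qed

text \<open>The factors of a product law are its marginals, so independence can be shown without
  computing the marginals separately.\<close>

lemma map_pair_pmfD:
  assumes "map_pmf (\<lambda>\<omega>. (X \<omega>, Y \<omega>)) p = pair_pmf A B"
  shows "map_pmf (\<lambda>\<omega>. (X \<omega>, Y \<omega>)) p = pair_pmf (map_pmf X p) (map_pmf Y p)"
proof -
  have "map_pmf X p = map_pmf fst (map_pmf (\<lambda>\<omega>. (X \<omega>, Y \<omega>)) p)"
    "map_pmf Y p = map_pmf snd (map_pmf (\<lambda>\<omega>. (X \<omega>, Y \<omega>)) p)"
    by (simp_all add: map_pmf_comp)
  then have "map_pmf X p = A" "map_pmf Y p = B"
    unfolding assms map_fst_pair_pmf map_snd_pair_pmf by simp_all
  then show ?thesis using assms by simp
qed


subsection \<open>Messages\<close>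

lemma finite_messages: "finite (carrier F) \<Longrightarrow> finite (messages F L)"
  unfolding messages_def using finite_lists_length_eq[of "carrier F" L] by (simp add: conj_commute)

lemma card_messages: "finite (carrier F) \<Longrightarrow> card (messages F L) = card (carrier F) ^ L"
  unfolding messages_def using card_lists_length_eq[of "carrier F" L] by (simp add: conj_commute)

lemma card_carrier_field_gt_1:
  assumes "field F" "finite (carrier F)"
  shows "1 < card (carrier F)"
proof -
  interpret field F by fact
  have "card {\<zero>\<^bsub>F\<^esub>, \<one>\<^bsub>F\<^esub>} \<le> card (carrier F)"
    using assms by (intro card_mono) auto
  then show ?thesis by simp
qed

lemma messages_nonempty:
  assumes "field F" "finite (carrier F)"
  shows "messages F L \<noteq> {}"
proof -
  have "card (messages F L) \<noteq> 0"
    using card_carrier_field_gt_1[OF assms] assms by (auto simp: card_messages)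
  then show ?thesis by force
qed

lemma add_msg_closed:
  assumes "field F" "w \<in> messages F L" "d \<in> messages F L"
  shows "add_msg F w d \<in> messages F L"
proof -
  interpret field F by fact
  from assms(2,3) show ?thesis
    by (force simp: messages_def add_msg_def set_zip subset_iff in_set_conv_nth)
qed

lemma add_msg_commute:
  assumes "field F" "w \<in> messages F L" "d \<in> messages F L"
  shows "add_msg F w d = add_msg F d w"
proof -
  interpret field F by fact
  from assms(2,3) show ?thesis
    by (auto simp: messages_def add_msg_def subset_iff intro!: nth_equalityI a_comm)
qed

lemma add_msg_inj:
  assumes "field F" "w \<in> messages F L"
  shows "inj_on (add_msg F w) (messages F L)"
proof (rule inj_onI)
  interpret field F by fact
  fix d d' assume d: "d \<in> messages F L" "d' \<in> messages F L" and eq: "add_msg F w d = add_msg F w d'"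
  show "d = d'"
  proof (rule nth_equalityI)
    show "length d = length d'" using d by (simp add: messages_def)
    fix i assume i: "i < length d"
    then have "w ! i \<oplus>\<^bsub>F\<^esub> d ! i = w ! i \<oplus>\<^bsub>F\<^esub> d' ! i"
      using arg_cong[OF eq, of "\<lambda>l. l ! i"] d assms(2) by (simp add: add_msg_def messages_def)
    moreover have "w ! i \<in> carrier F" "d ! i \<in> carrier F" "d' ! i \<in> carrier F"
      using i d assms(2) by (auto simp: messages_def)
    ultimately show "d ! i = d' ! i"
      by (metis r_neg1)
  qed
qed

lemma bij_betw_add_msg:
  assumes "field F" "finite (carrier F)" "w \<in> messages F L"
  shows "bij_betw (add_msg F w) (messages F L) (messages F L)"
  unfolding bij_betw_def using assms endo_inj_surj[of "messages F L" "add_msg F w"]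
  by (auto simp: add_msg_inj add_msg_closed finite_messages image_subset_iff)

lemma map_add_msg_uniform:
  assumes "field F" "finite (carrier F)" "w \<in> messages F L"
  shows "map_pmf (add_msg F w) (pmf_of_set (messages F L)) = pmf_of_set (messages F L)"
  using assms bij_betw_add_msg
  by (intro map_pmf_of_set_bij_betw finite_messages messages_nonempty) auto

lemma map_add_msg_uniform':
  assumes "field F" "finite (carrier F)" "d \<in> messages F L"
  shows "map_pmf (\<lambda>w. add_msg F w d) (pmf_of_set (messages F L)) = pmf_of_set (messages F L)"
proof -
  have "map_pmf (\<lambda>w. add_msg F w d) (pmf_of_set (messages F L)) = map_pmf (add_msg F d) (pmf_of_set (messages F L))"
    using assms by (intro map_pmf_cong) (auto simp: finite_messages messages_nonempty intro: add_msg_commute)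
  then show ?thesis using map_add_msg_uniform[OF assms] by simp
qed


subsection \<open>The law of an update slot\<close>

lemma set_update_law:
  assumes "field F" "finite (carrier F)"
  shows "set_pmf (update_law F L sch \<sigma> D X) =
    {(w, s, d, u). (w, s) \<in> set_pmf \<sigma> \<and> d \<in> messages F L \<and> u \<in> set_pmf (upload sch D X d)}"
  using assms by (auto simp: update_law_def finite_messages messages_nonempty) (force+)?

lemma finite_update_law:
  assumes "field F" "finite (carrier F)" "finite (set_pmf \<sigma>)" "\<And>d. finite (set_pmf (upload sch D X d))"
  shows "finite (set_pmf (update_law F L sch \<sigma> D X))"
  using assms by (auto simp: update_law_def finite_messages messages_nonempty)

text \<open>What the user draws in a slot, separated from the state; \<open>update_law\<close> is
  its product with \<sigma>, and this is the independence condition.\<close>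

definition increment_law :: "'f ring \<Rightarrow> nat \<Rightarrow> ('f, 's, 'u, 'a) scheme \<Rightarrow> nat set \<Rightarrow> nat \<Rightarrow>
    ('f list \<times> (nat \<Rightarrow> 'u)) pmf" where
  "increment_law F L sch D X =
     bind_pmf (pmf_of_set (messages F L)) (\<lambda>d. map_pmf (Pair d) (upload sch D X d))"

lemma update_law_indep:
  "map_pmf (\<lambda>(w, s, d, u). ((d, u), (w, s))) (update_law F L sch \<sigma> D X) =
     pair_pmf (increment_law F L sch D X) \<sigma>"
proof -
  have "map_pmf (\<lambda>(w, s, d, u). ((d, u), (w, s))) (update_law F L sch \<sigma> D X) =
    bind_pmf \<sigma> (\<lambda>ws. bind_pmf (increment_law F L sch D X) (\<lambda>du. return_pmf (du, ws)))"
    by (simp add: update_law_def increment_law_def map_bind_pmf bind_map_pmf bind_assoc_pmf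
        case_prod_unfold map_pmf_def bind_return_pmf)
  also have "\<dots> = pair_pmf (increment_law F L sch D X) \<sigma>"
    unfolding pair_pmf_def by (rule bind_commute_pmf)
  finally show ?thesis .
qed

lemma map_prod_pair_pmf: "map_pmf (map_prod f g) (pair_pmf p q) = pair_pmf (map_pmf f p) (map_pmf g q)"
  by (simp add: pair_map_pmf1 pair_map_pmf2 map_pmf_comp comp_def map_prod_def case_prod_unfold)

lemma map_update_law_indep:
  "map_pmf (\<lambda>(w, s, d, u). (f (d, u), g (w, s))) (update_law F L sch \<sigma> D X) =
     pair_pmf (map_pmf f (increment_law F L sch D X)) (map_pmf g \<sigma>)"
proof -
  have "map_pmf (\<lambda>(w, s, d, u). (f (d, u), g (w, s))) (update_law F L sch \<sigma> D X) =
    map_pmf (map_prod f g) (map_pmf (\<lambda>(w, s, d, u). ((d, u), (w, s))) (update_law F L sch \<sigma> D X))"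
    by (simp add: map_pmf_comp comp_def case_prod_unfold)
  then show ?thesis by (simp add: update_law_indep map_prod_pair_pmf)
qed

lemma update_law_indep':
  fixes f :: "'f list \<times> (nat \<Rightarrow> 'u) \<Rightarrow> 'x" and g :: "'f list \<times> (nat \<Rightarrow> 's) \<Rightarrow> 'y"
    and sch :: "('f, 's, 'u, 'a) scheme"
  defines "X' \<equiv> \<lambda>(w, s, d, u). f (d, u)" and "Y' \<equiv> \<lambda>(w, s, d, u). g (w, s)"
  shows "map_pmf (\<lambda>\<omega>. (X' \<omega>, Y' \<omega>)) (update_law F L sch \<sigma> D X) =
    pair_pmf (map_pmf X' (update_law F L sch \<sigma> D X)) (map_pmf Y' (update_law F L sch \<sigma> D X))"
proof -
  have eq: "map_pmf (\<lambda>\<omega>. (X' \<omega>, Y' \<omega>)) (update_law F L sch \<sigma> D X) =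
    pair_pmf (map_pmf f (increment_law F L sch D X)) (map_pmf g \<sigma>)"
    using map_update_law_indep[of f g F L sch \<sigma> D X] by (simp add: X'_def Y'_def case_prod_unfold)
  have "map_pmf X' (update_law F L sch \<sigma> D X) = map_pmf f (increment_law F L sch D X)"
    using arg_cong[OF eq, of "map_pmf fst"] by (simp add: map_pmf_comp map_fst_pair_pmf)
  moreover have "map_pmf Y' (update_law F L sch \<sigma> D X) = map_pmf g \<sigma>"
    using arg_cong[OF eq, of "map_pmf snd"] by (simp add: map_pmf_comp map_snd_pair_pmf)
  ultimately show ?thesis using eq by simp
qed

lemma map_d_update_law:
  "map_pmf (\<lambda>(w, s, d, u). d) (update_law F L sch \<sigma> D X) = pmf_of_set (messages F L)"
  by (simp add: update_law_def map_bind_pmf case_prod_unfold bind_return_pmf' map_pmf_def bind_assoc_pmf bind_return_pmf)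

lemma log_card_messages:
  assumes "field F" "finite (carrier F)"
  shows "log (qq F) (card (messages F L)) = real L"
  using card_carrier_field_gt_1[OF assms] assms by (simp add: card_messages)


subsection \<open>Entropy bounds for a single slot\<close>

text \<open>Given all old storages and the uploads to \<open>Y\<close>, the increment is still uniform, and it is
  a function of these and, for each \<open>n \<in> R - Y\<close>, of either the upload or the new storage.\<close>

lemma update_cut_bound:
  fixes sch :: "('f, 's, 'u, 'a) scheme"
  assumes F: "field F" "finite (carrier F)"
    and fin: "finite (set_pmf \<sigma>)" "\<And>d. finite (set_pmf (upload sch D X d))"
    and msg: "fst ` set_pmf \<sigma> \<subseteq> messages F L"
    and cs: "coded_storage N Rr Kc S F L \<sigma> fst snd"
    and ok: "update_ok N Rr Kc S F L sch \<sigma> D X"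
    and D: "D \<subseteq> {1..N}" and R: "R \<subseteq> {1..N} - D" "card R + card D = Rr"
    and Y: "Y \<subseteq> R" "card Y = X"
  defines "p \<equiv> update_law F L sch \<sigma> D X"
  shows "real L \<le> (\<Sum>n\<in>R - Y. min (ent (qq F) p (\<lambda>(w, s, d, u). u n))
    (ent (qq F) p (\<lambda>(w, s, d, u). next_storage N sch D X s u n)))"
proof -
  let ?U = "\<lambda>n. ent (qq F) p (\<lambda>(w, s, d, u). u n)"
  let ?S = "\<lambda>n. ent (qq F) p (\<lambda>(w, s, d, u). next_storage N sch D X s u n)"
  have b: "1 < qq F" using card_carrier_field_gt_1[OF F] by simp
  have finp: "finite (set_pmf p)" unfolding p_def using F fin by (rule finite_update_law)
  note E = b finp
  have finR: "finite R" using R(1) by (rule finite_subset) auto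
  have RD: "R \<union> D \<subseteq> {1..N}" "card (R \<union> D) = Rr"
    using R D card_Un_disjoint[OF finR finite_subset[OF D]] by auto
  have "cond_ent (qq F) p (\<lambda>(w, s, d, u). add_msg F w d)
      (\<lambda>\<omega>. restrict ((\<lambda>(w, s, d, u). next_storage N sch D X s u) \<omega>) (R \<union> D)) = 0"
    using ok RD unfolding update_ok_def coded_storage_def Let_def p_def by blast
  then obtain f where f: "\<And>w s d u. (w, s, d, u) \<in> set_pmf p \<Longrightarrow>
      add_msg F w d = f (restrict (next_storage N sch D X s u) (R \<union> D))"
    unfolding cond_ent_eq_0_iff[OF E] by fastforce
  have "cond_ent (qq F) \<sigma> fst (\<lambda>\<omega>. restrict (snd \<omega>) (R \<union> D)) = 0"
    using cs RD unfolding coded_storage_def by blast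
  then obtain g where g: "\<And>w s. (w, s) \<in> set_pmf \<sigma> \<Longrightarrow> w = g (restrict s (R \<union> D))"
    unfolding cond_ent_eq_0_iff[OF b fin(1)] by fastforce
  define Z where "Z = (\<lambda>(w :: 'f list, s :: nat \<Rightarrow> 's, d :: 'f list, u :: nat \<Rightarrow> 'u). (s, restrict u Y))"
  define dd where "dd = (\<lambda>(w :: 'f list, s :: nat \<Rightarrow> 's, d :: 'f list, u :: nat \<Rightarrow> 'u). d)"
  \<comment> \<open>For each server the one of upload and new storage that has the smaller entropy
    is revealed. The sum type lets the choice differ between servers, which puts the minimum inside
    the sum.\<close>
  define T where "T = (\<lambda>n (w :: 'f list, s :: nat \<Rightarrow> 's, d :: 'f list, u).
     if ?S n \<le> ?U n then Inl (next_storage N sch D X s u n) else Inr (u n))"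
  \<comment> \<open>The new storages of \<open>R \<union> D\<close> are recomputed: dropouts keep
    the old storage, servers in \<open>Y\<close> apply the transition to their known upload, and the
    others use the revealed value.\<close>
  define nxt where "nxt = (\<lambda>(s :: nat \<Rightarrow> 's, uY :: nat \<Rightarrow> 'u) t n.
     if n \<in> D then s n else if n \<in> Y then transition sch D X n (s n) (uY n)
     else (case t n of Inl x \<Rightarrow> x | Inr v \<Rightarrow> transition sch D X n (s n) v))"
  have nxt: "restrict (next_storage N sch D X s u) (R \<union> D) =
      restrict (nxt (Z (w, s, d, u)) (restrict (\<lambda>n. T n (w, s, d, u)) (R - Y))) (R \<union> D)" for w s d u
    using R Y RD by (auto simp: fun_eq_iff restrict_def next_storage_def nxt_def Z_def T_def)
  \<comment> \<open>The old storages of \<open>R \<union> D\<close> give the old message, so the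
    increment is found by inverting the addition of that message.\<close>
  define h where "h = (\<lambda>(z, t). the_inv_into (messages F L) (add_msg F (g (restrict (fst z) (R \<union> D))))
      (f (restrict (nxt z t) (R \<union> D))))"
  have h: "dd \<omega> = h (Z \<omega>, restrict (\<lambda>n. T n \<omega>) (R - Y))" if "\<omega> \<in> set_pmf p" for \<omega>
  proof -
    obtain w s d u where \<omega>: "\<omega> = (w, s, d, u)" by (cases \<omega>)
    from that have ws: "(w, s) \<in> set_pmf \<sigma>" and d: "d \<in> messages F L"
      unfolding \<omega> p_def set_update_law[OF F] by auto
    have w: "w \<in> messages F L" using msg ws by force
    have "h (Z \<omega>, restrict (\<lambda>n. T n \<omega>) (R - Y)) = the_inv_into (messages F L) (add_msg F w) (add_msg F w d)"
      using g[OF ws] f[of w s d u] that nxt[of s u w d] by (simp add: \<omega> h_def Z_def)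
    also have "\<dots> = d"
      using add_msg_inj[OF F(1) w] d by (rule the_inv_into_f_f)
    finally show ?thesis by (simp add: dd_def \<omega>)
  qed
  have "ent (qq F) p (\<lambda>\<omega>. (Z \<omega>, dd \<omega>)) \<le> ent (qq F) p (\<lambda>\<omega>. (Z \<omega>, restrict (\<lambda>n. T n \<omega>) (R - Y)))"
    by (rule ent_fun_le[OF E, where f = "\<lambda>v. (fst v, h v)"]) (simp add: h)
  also have "\<dots> \<le> ent (qq F) p Z + (\<Sum>n\<in>R - Y. ent (qq F) p (T n))"
    using finR by (intro ent_restrict_le[OF E]) auto
  also have "(\<Sum>n\<in>R - Y. ent (qq F) p (T n)) \<le> (\<Sum>n\<in>R - Y. min (?U n) (?S n))"
  proof (rule sum_mono)
    fix n
    show "ent (qq F) p (T n) \<le> min (?U n) (?S n)"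
    proof (cases "?S n \<le> ?U n")
      case True
      have "ent (qq F) p (T n) \<le> ?S n"
        by (rule ent_fun_le[OF E, where f = Inl]) (auto simp: T_def True)
      then show ?thesis using True by simp
    next
      case False
      have "ent (qq F) p (T n) \<le> ?U n"
        by (rule ent_fun_le[OF E, where f = Inr]) (auto simp: T_def False)
      then show ?thesis using False by simp
    qed
  qed
  finally have upper: "ent (qq F) p (\<lambda>\<omega>. (Z \<omega>, dd \<omega>)) \<le> ent (qq F) p Z + (\<Sum>n\<in>R - Y. min (?U n) (?S n))"
    by simp
  define uY where "uY = (\<lambda>(w :: 'f list, s :: nat \<Rightarrow> 's, d :: 'f list, u :: nat \<Rightarrow> 'u). restrict u Y)"
  define ss where "ss = (\<lambda>(w :: 'f list, s :: nat \<Rightarrow> 's, d :: 'f list, u :: nat \<Rightarrow> 'u). s)"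
  have "mut_inf (qq F) p dd uY = 0"
    using ok Y R unfolding update_ok_def Let_def p_def dd_def uY_def by blast
  then have 1: "ent (qq F) p (\<lambda>\<omega>. (uY \<omega>, dd \<omega>)) = ent (qq F) p dd + ent (qq F) p uY"
    by (simp add: mut_inf_eq[OF E])
  have 2: "ent (qq F) p dd = real L"
    using ent_uniform[OF E, of dd "messages F L"] log_card_messages[OF F, of L]
    by (simp add: map_d_update_law p_def dd_def finite_messages messages_nonempty F)
  have 3: "ent (qq F) p (\<lambda>\<omega>. (ss \<omega>, (uY \<omega>, dd \<omega>))) = ent (qq F) p (\<lambda>\<omega>. (uY \<omega>, dd \<omega>)) + ent (qq F) p ss"
    using update_law_indep'[of "\<lambda>(d, u). (restrict u Y, d)" "\<lambda>(w, s). s" F L sch \<sigma> D X]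
    by (intro ent_Pair_indep[OF E]) (simp add: p_def uY_def dd_def ss_def case_prod_unfold)
  have 4: "ent (qq F) p Z \<le> ent (qq F) p ss + ent (qq F) p uY"
    using ent_Pair[OF E, of ss uY] cond_ent_le[OF E, of uY ss]
    by (simp add: Z_def uY_def ss_def case_prod_unfold)
  have 5: "ent (qq F) p (\<lambda>\<omega>. (ss \<omega>, (uY \<omega>, dd \<omega>))) \<le> ent (qq F) p (\<lambda>\<omega>. (Z \<omega>, dd \<omega>))"
    by (rule ent_fun_le[OF E, where f = "\<lambda>((a, b), c). (a, (b, c))"])
       (auto simp: Z_def uY_def ss_def dd_def)
  \<comment> \<open>Independence and security make the joint entropy of \<open>Z\<close> and the
    increment at least \<open>H(ss) + H(uY) + L\<close>, whereas \<open>Z\<close> alone has at most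
    \<open>H(ss) + H(uY)\<close>; the revealed values account for the gap \<open>L\<close>.\<close>
  from upper 1 2 3 4 5 show ?thesis by linarith
qed

text \<open>Stated as an identity of laws and not of entropies, because it has to be carried through
  later update steps.\<close>

definition uniform_given :: "'f ring \<Rightarrow> nat \<Rightarrow> ('f list \<times> (nat \<Rightarrow> 's)) pmf \<Rightarrow> nat set \<Rightarrow> bool" where
  "uniform_given F L \<sigma> Y \<longleftrightarrow> map_pmf (\<lambda>(w, s). (w, restrict s Y)) \<sigma> =
     pair_pmf (pmf_of_set (messages F L)) (map_pmf (\<lambda>(w, s). restrict s Y) \<sigma>)"

text \<open>The answers of \<open>Y\<close> are independent of the uniform message, so the remaining
  answers must supply all \<open>L\<close> units of it.\<close>

lemma read_cut_bound:
  fixes sch :: "('f, 's, 'u, 'a) scheme"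
  assumes F: "field F" "finite (carrier F)" and fin: "finite (set_pmf \<sigma>)"
    and ug: "uniform_given F L \<sigma> Y"
    and ok: "read_ok N F sch \<sigma> D" and Y: "Y \<subseteq> {1..N} - D"
  shows "real L \<le> (\<Sum>n\<in>{1..N} - Y - D. ent (qq F) \<sigma> (\<lambda>(w, s). answer sch D n (s n)))"
proof -
  have b: "1 < qq F" using card_carrier_field_gt_1[OF F] by simp
  note E = b fin
  define ww where "ww = (\<lambda>(w :: 'f list, s :: nat \<Rightarrow> 's). w)"
  define aY where "aY = (\<lambda>(w :: 'f list, s). restrict (\<lambda>n. answer sch D n (s n)) Y)"
  define A where "A = (\<lambda>n (w :: 'f list, s). answer sch D n (s n))"
  let ?r = "\<lambda>s. restrict (\<lambda>n. answer sch D n (s n)) Y"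
  have "map_pmf (\<lambda>\<omega>. (ww \<omega>, aY \<omega>)) \<sigma> = map_pmf (map_prod id ?r) (map_pmf (\<lambda>(w, s). (w, restrict s Y)) \<sigma>)"
    by (simp add: map_pmf_comp ww_def aY_def case_prod_unfold cong: restrict_cong)
  also have "\<dots> = pair_pmf (pmf_of_set (messages F L)) (map_pmf ?r (map_pmf (\<lambda>(w, s). restrict s Y) \<sigma>))"
    using ug unfolding uniform_given_def by (simp add: map_prod_pair_pmf)
  also have "map_pmf ?r (map_pmf (\<lambda>(w, s). restrict s Y) \<sigma>) = map_pmf aY \<sigma>"
    by (simp add: map_pmf_comp aY_def case_prod_unfold cong: restrict_cong)
  finally have indep: "map_pmf (\<lambda>\<omega>. (ww \<omega>, aY \<omega>)) \<sigma> = pair_pmf (pmf_of_set (messages F L)) (map_pmf aY \<sigma>)" .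
  have w: "map_pmf ww \<sigma> = pmf_of_set (messages F L)"
    using arg_cong[OF indep, of "map_pmf fst"] by (simp add: map_pmf_comp map_fst_pair_pmf)
  have 1: "ent (qq F) \<sigma> (\<lambda>\<omega>. (aY \<omega>, ww \<omega>)) = real L + ent (qq F) \<sigma> aY"
    using ent_Pair_indep[OF E, of ww aY] ent_uniform[OF E w] indep w log_card_messages[OF F, of L]
    by (simp add: finite_messages messages_nonempty F)
  have "cond_ent (qq F) \<sigma> ww (\<lambda>(w, s). restrict (\<lambda>n. answer sch D n (s n)) ({1..N} - D)) = 0"
    using ok unfolding read_ok_def ww_def by blast
  then obtain f where f: "\<And>w s. (w, s) \<in> set_pmf \<sigma> \<Longrightarrow>
      w = f (restrict (\<lambda>n. answer sch D n (s n)) ({1..N} - D))"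
    unfolding cond_ent_eq_0_iff[OF E] ww_def by fastforce
  let ?B = "{1..N} - Y - D"
  have "ent (qq F) \<sigma> (\<lambda>\<omega>. (aY \<omega>, ww \<omega>)) \<le> ent (qq F) \<sigma> (\<lambda>\<omega>. (aY \<omega>, restrict (\<lambda>n. A n \<omega>) ?B))"
  proof (rule ent_fun_le[OF E, where f = "\<lambda>(x, y). (x, f (restrict (\<lambda>n. if n \<in> Y then x n else y n) ({1..N} - D)))"])
    fix \<omega> assume "\<omega> \<in> set_pmf \<sigma>"
    moreover obtain w s where \<omega>: "\<omega> = (w, s)" by (cases \<omega>)
    moreover have "restrict (\<lambda>n. if n \<in> Y then aY \<omega> n else restrict (\<lambda>n. A n \<omega>) ?B n) ({1..N} - D) =
        restrict (\<lambda>n. answer sch D n (s n)) ({1..N} - D)"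
      using Y by (auto simp: fun_eq_iff aY_def A_def \<omega> restrict_def)
    ultimately show "(aY \<omega>, ww \<omega>) = (\<lambda>(x, y). (x, f (restrict (\<lambda>n. if n \<in> Y then x n else y n) ({1..N} - D))))
        (aY \<omega>, restrict (\<lambda>n. A n \<omega>) ?B)"
      using f[of w s] by (simp only: ww_def prod.case)
  qed
  also have "\<dots> \<le> ent (qq F) \<sigma> aY + (\<Sum>n\<in>?B. ent (qq F) \<sigma> (A n))"
    by (intro ent_restrict_le[OF E]) auto
  finally show ?thesis using 1 by (simp add: A_def)
qed


subsection \<open>Uniformity of the message given few storages\<close>

text \<open>The product form becomes resampling: replacing the message by a fresh uniform one leaves
  the law unchanged. In this form the monad laws apply.\<close>

lemma uniform_given_iff:
  "uniform_given F L \<sigma> Y \<longleftrightarrow> map_pmf (\<lambda>(w, s). (w, restrict s Y)) \<sigma> =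
     bind_pmf \<sigma> (\<lambda>(w, s). map_pmf (\<lambda>w. (w, restrict s Y)) (pmf_of_set (messages F L)))"
proof -
  have "pair_pmf (pmf_of_set (messages F L)) (map_pmf (\<lambda>(w, s). restrict s Y) \<sigma>) =
    bind_pmf \<sigma> (\<lambda>(w, s). map_pmf (\<lambda>w. (w, restrict s Y)) (pmf_of_set (messages F L)))"
    unfolding pair_pmf_def
    by (subst bind_commute_pmf) (simp add: map_pmf_def bind_assoc_pmf bind_return_pmf case_prod_unfold)
  then show ?thesis unfolding uniform_given_def by simp
qed

abbreviation update_step where
  "update_step N F L sch D X \<sigma> \<equiv> map_pmf (\<lambda>(w, s, d, u). (add_msg F w d, next_storage N sch D X s u))
     (update_law F L sch \<sigma> D X)"

text \<open>A one-time pad: the fresh increment masks the old message, and the dropouts keep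
  storages that were fixed before the increment was drawn.\<close>

lemma uniform_given_dropouts:
  assumes F: "field F" "finite (carrier F)" and msg: "fst ` set_pmf \<sigma> \<subseteq> messages F L"
    and "Y \<subseteq> D"
  shows "uniform_given F L (update_step N F L sch D X \<sigma>) Y"
proof -
  let ?M = "pmf_of_set (messages F L)"
  have r: "restrict (next_storage N sch D X s u) Y = restrict s Y" for s u
    using assms(4) by (auto simp: next_storage_def restrict_def fun_eq_iff)
  have "map_pmf (\<lambda>(w, s). (w, restrict s Y)) (update_step N F L sch D X \<sigma>) =
     bind_pmf \<sigma> (\<lambda>(w, s). map_pmf (\<lambda>d. (add_msg F w d, restrict s Y)) ?M)"
    by (simp add: map_pmf_comp update_law_def map_bind_pmf case_prod_unfold r map_pmf_def bind_assoc_pmf bind_return_pmf)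
  also have "\<dots> = bind_pmf \<sigma> (\<lambda>(w, s). map_pmf (\<lambda>w. (w, restrict s Y)) (map_pmf (add_msg F w) ?M))"
    by (simp add: map_pmf_comp)
  also have "\<dots> = bind_pmf \<sigma> (\<lambda>(w, s). map_pmf (\<lambda>w. (w, restrict s Y)) ?M)"
    using msg by (intro bind_pmf_cong) (auto simp: map_add_msg_uniform[OF F])
  also have "\<dots> = bind_pmf (update_step N F L sch D X \<sigma>) (\<lambda>(w, s). map_pmf (\<lambda>w. (w, restrict s Y)) ?M)"
    by (simp add: bind_map_pmf update_law_def bind_assoc_pmf bind_return_pmf case_prod_unfold r)
  finally show ?thesis unfolding uniform_given_iff .
qed

text \<open>For a fixed increment and fixed uploads, adding the increment permutes the messages, and
  the new storages in \<open>Y\<close> depend on the old state only through \<open>Y\<close>. The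
  user's draw is independent of the state, so averaging over it preserves the property.\<close>

lemma uniform_given_update:
  assumes F: "field F" "finite (carrier F)" and ug: "uniform_given F L \<sigma> Y"
  shows "uniform_given F L (update_step N F L sch D X \<sigma>) Y"
proof -
  let ?M = "pmf_of_set (messages F L)"
  let ?n = "\<lambda>s u. restrict (next_storage N sch D X s u) Y"
  let ?I = "increment_law F L sch D X"
  have n: "?n (restrict s Y) u = ?n s u" for s u
    by (auto simp: next_storage_def restrict_def fun_eq_iff)
  have law: "update_law F L sch \<sigma> D X = bind_pmf ?I (\<lambda>(d, u). map_pmf (\<lambda>(w, s). (w, s, d, u)) \<sigma>)"
  proof -
    have "update_law F L sch \<sigma> D X = map_pmf (\<lambda>((d, u), (w, s)). (w, s, d, u)) 
      (map_pmf (\<lambda>(w, s, d, u). ((d, u), (w, s))) (update_law F L sch \<sigma> D X))"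
      by (simp add: map_pmf_comp case_prod_unfold)
    also have "\<dots> = bind_pmf ?I (\<lambda>(d, u). map_pmf (\<lambda>(w, s). (w, s, d, u)) \<sigma>)"
      unfolding update_law_indep by (simp add: pair_pmf_def map_pmf_def bind_assoc_pmf bind_return_pmf case_prod_unfold)
    finally show ?thesis .
  qed
  have I: "fst ` set_pmf ?I \<subseteq> messages F L"
    by (auto simp: increment_law_def finite_messages messages_nonempty F)
  have "map_pmf (\<lambda>(w, s). (w, restrict s Y)) (update_step N F L sch D X \<sigma>) =
     bind_pmf ?I (\<lambda>(d, u). map_pmf (\<lambda>(w, s). (add_msg F w d, ?n s u)) \<sigma>)"
    by (simp add: law map_bind_pmf case_prod_unfold map_pmf_comp)
  also have "\<dots> = bind_pmf ?I (\<lambda>(d, u). map_pmf (\<lambda>(w, r). (add_msg F w d, ?n r u))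
       (map_pmf (\<lambda>(w, s). (w, restrict s Y)) \<sigma>))"
    by (simp add: map_pmf_comp case_prod_unfold n)
  also have "\<dots> = bind_pmf ?I (\<lambda>(d, u). bind_pmf \<sigma> (\<lambda>(w, s). map_pmf (\<lambda>w. (w, ?n s u)) (map_pmf (\<lambda>w. add_msg F w d) ?M)))"
    unfolding ug[unfolded uniform_given_iff] by (simp add: map_bind_pmf map_pmf_comp case_prod_unfold n)
  also have "\<dots> = bind_pmf ?I (\<lambda>(d, u). bind_pmf \<sigma> (\<lambda>(w, s). map_pmf (\<lambda>w. (w, ?n s u)) ?M))"
    using I by (intro bind_pmf_cong refl) (auto simp: map_add_msg_uniform'[OF F])
  also have "\<dots> = bind_pmf (update_step N F L sch D X \<sigma>) (\<lambda>(w, s). map_pmf (\<lambda>w. (w, restrict s Y)) ?M)"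
    by (simp add: law bind_map_pmf bind_assoc_pmf case_prod_unfold)
  finally show ?thesis unfolding uniform_given_iff .
qed

text \<open>Carries the storage conditions from the sample space of an update slot to the law of the
  next state.\<close>

lemma coded_storage_map:
  fixes F :: "'f ring"
  assumes b: "1 < qq F" and fin: "finite (set_pmf p)"
  shows "coded_storage N Rr Kc S F L (map_pmf g p) fst snd \<longleftrightarrow>
    coded_storage N Rr Kc S F L p (\<lambda>\<omega>. fst (g \<omega>)) (\<lambda>\<omega>. snd (g \<omega>))"
proof -
  have fin': "finite (set_pmf (map_pmf g p))" using fin by simp
  have "ent (qq F) (map_pmf g p) (\<lambda>\<omega>. snd \<omega> n) = ent (qq F) p (\<lambda>\<omega>. snd (g \<omega>) n)" for n
    by (rule ent_map_eq[OF b fin' fin]) (simp add: map_pmf_comp)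
  then show ?thesis
    unfolding coded_storage_def cond_ent_eq_0_iff[OF b fin] cond_ent_eq_0_iff[OF b fin'] by auto
qed


subsection \<open>The linear program\<close>

text \<open>Common form of \<open>V_read\<close> and \<open>V_update\<close>, so that a single
  optimum serves both.\<close>

definition lp_region :: "nat \<Rightarrow> nat \<Rightarrow> nat \<Rightarrow> nat set \<Rightarrow> nat \<Rightarrow> (nat \<Rightarrow> real) set" where
  "lp_region N Kc S D k = {v \<in> {1..N} \<rightarrow>\<^sub>E {0..}.
     (\<forall>T. T \<subseteq> {1..N} - D \<and> card T = k \<longrightarrow> (\<Sum>n\<in>T. v n) \<ge> 1) \<and>
     (\<forall>n\<in>{1..S} - D. v n \<le> 1 / real Kc)}"

text \<open>Equal shares if the cap allows them. Otherwise the capped servers are full, and the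
  others share equally what a \<open>k\<close>-subset containing all capped servers still
  lacks.\<close>

definition lp_opt :: "nat \<Rightarrow> nat \<Rightarrow> nat set \<Rightarrow> nat \<Rightarrow> nat \<Rightarrow> real" where
  "lp_opt Kc S D k n = (if Kc \<le> k then 1 / real k else if n \<le> S then 1 / real Kc
     else (1 - real (card ({1..S} - D)) / real Kc) / real (k - card ({1..S} - D)))"

text \<open>The elements outside a \<open>k\<close>-subset of minimal sum are at least its average.\<close>

lemma sum_ge_of_subset_sums:
  fixes v :: "'b \<Rightarrow> real"
  assumes fin: "finite A" and k: "1 \<le> k" "k \<le> card A"
    and sums: "\<And>T. T \<subseteq> A \<Longrightarrow> card T = k \<Longrightarrow> t \<le> sum v T"
  shows "t * real (card A) / real k \<le> sum v A"
proof -
  let ?C = "{T. T \<subseteq> A \<and> card T = k}"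
  have "finite ?C" "?C \<noteq> {}"
    using fin k(2) obtain_subset_with_card_n[of k A] by auto
  then obtain T where "is_arg_min (sum v) (\<lambda>T. T \<in> ?C) T"
    using ex_is_arg_min_if_finite by blast
  then have T: "T \<subseteq> A" "card T = k" and min: "\<And>T'. T' \<subseteq> A \<Longrightarrow> card T' = k \<Longrightarrow> sum v T \<le> sum v T'"
    by (auto simp: is_arg_min_linorder)
  have finT: "finite T" using T fin finite_subset by auto
  have "sum v T / real k \<le> v x" if "x \<in> A - T" for x
  proof -
    have "v y \<le> v x" if "y \<in> T" for y
    proof -
      have "card (insert x (T - {y})) = k"
        using \<open>x \<in> A - T\<close> that finT T(2) k(1) by (simp add: card_Diff_singleton)
      then have "sum v T \<le> sum v (insert x (T - {y}))"
        using \<open>x \<in> A - T\<close> T by (intro min) auto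
      also have "\<dots> = v x + (sum v T - v y)"
        using \<open>x \<in> A - T\<close> that finT by (simp add: sum_diff1)
      finally show ?thesis by simp
    qed
    then have "sum v T \<le> real (card T) * v x" by (rule sum_bounded_above)
    then show ?thesis using T k by (simp add: field_simps)
  qed
  then have "real (card (A - T)) * (sum v T / real k) \<le> sum v (A - T)"
    by (rule sum_bounded_below)
  moreover have "real (card (A - T)) = real (card A) - real k"
    using T k finT by (simp add: card_Diff_subset of_nat_diff)
  moreover have "sum v A = sum v T + sum v (A - T)"
    using sum.subset_diff[OF T(1) fin, of v] by simp
  ultimately have "sum v T + (real (card A) - real k) * (sum v T / real k) \<le> sum v A" by simp
  also have "sum v T + (real (card A) - real k) * (sum v T / real k) = sum v T * real (card A) / real k"
    using k by (simp add: field_simps)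
  finally have "sum v T * real (card A) / real k \<le> sum v A" .
  moreover have "t * real (card A) / real k \<le> sum v T * real (card A) / real k"
    using sums[OF T] by (intro divide_right_mono mult_right_mono) auto
  ultimately show ?thesis by linarith
qed

context
  fixes N Kc S k :: nat and D :: "nat set"
  assumes SN: "S \<le> N" and Kc: "1 \<le> Kc" and D: "D \<subseteq> {1..N}"
    and k: "1 \<le> k" "k \<le> card ({1..N} - D)" "k < Kc \<Longrightarrow> card ({1..S} - D) < k"
begin

abbreviation (input) "cS \<equiv> card ({1..S} - D)"

lemma lp_opt_ge: "k < Kc \<Longrightarrow> 1 / real Kc \<le> (1 - real cS / real Kc) / real (k - cS)"
  using k(3) Kc by (simp add: field_simps of_nat_diff)

lemma lp_opt_in_region: "restrict (lp_opt Kc S D k) {1..N} \<in> lp_region N Kc S D k"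
proof -
  have nonneg: "0 \<le> lp_opt Kc S D k n" for n
    using lp_opt_ge Kc k by (auto simp: lp_opt_def intro: order_trans[of 0 "1 / real Kc"])
  have "1 \<le> (\<Sum>n\<in>T. lp_opt Kc S D k n)" if T: "T \<subseteq> {1..N} - D" "card T = k" for T
  proof (cases "Kc \<le> k")
    case True
    then show ?thesis using T k by (simp add: lp_opt_def)
  next
    case False
    then have c: "cS < k" using k(3) by simp
    have finT: "finite T" using T finite_subset by fastforce
    let ?y = "(1 - real cS / real Kc) / real (k - cS)"
    let ?C = "T \<inter> {..S}"
    have t: "card ?C \<le> cS" by (rule card_mono) (use T in auto)
    have "(\<Sum>n\<in>T. lp_opt Kc S D k n) = (\<Sum>n\<in>?C. lp_opt Kc S D k n) + (\<Sum>n\<in>T - ?C. lp_opt Kc S D k n)"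
      using finT by (metis Int_lower1 add.commute sum.subset_diff)
    also have "\<dots> = real (card ?C) / real Kc + real (card (T - ?C)) * ?y"
      using False by (simp add: lp_opt_def)
    also have "real (card (T - ?C)) = real k - real (card ?C)"
      using finT T(2) card_mono[OF finT, of ?C] by (simp add: card_Diff_subset_Int of_nat_diff)
    finally have eq: "(\<Sum>n\<in>T. lp_opt Kc S D k n) =
      real (card ?C) / real Kc + (real k - real (card ?C)) * ?y" .
    \<comment> \<open>An uncapped share is at least the cap, so a subset with fewer capped servers
      has no smaller sum; with all capped servers the sum is exactly 1.\<close>
    have "(real cS - real (card ?C)) * (1 / real Kc) \<le> (real cS - real (card ?C)) * ?y"
      using lp_opt_ge False t by (intro mult_left_mono) auto
    moreover have "(real k - real cS) * ?y = 1 - real cS / real Kc"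
      using c by (simp add: of_nat_diff)
    ultimately show ?thesis unfolding eq by (simp add: algebra_simps diff_divide_distrib)
  qed
  then have "1 \<le> (\<Sum>n\<in>T. restrict (lp_opt Kc S D k) {1..N} n)" if "T \<subseteq> {1..N} - D" "card T = k" for T
    using that by (subst sum.cong[OF refl, of T _ "lp_opt Kc S D k"]) auto
  moreover have "lp_opt Kc S D k n \<le> 1 / real Kc" if "n \<in> {1..S} - D" for n
    using that Kc by (auto simp: lp_opt_def field_simps)
  ultimately show ?thesis using nonneg SN unfolding lp_region_def by auto
qed

lemma lp_opt_le:
  assumes v: "v \<in> lp_region N Kc S D k"
  shows "(\<Sum>n\<in>{1..N} - D. lp_opt Kc S D k n) \<le> (\<Sum>n\<in>{1..N} - D. v n)"
proof (cases "Kc \<le> k")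
  case True
  have "1 * real (card ({1..N} - D)) / real k \<le> sum v ({1..N} - D)"
    using v k by (intro sum_ge_of_subset_sums) (auto simp: lp_region_def)
  then show ?thesis using True by (simp add: lp_opt_def)
next
  case False
  then have c: "cS < k" using k(3) by simp
  let ?A = "{1..N} - D" and ?C = "{1..S} - D"
  have CA: "?C \<subseteq> ?A" using SN by auto
  define s where "s = sum v ?C"
  define a where "a = real (card ?A) - real cS"
  define r where "r = a / (real k - real cS)"
  have cardAC: "card (?A - ?C) = card ?A - cS"
    using CA by (intro card_Diff_subset) auto
  have cA: "cS \<le> card ?A" using CA by (intro card_mono) auto
  have split: "sum f ?A = sum f (?A - ?C) + sum f ?C" for f :: "nat \<Rightarrow> real"
    using CA by (intro sum.subset_diff) auto
  have "s \<le> real cS * (1 / real Kc)"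
    unfolding s_def using v by (intro sum_bounded_above) (auto simp: lp_region_def)
  then have s: "s \<le> real cS / real Kc" by simp
  \<comment> \<open>Together with all capped servers, \<open>k - cS\<close> of the others form a
    \<open>k\<close>-subset; the averaging bound therefore applies to the others with threshold
    \<open>1 - s\<close>.\<close>
  have "(1 - s) * real (card (?A - ?C)) / real (k - cS) \<le> sum v (?A - ?C)"
  proof (rule sum_ge_of_subset_sums)
    fix T assume T: "T \<subseteq> ?A - ?C" "card T = k - cS"
    have "finite T" using T finite_subset[of T "?A - ?C"] by simp
    then have "card (T \<union> ?C) = k" using T c by (subst card_Un_disjoint) auto
    then have "1 \<le> sum v (T \<union> ?C)"
    proof -
      have "T \<union> ?C \<subseteq> ?A" using T CA by blast
      then show ?thesis using v \<open>card (T \<union> ?C) = k\<close> unfolding lp_region_def by blast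
    qed
    also have "\<dots> = sum v T + s"
      unfolding s_def using T \<open>finite T\<close> by (intro sum.union_disjoint) auto
    finally show "1 - s \<le> sum v T" by simp
  qed (use c k cardAC in auto)
  then have "(1 - s) * r \<le> sum v (?A - ?C)"
    unfolding cardAC r_def a_def using c cA by (simp add: of_nat_diff)
  then have 1: "s + (1 - s) * r \<le> sum v ?A" using split[of v] by (simp add: s_def)
  \<comment> \<open>As \<open>r \<ge> 1\<close>, the bound \<open>s + (1 - s) * r\<close> does not
    increase with \<open>s\<close>, so it is least at the largest possible value
    \<open>cS / Kc\<close> of \<open>s\<close>.\<close>
  have "1 \<le> r" using c k cA by (simp add: r_def a_def field_simps)
  then have "0 \<le> (real cS / real Kc - s) * (r - 1)"
    using s by (intro mult_nonneg_nonneg) auto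
  moreover have "(x - s) * (r - 1) = s + (1 - s) * r - (x + (1 - x) * r)" for x
    by (simp add: algebra_simps)
  ultimately have 2: "real cS / real Kc + (1 - real cS / real Kc) * r \<le> s + (1 - s) * r"
    by (simp only: diff_ge_0_iff_ge)
  have "sum (lp_opt Kc S D k) (?A - ?C) = a * ((1 - real cS / real Kc) / real (k - cS))"
  proof -
    have "real (card (?A - ?C)) = a" unfolding cardAC a_def using cA by (simp add: of_nat_diff)
    moreover have "sum (lp_opt Kc S D k) (?A - ?C) =
        (\<Sum>n\<in>?A - ?C. (1 - real cS / real Kc) / real (k - cS))"
      using False by (intro sum.cong) (auto simp: lp_opt_def)
    ultimately show ?thesis by simp
  qed
  then have "sum (lp_opt Kc S D k) (?A - ?C) = (1 - real cS / real Kc) * r"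
    using c by (simp add: r_def of_nat_diff)
  moreover have "sum (lp_opt Kc S D k) ?C = real cS / real Kc"
    using False by (simp add: lp_opt_def)
  ultimately have "sum (lp_opt Kc S D k) ?A = real cS / real Kc + (1 - real cS / real Kc) * r"
    using split[of "lp_opt Kc S D k"] by simp
  then show ?thesis using 1 2 by linarith
qed

lemma is_min_over_lp_region:
  "is_min_over N D (lp_region N Kc S D k) (\<Sum>n\<in>{1..N} - D. lp_opt Kc S D k n)"
proof -
  let ?v = "restrict (lp_opt Kc S D k) {1..N}"
  have eq: "(\<Sum>n\<in>{1..N} - D. ?v n) = (\<Sum>n\<in>{1..N} - D. lp_opt Kc S D k n)"
    by (intro sum.cong) auto
  have "is_arg_min (\<lambda>v. \<Sum>n\<in>{1..N} - D. v n) (\<lambda>v. v \<in> lp_region N Kc S D k) ?v"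
    unfolding is_arg_min_def using lp_opt_in_region lp_opt_le eq by (auto simp: not_less)
  then show ?thesis unfolding is_min_over_def using eq by metis
qed

end

text \<open>Complements within the available servers exchange the excluded sets and the summed
  ones.\<close>

lemma V_read_eq_lp_region:
  assumes "D \<subseteq> {1..N}" "card D \<le> N - Rr" "Om Rr Kc S \<le> Rr" "Rr \<le> N"
  shows "V_read N Rr Kc S D = lp_region N Kc S D (N - card D - Om Rr Kc S)"
proof -
  let ?A = "{1..N} - D"
  have finD: "finite D" using assms(1) by (rule finite_subset) auto
  have cA: "card ?A = N - card D" using assms(1) finD by (simp add: card_Diff_subset)
  have "(\<forall>Y. Y \<subseteq> ?A \<and> card Y = Om Rr Kc S \<longrightarrow> (\<Sum>n\<in>{1..N} - Y - D. v n) \<ge> 1) \<longleftrightarrow>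
    (\<forall>T. T \<subseteq> ?A \<and> card T = N - card D - Om Rr Kc S \<longrightarrow> (\<Sum>n\<in>T. v n) \<ge> (1::real))" (is "?l \<longleftrightarrow> ?r") for v
  proof
    assume ?l
    show ?r
    proof (intro allI impI, elim conjE)
      fix T assume T: "T \<subseteq> ?A" "card T = N - card D - Om Rr Kc S"
      then have finT: "finite T" using finite_subset[of T ?A] by simp
      have "card (?A - T) = Om Rr Kc S" using T finT cA assms by (simp add: card_Diff_subset)
      then have "(\<Sum>n\<in>{1..N} - (?A - T) - D. v n) \<ge> 1"
        using \<open>?l\<close>[rule_format, of "?A - T"] by (metis Diff_subset)
      moreover have "{1..N} - (?A - T) - D = T" using T by auto
      ultimately show "(\<Sum>n\<in>T. v n) \<ge> 1" by simp
    qed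
  next
    assume ?r
    show ?l
    proof (intro allI impI, elim conjE)
      fix Y assume Y: "Y \<subseteq> ?A" "card Y = Om Rr Kc S"
      then have finY: "finite Y" using finite_subset[of Y ?A] by simp
      have "{1..N} - Y - D = ?A - Y" by auto
      moreover have "card (?A - Y) = N - card D - Om Rr Kc S"
        using Y finY cA by (simp add: card_Diff_subset)
      ultimately show "(\<Sum>n\<in>{1..N} - Y - D. v n) \<ge> 1" using \<open>?r\<close> by (metis Diff_subset)
    qed
  qed
  then show ?thesis unfolding V_read_def lp_region_def by simp
qed

text \<open>Only the difference \<open>R - Y\<close> matters: a set of
  \<open>Rr - card D - X\<close> available servers always has room for \<open>X\<close> more,
  because \<open>Rr \<le> N\<close>.\<close>

lemma V_update_eq_lp_region:
  assumes "D \<subseteq> {1..N}" "card D + X \<le> Rr" "Rr \<le> N"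
  shows "V_update N Rr Kc S D X = lp_region N Kc S D (Rr - card D - X)"
proof -
  let ?A = "{1..N} - D"
  have finD: "finite D" using assms(1) by (rule finite_subset) auto
  have cA: "card ?A = N - card D" using assms(1) finD by (simp add: card_Diff_subset)
  have "(\<forall>R Y. R \<subseteq> ?A \<and> int (card R) = int Rr - int (card D) \<and> Y \<subseteq> R \<and> card Y = X \<longrightarrow>
        (\<Sum>n\<in>R - Y. v n) \<ge> 1) \<longleftrightarrow>
    (\<forall>T. T \<subseteq> ?A \<and> card T = Rr - card D - X \<longrightarrow> (\<Sum>n\<in>T. v n) \<ge> (1::real))" (is "?l \<longleftrightarrow> ?r") for v
  proof
    assume ?l
    show ?r
    proof (intro allI impI, elim conjE)
      fix T assume T: "T \<subseteq> ?A" "card T = Rr - card D - X"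
      then have finT: "finite T" using finite_subset[of T ?A] by simp
      have "X \<le> card (?A - T)" using T finT cA assms by (simp add: card_Diff_subset)
      then obtain Y where Y: "Y \<subseteq> ?A - T" "card Y = X" "finite Y" by (rule obtain_subset_with_card_n)
      have "card (T \<union> Y) = card T + card Y" using finT Y by (intro card_Un_disjoint) auto
      then have "int (card (T \<union> Y)) = int Rr - int (card D)" using T Y assms by simp
      then have "(\<Sum>n\<in>(T \<union> Y) - Y. v n) \<ge> 1"
        using T Y by (intro \<open>?l\<close>[rule_format, of "T \<union> Y" Y]) auto
      moreover have "(T \<union> Y) - Y = T" using Y by auto
      ultimately show "(\<Sum>n\<in>T. v n) \<ge> 1" by simp
    qed
  next
    assume ?r
    show ?l
    proof (intro allI impI, elim conjE)
      fix R Y assume R: "R \<subseteq> ?A" "int (card R) = int Rr - int (card D)" "Y \<subseteq> R" "card Y = X"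
      then have "finite Y" by (rule_tac finite_subset[of _ "{1..N}"]) auto
      then have "card (R - Y) = Rr - card D - X" using R by (simp add: card_Diff_subset)
      then show "(\<Sum>n\<in>R - Y. v n) \<ge> 1" using \<open>?r\<close> R by (metis Diff_subset order_trans)
    qed
  qed
  then show ?thesis unfolding V_update_def lp_region_def by simp
qed

text \<open>The value \<open>min Kc (S + 1)\<close> merges the two cases of feasibility. It is the
  smallest effective number of servers that a read, or an update with
  \<open>card D + X \<le> Om\<close>, can have.\<close>

lemma feasible_Om:
  assumes "feasible N Rr Kc S"
  shows "Om Rr Kc S < Rr" "Rr - Om Rr Kc S = min Kc (S + 1)" "1 \<le> Kc" "S \<le> N" "Rr \<le> N"
  using assms by (auto simp: feasible_def Om_def)

lemma lp_parameters:
  assumes "feasible N Rr Kc S" "D \<subseteq> {1..N}" "min Kc (S + 1) \<le> k" "k < Kc"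
  shows "card ({1..S} - D) < k"
proof -
  have "card ({1..S} - D) \<le> card {1..S}" by (intro card_mono) auto
  then show ?thesis using assms by auto
qed

lemma is_min_over_V_read:
  assumes "feasible N Rr Kc S" "D \<subseteq> {1..N}" "card D \<le> N - Rr"
  shows "is_min_over N D (V_read N Rr Kc S D)
    (\<Sum>n\<in>{1..N} - D. lp_opt Kc S D (N - card D - Om Rr Kc S) n)"
proof -
  note f = feasible_Om[OF assms(1)]
  have "card ({1..N} - D) = N - card D"
    using assms(2) finite_subset[OF assms(2)] by (simp add: card_Diff_subset)
  then have "is_min_over N D (lp_region N Kc S D (N - card D - Om Rr Kc S))
    (\<Sum>n\<in>{1..N} - D. lp_opt Kc S D (N - card D - Om Rr Kc S) n)"
  proof (intro is_min_over_lp_region[OF f(4,3) assms(2)] lp_parameters[OF assms(1,2)])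
    show k: "min Kc (S + 1) \<le> N - card D - Om Rr Kc S" using f(1,5) assms(3) unfolding f(2)[symmetric] by linarith
    show "1 \<le> N - card D - Om Rr Kc S" using k f(3) by linarith
  qed simp
  then show ?thesis
    using f assms by (subst V_read_eq_lp_region) auto
qed

lemma is_min_over_V_update:
  assumes "feasible N Rr Kc S" "D \<subseteq> {1..N}" "card D + X \<le> Om Rr Kc S"
  shows "is_min_over N D (V_update N Rr Kc S D X)
    (\<Sum>n\<in>{1..N} - D. lp_opt Kc S D (Rr - card D - X) n)"
proof -
  note f = feasible_Om[OF assms(1)]
  have "card ({1..N} - D) = N - card D"
    using assms(2) finite_subset[OF assms(2)] by (simp add: card_Diff_subset)
  then have "is_min_over N D (lp_region N Kc S D (Rr - card D - X))
    (\<Sum>n\<in>{1..N} - D. lp_opt Kc S D (Rr - card D - X) n)"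
  proof (intro is_min_over_lp_region[OF f(4,3) assms(2)] lp_parameters[OF assms(1,2)])
    show k: "min Kc (S + 1) \<le> Rr - card D - X" using assms(3) unfolding f(2)[symmetric] by linarith
    show "1 \<le> Rr - card D - X" using k f(3) by linarith
  qed (use f(5) in simp)
  then show ?thesis
    using f assms by (subst V_update_eq_lp_region) auto
qed

lemma is_min_over_le:
  assumes "is_min_over N D V m" "v \<in> V"
  shows "m \<le> (\<Sum>n\<in>{1..N} - D. v n)"
  using assms by (auto simp: is_min_over_def is_arg_min_def not_less)


subsection \<open>Converse bounds\<close>

lemma update_ok_above_threshold:
  assumes "D \<subseteq> {1..N}" "N - card D \<ge> update_threshold N Rr Kc S F L sch \<sigma> X"
  shows "update_ok N Rr Kc S F L sch \<sigma> D X"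
proof -
  let ?P = "\<lambda>r. \<forall>D. D \<subseteq> {1..N} \<and> N - card D \<ge> r \<longrightarrow> update_ok N Rr Kc S F L sch \<sigma> D X"
  have "?P (N + 1)" by auto
  then have "?P (LEAST r. ?P r)" by (rule LeastI)
  then show ?thesis using assms unfolding update_threshold_def by blast
qed

context
  fixes N Rr Kc S L :: nat and F :: "'f ring" and sch :: "('f, 's, 'u, 'a) scheme"
    and \<sigma> :: "('f list \<times> (nat \<Rightarrow> 's)) pmf"
  assumes feas: "feasible N Rr Kc S"
    and F: "field F" "finite (carrier F)" and L: "L > 0"
    and fin: "finite (set_pmf \<sigma>)" "\<And>D X d. finite (set_pmf (upload sch D X d))"
    and msg: "fst ` set_pmf \<sigma> \<subseteq> messages F L"
    and cs: "coded_storage N Rr Kc S F L \<sigma> fst snd"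
begin

text \<open>At one available server fewer than claimed, choose dropouts and colluding servers such that
  the remaining servers of a read set are fewer than \<open>Kc\<close> storage constrained ones.\<close>

lemma update_threshold_ge:
  assumes "X < Rr" "X \<le> Om Rr Kc S \<or> update_threshold N Rr Kc S F L sch \<sigma> X \<le> N"
  shows "int N - int (Om Rr Kc S) + int X \<le> int (update_threshold N Rr Kc S F L sch \<sigma> X)"
proof (rule ccontr)
  let ?r = "update_threshold N Rr Kc S F L sch \<sigma> X" and ?O = "Om Rr Kc S"
  assume "\<not> ?thesis"
  then have r: "int ?r < int N - int ?O + int X" by simp
  note f = feasible_Om[OF feas]
  \<comment> \<open>For \<open>X \<le> Om\<close> dropouts and colluders number
    \<open>Om + 1\<close> together, one more than allowed, and
    \<open>m = min Kc (S + 1) - 1\<close>. For larger \<open>X\<close> the truncated difference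
    gives \<open>d = 0\<close>.\<close>
  define d where "d = Suc ?O - X"
  define m where "m = Rr - d - X"
  have m: "m \<le> S" "m < Kc" "m + d + X = Rr"
    using f(1,2,3) assms(1) by (auto simp: m_def d_def min_def split: if_splits)
  define D where "D = {Suc m..m + d}"
  define Y where "Y = {Suc (m + d)..Rr}"
  have D: "D \<subseteq> {1..N}" "card D = d" using m f(5) by (auto simp: D_def)
  \<comment> \<open>Beyond \<open>?O\<close> there are no dropouts, and the second alternative of
    the hypothesis keeps the threshold away from the vacuous value \<open>N + 1\<close>.\<close>
  have "?r \<le> N - card D" using r assms(2) D m f(5) by (cases "X \<le> ?O") (auto simp: d_def)
  then have ok: "update_ok N Rr Kc S F L sch \<sigma> D X" by (rule update_ok_above_threshold[OF D(1)])
  let ?p = "update_law F L sch \<sigma> D X"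
  let ?nxt = "\<lambda>n. ent (qq F) ?p (\<lambda>(w, s, d, u). next_storage N sch D X s u n)"
  have "real L \<le> (\<Sum>n\<in>({1..m} \<union> Y) - Y. min (ent (qq F) ?p (\<lambda>(w, s, d, u). u n)) (?nxt n))"
  proof (rule update_cut_bound[OF F fin msg cs ok D(1)])
    show "{1..m} \<union> Y \<subseteq> {1..N} - D" using m f(5) by (auto simp: D_def Y_def)
    show "card ({1..m} \<union> Y) + card D = Rr"
      using m D(2) by (subst card_Un_disjoint) (auto simp: Y_def)
    show "card Y = X" using m by (simp add: Y_def)
  qed auto
  also have "({1..m} \<union> Y) - Y = {1..m}" by (auto simp: Y_def)
  also have "(\<Sum>n\<in>{1..m}. min (ent (qq F) ?p (\<lambda>(w, s, d, u). u n)) (?nxt n)) \<le>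
      real (card {1..m}) * (real L / real Kc)"
  proof (rule sum_bounded_above)
    fix n assume "n \<in> {1..m}"
    then have "n \<in> {1..S}" using m by auto
    then have "?nxt n \<le> real L / real Kc"
      using ok unfolding update_ok_def coded_storage_def Let_def by (simp add: case_prod_unfold)
    then show "min (ent (qq F) ?p (\<lambda>(w, s, d, u). u n)) (?nxt n) \<le> real L / real Kc" by simp
  qed
  also have "\<dots> < real L" using m(2) L by (simp add: field_simps)
  finally show False by simp
qed

text \<open>The minima of upload entropy and new-storage entropy form a feasible vector: the cut
  bound gives the sums, and the storage cost gives the caps, which the uploads by themselves need
  not satisfy.\<close>

lemma update_cost_ge:
  assumes D: "D \<subseteq> {1..N}" and X: "card D + X \<le> Om Rr Kc S"
    and ok: "update_ok N Rr Kc S F L sch \<sigma> D X"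
  shows "(\<Sum>n\<in>{1..N} - D. lp_opt Kc S D (Rr - card D - X) n) \<le> update_cost N F L sch \<sigma> D X"
proof -
  note f = feasible_Om[OF feas]
  let ?p = "update_law F L sch \<sigma> D X"
  have b: "1 < qq F" using card_carrier_field_gt_1[OF F] by simp
  have finp: "finite (set_pmf ?p)" using F fin by (rule finite_update_law)
  let ?U = "\<lambda>n. ent (qq F) ?p (\<lambda>(w, s, d, u). u n)"
  let ?nxt = "\<lambda>n. ent (qq F) ?p (\<lambda>(w, s, d, u). next_storage N sch D X s u n)"
  note nonneg = ent_nonneg[OF b finp]
  define v where "v = restrict (\<lambda>n. if n \<in> D then 0 else min (?U n) (?nxt n) / real L) {1..N}"
  have "v \<in> V_update N Rr Kc S D X"
    unfolding V_update_def
  proof (intro CollectI conjI allI impI ballI)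
    show "v \<in> {1..N} \<rightarrow>\<^sub>E {0..}" by (auto simp: v_def intro!: divide_nonneg_nonneg nonneg)
  next
    fix R Y assume R: "R \<subseteq> {1..N} - D \<and> int (card R) = int Rr - int (card D) \<and> Y \<subseteq> R \<and> card Y = X"
    then have "real L \<le> (\<Sum>n\<in>R - Y. min (?U n) (?nxt n))"
      using X f by (intro update_cut_bound[OF F fin msg cs ok D]) auto
    moreover have "(\<Sum>n\<in>R - Y. v n) = (\<Sum>n\<in>R - Y. min (?U n) (?nxt n)) / real L"
      unfolding sum_divide_distrib using R by (intro sum.cong) (auto simp: v_def)
    ultimately show "1 \<le> (\<Sum>n\<in>R - Y. v n)" using L by simp
  next
    fix n assume n: "n \<in> {1..S} - D"
    then have "?nxt n \<le> real L / real Kc"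
      using ok unfolding update_ok_def coded_storage_def Let_def by (simp add: case_prod_unfold)
    then have "min (?U n) (?nxt n) / real L \<le> (real L / real Kc) / real L"
      by (intro divide_right_mono) auto
    then show "v n \<le> 1 / real Kc" using n L f by (auto simp: v_def)
  qed
  then have "(\<Sum>n\<in>{1..N} - D. lp_opt Kc S D (Rr - card D - X) n) \<le> (\<Sum>n\<in>{1..N} - D. v n)"
    by (rule is_min_over_le[OF is_min_over_V_update[OF feas D X]])
  also have "\<dots> \<le> (\<Sum>n\<in>{1..N} - D. ?U n / real L)"
    by (intro sum_mono) (auto simp: v_def intro!: divide_right_mono)
  finally show ?thesis by (simp add: update_cost_def sum_divide_distrib)
qed

text \<open>An answer is a function of the storage and inherits its cap, so the answer entropies
  themselves are feasible.\<close>

lemma read_cost_ge: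
  assumes D: "D \<subseteq> {1..N}" "card D \<le> N - Rr" and ok: "read_ok N F sch \<sigma> D"
    and ug: "\<And>Y. Y \<subseteq> {1..N} - D \<Longrightarrow> card Y = Om Rr Kc S \<Longrightarrow> uniform_given F L \<sigma> Y"
  shows "(\<Sum>n\<in>{1..N} - D. lp_opt Kc S D (N - card D - Om Rr Kc S) n) \<le> read_cost N F L sch \<sigma> D"
proof -
  note f = feasible_Om[OF feas]
  have b: "1 < qq F" using card_carrier_field_gt_1[OF F] by simp
  let ?A = "\<lambda>n. ent (qq F) \<sigma> (\<lambda>(w, s). answer sch D n (s n))"
  note nonneg = ent_nonneg[OF b fin(1)]
  define v where "v = restrict (\<lambda>n. if n \<in> D then 0 else ?A n / real L) {1..N}"
  have "v \<in> V_read N Rr Kc S D"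
    unfolding V_read_def
  proof (intro CollectI conjI allI impI ballI)
    show "v \<in> {1..N} \<rightarrow>\<^sub>E {0..}" by (auto simp: v_def intro!: divide_nonneg_nonneg nonneg)
  next
    fix Y assume Y: "Y \<subseteq> {1..N} - D \<and> card Y = Om Rr Kc S"
    then have "real L \<le> (\<Sum>n\<in>{1..N} - Y - D. ?A n)"
      by (intro read_cut_bound[OF F fin(1) ug ok]) auto
    moreover have "(\<Sum>n\<in>{1..N} - Y - D. v n) = (\<Sum>n\<in>{1..N} - Y - D. ?A n) / real L"
      unfolding sum_divide_distrib by (intro sum.cong) (auto simp: v_def)
    ultimately show "1 \<le> (\<Sum>n\<in>{1..N} - Y - D. v n)" using L by simp
  next
    fix n assume n: "n \<in> {1..S} - D"
    have "?A n \<le> ent (qq F) \<sigma> (\<lambda>\<omega>. snd \<omega> n)"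
      by (rule ent_fun_le[OF b fin(1), where f = "answer sch D n"]) auto
    also have "\<dots> \<le> real L / real Kc" using cs n unfolding coded_storage_def by simp
    finally have "?A n / real L \<le> (real L / real Kc) / real L"
      by (intro divide_right_mono) auto
    then show "v n \<le> 1 / real Kc" using n L f by (auto simp: v_def)
  qed
  then have "(\<Sum>n\<in>{1..N} - D. lp_opt Kc S D (N - card D - Om Rr Kc S) n) \<le> (\<Sum>n\<in>{1..N} - D. v n)"
    by (rule is_min_over_le[OF is_min_over_V_read[OF feas D]])
  also have "\<dots> = (\<Sum>n\<in>{1..N} - D. ?A n / real L)"
    by (intro sum.cong) (auto simp: v_def)
  finally show ?thesis by (simp add: read_cost_def sum_divide_distrib)
qed

end

lemma state_law_invariants:
  assumes F: "field F" "finite (carrier F)" and sch: "rdcds_scheme N Rr Kc S F L sch"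
  shows "finite (set_pmf (state_law N F L sch ops t))"
    and "fst ` set_pmf (state_law N F L sch ops t) \<subseteq> messages F L"
proof -
  have "finite (set_pmf (state_law N F L sch ops t)) \<and>
    fst ` set_pmf (state_law N F L sch ops t) \<subseteq> messages F L"
  proof (induction t)
    case 0
    have "fst ` set_pmf (init_law sch) = set_pmf (map_pmf fst (init_law sch))" by simp
    also have "\<dots> = messages F L"
      using sch by (simp only: rdcds_scheme_def) (simp add: finite_messages messages_nonempty F)
    finally show ?case using sch by (simp add: rdcds_scheme_def)
  next
    case (Suc t)
    have fu: "finite (set_pmf (upload sch D X d))" for D X d
      using sch by (simp add: rdcds_scheme_def)
    show ?case
      using Suc finite_update_law[OF F _ fu]
      by (auto split: operation.split simp: set_update_law[OF F] intro!: add_msg_closed F)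
        (use F Suc in \<open>auto intro!: add_msg_closed\<close>)?
  qed
  then show "finite (set_pmf (state_law N F L sch ops t))"
    "fst ` set_pmf (state_law N F L sch ops t) \<subseteq> messages F L" by auto
qed

lemma uniform_given_steady_state:
  assumes F: "field F" "finite (carrier F)" and sch: "rdcds_scheme N Rr Kc S F L sch"
    and "ops \<tau> = Update Y X" "\<tau> < t"
  shows "uniform_given F L (state_law N F L sch ops t) Y"
  using assms(5)
proof (induction t)
  case (Suc t)
  show ?case
  proof (cases "\<tau> = t")
    case True
    then show ?thesis
      using uniform_given_dropouts[OF F state_law_invariants(2)[OF F sch] subset_refl] assms(4) by simp
  next
    case False
    then show ?thesis
      using Suc by (auto split: operation.split intro!: uniform_given_update[OF F])
  qed
qed simp

lemma converse:
  fixes F :: "'f ring" and sch :: "('f, 's, 'u, 'a) scheme"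
  assumes feas: "feasible N Rr Kc S" and F: "field F" "finite (carrier F)" and L: "L > 0"
    and sch: "rdcds_scheme N Rr Kc S F L sch" and adm: "admissible N Rr Kc S F L sch ops"
    and steady: "steady_by N Rr Kc S ops t0" and t: "t > t0"
  defines "\<sigma> \<equiv> state_law N F L sch ops t"
  shows "ops t = Update D X \<Longrightarrow>
      int N - int (Om Rr Kc S) + int X \<le> int (update_threshold N Rr Kc S F L sch \<sigma> X)"
    and "ops t = Read D \<Longrightarrow> \<exists>m. is_min_over N D (V_read N Rr Kc S D) m \<and> m \<le> read_cost N F L sch \<sigma> D"
    and "ops t = Update D X \<Longrightarrow>
      \<exists>m. is_min_over N D (V_update N Rr Kc S D X) m \<and> m \<le> update_cost N F L sch \<sigma> D X"
proof -
  have cs: "coded_storage N Rr Kc S F L \<sigma> fst snd"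
    and rd: "\<And>D. D \<subseteq> {1..N} \<Longrightarrow> card D \<le> N - Rr \<Longrightarrow> read_ok N F sch \<sigma> D"
    and fu: "\<And>D X d. finite (set_pmf (upload sch D X d))"
    using sch adm unfolding rdcds_scheme_def \<sigma>_def by auto
  note ctx = feas F L state_law_invariants(1)[OF F sch, of ops t, folded \<sigma>_def] fu
    state_law_invariants(2)[OF F sch, of ops t, folded \<sigma>_def] cs
  have admt: "case ops t of Read D \<Rightarrow> D \<subseteq> {1..N} \<and> card D \<le> N - Rr
      | Update D X \<Rightarrow> D \<subseteq> {1..N} \<and> X < Rr \<and> N - card D \<ge> update_threshold N Rr Kc S F L sch \<sigma> X"
    using adm unfolding admissible_def \<sigma>_def by blast
  {
    assume "ops t = Update D X"
    with admt have D: "D \<subseteq> {1..N}" "X < Rr" and thr: "N - card D \<ge> update_threshold N Rr Kc S F L sch \<sigma> X"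
      by auto
    show bound: "int N - int (Om Rr Kc S) + int X \<le> int (update_threshold N Rr Kc S F L sch \<sigma> X)"
      using D thr by (intro update_threshold_ge[OF ctx]) auto
    have "card D \<le> N" using card_mono[OF _ D(1)] by simp
    then have "card D + X \<le> Om Rr Kc S" using thr bound by linarith
    then show "\<exists>m. is_min_over N D (V_update N Rr Kc S D X) m \<and> m \<le> update_cost N F L sch \<sigma> D X"
      using is_min_over_V_update[OF feas D(1)] update_cost_ge[OF ctx D(1)]
        update_ok_above_threshold[OF D(1) thr] by blast
  }
  assume "ops t = Read D"
  with admt have D: "D \<subseteq> {1..N}" "card D \<le> N - Rr" by auto
  have "uniform_given F L \<sigma> Y" if Y: "Y \<subseteq> {1..N} - D" "card Y = Om Rr Kc S" for Y
  proof -
    \<comment> \<open>A set of full size \<open>Om\<close> leaves 0 as the only security level with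
      which the steady state guarantees an update that drops it.\<close>
    have "Y \<subseteq> {1..N}" "card Y + 0 \<le> Om Rr Kc S" using Y by auto
    then obtain \<tau> where "\<tau> \<le> t0" "ops \<tau> = Update Y 0"
      using steady unfolding steady_by_def by blast
    then show ?thesis unfolding \<sigma>_def
      using t by (intro uniform_given_steady_state[OF F sch, of _ \<tau>]) auto
  qed
  then show "\<exists>m. is_min_over N D (V_read N Rr Kc S D) m \<and> m \<le> read_cost N F L sch \<sigma> D"
    using is_min_over_V_read[OF feas D] read_cost_ge[OF ctx D rd[OF D]] by blast
qed


subsection \<open>Staircase labellings\<close>

text \<open>Every block of \<open>k\<close> rows and \<open>L div k\<close> columns is a transversal of the labels. In the step
  from \<open>k\<close> to \<open>k + 1\<close> rows, the new row takes the labels of the columns that are dropped.\<close>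

lemma staircase_labelling:
  assumes "1 \<le> T" "T \<le> J" "\<And>k. k \<in> {T..J} \<Longrightarrow> k dvd L"
  shows "\<exists>l :: nat \<Rightarrow> nat \<Rightarrow> nat. (\<forall>i<T. \<forall>c. l i c = i * (L div T) + c) \<and>
    (\<forall>k\<in>{T..J}. bij_betw (\<lambda>(i, c). l i c) ({..<k} \<times> {..<L div k}) {..<L})"
  using assms(2,3)
proof (induction J rule: dec_induct)
  case base
  define m where "m = L div T"
  have L: "L = T * m" using base assms(1) by (simp add: m_def)
  have "bij_betw (\<lambda>(i, c). i * m + c) ({..<T} \<times> {..<m}) {..<T * m}"
  proof (rule bij_betw_byWitness[where f' = "\<lambda>x. (x div m, x mod m)"])
    show "(\<lambda>(i, c). i * m + c) ` ({..<T} \<times> {..<m}) \<subseteq> {..<T * m}"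
    proof clarsimp
      fix i c assume "i < T" "c < m"
      then have "i * m + c < Suc i * m" by simp
      also have "\<dots> \<le> T * m" using \<open>i < T\<close> by (intro mult_right_mono) auto
      finally show "i * m + c < T * m" .
    qed
    show "(\<lambda>x. (x div m, x mod m)) ` {..<T * m} \<subseteq> {..<T} \<times> {..<m}"
    proof (rule image_subsetI)
      fix x assume x: "x \<in> {..<T * m}"
      then have "m > 0" by (cases m) auto
      with x show "(x div m, x mod m) \<in> {..<T} \<times> {..<m}" by (simp add: less_mult_imp_div_less)
    qed
  qed auto
  then have "bij_betw (\<lambda>(i, c). i * m + c) ({..<T} \<times> {..<m}) {..<L}" using L by metis
  then show ?case unfolding m_def by (intro exI[of _ "\<lambda>i c. i * (L div T) + c"]) simp
next
  case (step J)
  from step.IH[OF step.prems] obtain l where l0: "\<forall>i<T. \<forall>c. l i c = i * (L div T) + c"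
    and l: "\<And>k. k \<in> {T..J} \<Longrightarrow> bij_betw (\<lambda>(i, c). l i c) ({..<k} \<times> {..<L div k}) {..<L}"
    by fastforce
  have J: "J \<ge> 1" using step assms(1) by simp
  define m where "m = L div Suc J"
  have "Suc J dvd L" "J dvd L" using step.prems step.hyps by auto
  then have LJ: "L = Suc J * m" and LJ': "L = J * (L div J)"
    unfolding m_def by (simp_all only: dvd_mult_div_cancel)
  have m_le: "m \<le> L div J" unfolding m_def using J by (intro div_le_mono2) auto
  let ?N = "{..<J} \<times> {m..<L div J}" and ?O = "{..<J} \<times> {..<m}"
  let ?f = "\<lambda>(i, c). l i c"
  have blk: "bij_betw ?f ({..<J} \<times> {..<L div J}) {..<L}" using l step.hyps by simp
  have un: "{..<J} \<times> {..<L div J} = ?O \<union> ?N" using m_le by auto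
  have injf: "inj_on ?f ({..<J} \<times> {..<L div J})" using blk by (rule bij_betw_imp_inj_on)
  \<comment> \<open>Cutting the \<open>J\<close> old rows to \<open>m\<close> columns drops
    \<open>L - J * m = m\<close> cells, exactly as many as the new row has.\<close>
  have "card (?f ` ?N) = card ?N"
    using injf m_le by (intro card_image inj_on_subset[OF injf]) auto
  also have "\<dots> = J * (L div J) - J * m" by (simp add: diff_mult_distrib2)
  also have "\<dots> = m" using LJ LJ' by simp
  finally have "card {..<m} = card (?f ` ?N)" by simp
  then obtain g where g: "bij_betw g {..<m} (?f ` ?N)"
    by (metis finite_SigmaI finite_atLeastLessThan finite_imageI finite_lessThan finite_same_card_bij)
  define l' where "l' = (\<lambda>i c. if i < J then l i c else g c)"
  have old: "bij_betw (\<lambda>(i, c). l' i c) ({..<k} \<times> A) B \<longleftrightarrow> bij_betw ?f ({..<k} \<times> A) B"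
    if "k \<le> J" for k A B
    using that by (intro bij_betw_cong) (auto simp: l'_def)
  have "bij_betw (\<lambda>(i, c). l' i c) (?O \<union> {J} \<times> {..<m}) (?f ` ?O \<union> ?f ` ?N)"
  proof (rule bij_betw_combine)
    show "bij_betw (\<lambda>(i, c). l' i c) ?O (?f ` ?O)"
    proof -
      have "?O \<subseteq> {..<J} \<times> {..<L div J}" using m_le by auto
      then show ?thesis
        unfolding old[OF order_refl] by (intro inj_on_imp_bij_betw inj_on_subset[OF injf])
    qed
    have "bij_betw (g \<circ> snd) ({J} \<times> {..<m}) (?f ` ?N)"
      by (rule bij_betw_trans[OF _ g]) (auto simp: bij_betw_def inj_on_def image_iff)
    then show "bij_betw (\<lambda>(i, c). l' i c) ({J} \<times> {..<m}) (?f ` ?N)"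
      by (rule iffD1[OF bij_betw_cong, rotated]) (auto simp: l'_def)
    show "?f ` ?O \<inter> ?f ` ?N = {}"
    proof -
      have "?f ` ?O \<inter> ?f ` ?N = ?f ` (?O \<inter> ?N)"
        by (rule inj_on_image_Int[symmetric, OF injf]) (use m_le in auto)
      also have "?O \<inter> ?N = {}" by auto
      finally show ?thesis by simp
    qed
  qed
  moreover have "?O \<union> {J} \<times> {..<m} = {..<Suc J} \<times> {..<L div Suc J}" by (auto simp: m_def)
  moreover have "?f ` ?O \<union> ?f ` ?N = {..<L}"
    using blk unfolding bij_betw_def un image_Un by simp
  ultimately have new: "bij_betw (\<lambda>(i, c). l' i c) ({..<Suc J} \<times> {..<L div Suc J}) {..<L}" by simp
  have "bij_betw (\<lambda>(i, c). l' i c) ({..<k} \<times> {..<L div k}) {..<L}" if "k \<in> {T..Suc J}" for k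
  proof (cases "k = Suc J")
    case True
    then show ?thesis using new by simp
  next
    case False
    then show ?thesis using that l[of k] old[of k] by simp
  qed
  moreover have "\<forall>i<T. \<forall>c. l' i c = i * (L div T) + c"
    using l0 step.hyps by (auto simp: l'_def)
  ultimately show ?case by blast
qed


subsection \<open>Evaluation points in general position modulo a prime\<close>

text \<open>Lagrange's bound. The leading coefficient may be divisible by \<open>p\<close>, so any
  other coefficient may witness that the polynomial is nonzero modulo \<open>p\<close>; a root is
  split off by division over the integers, with a remainder divisible by \<open>p\<close>.\<close>

lemma card_roots_mod_prime:
  fixes q :: "int poly" and p :: int
  assumes p: "prime p" and "degree q \<le> n" "\<not> p dvd coeff q i"
  shows "card {x \<in> {0..<p}. p dvd poly q x} \<le> n"
  using assms(2,3)
proof (induction n arbitrary: q i)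
  case 0
  then obtain c where c: "q = [:c:]" using degree_eq_zeroE by blast
  then have "\<not> p dvd c" using 0 by (cases i) auto
  then have "{x \<in> {0..<p}. p dvd poly q x} = {}" by (auto simp: c)
  then show ?case by (metis card.empty order_refl)
next
  case (Suc n)
  show ?case
  proof (cases "{x \<in> {0..<p}. p dvd poly q x} = {}")
    case True
    show ?thesis unfolding True by simp
  next
    case False
    then obtain a where a: "a \<in> {0..<p}" "p dvd poly q a" by auto
    define s where "s = synthetic_div q a"
    have q: "q = [:-a, 1:] * s + [:poly q a:]" using synthetic_div_correct'[of a q] by (simp only: s_def)
    have "degree s \<le> n" using Suc.prems by (simp add: s_def degree_synthetic_div)
    moreover have "\<exists>j. \<not> p dvd coeff s j"
    proof (rule ccontr)
      assume "\<not> ?thesis"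
      then have "p dvd coeff ([:-a, 1:] * s) i"
        by (auto simp: coeff_pCons split: nat.split)
      moreover have "p dvd coeff [:poly q a:] i" using a by (cases i) auto
      ultimately show False using Suc.prems(2) q by (metis coeff_add dvd_add)
    qed
    ultimately have IH: "card {x \<in> {0..<p}. p dvd poly s x} \<le> n" using Suc.IH by blast
    have sub: "{x \<in> {0..<p}. p dvd poly q x} \<subseteq> insert a {x \<in> {0..<p}. p dvd poly s x}"
    proof
      fix x assume "x \<in> {x \<in> {0..<p}. p dvd poly q x}"
      then have x: "x \<in> {0..<p}" "p dvd poly q x" by auto
      have "poly q x = (x - a) * poly s x + poly q a" by (subst q) (simp add: algebra_simps)
      then have "p dvd (x - a) * poly s x" using x a by (metis dvd_add_left_iff)
      then consider "p dvd x - a" | "p dvd poly s x" using p by (auto simp: prime_dvd_mult_iff)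
      then show "x \<in> insert a {x \<in> {0..<p}. p dvd poly s x}"
      proof cases
        case 1
        then have "x mod p = a mod p" by (simp add: mod_eq_dvd_iff)
        then show ?thesis using x a by simp
      next
        case 2
        then show ?thesis using x by simp
      qed
    qed
    have "card {x \<in> {0..<p}. p dvd poly q x} \<le> Suc (card {x \<in> {0..<p}. p dvd poly s x})"
    proof -
      have fin: "finite {x \<in> {0..<p}. p dvd poly s x}"
        by (rule finite_subset[of _ "{0..<p}"]) auto
      have "card {x \<in> {0..<p}. p dvd poly q x} \<le> card (insert a {x \<in> {0..<p}. p dvd poly s x})"
        using fin sub by (intro card_mono) auto
      also have "\<dots> \<le> Suc (card {x \<in> {0..<p}. p dvd poly s x})"
        using fin by (simp only: card_insert_if) simp
      finally show ?thesis .
    qed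
    with IH show ?thesis by linarith
  qed
qed

text \<open>For \<open>m = card E\<close> this is nonsingularity modulo \<open>p\<close> of the
  matrix with entries \<open>poly (b r) (\<alpha> n)\<close>. Injectivity and surjectivity are both
  stated, which avoids determinants.\<close>

definition uniquely_solvable :: "int \<Rightarrow> (nat \<Rightarrow> int) \<Rightarrow> nat set \<Rightarrow> nat \<Rightarrow> (nat \<Rightarrow> int poly) \<Rightarrow> bool" where
  "uniquely_solvable p \<alpha> E m b \<longleftrightarrow>
     (\<forall>z. (\<forall>n\<in>E. p dvd (\<Sum>r<m. z r * poly (b r) (\<alpha> n))) \<longrightarrow> (\<forall>r<m. p dvd z r)) \<and>
     (\<forall>t. \<exists>z. \<forall>n\<in>E. p dvd (\<Sum>r<m. z r * poly (b r) (\<alpha> n)) - t n)"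

text \<open>Each polynomial owns a monomial that no other contains, so a combination with some
  coefficient equal to 1 is nonzero modulo every prime.\<close>

definition separated :: "nat \<Rightarrow> nat \<Rightarrow> (nat \<Rightarrow> int poly) \<Rightarrow> bool" where
  "separated d m b \<longleftrightarrow> (\<forall>r<m. degree (b r) \<le> d) \<and>
     (\<exists>e. \<forall>r<m. coeff (b r) (e r) = 1 \<and> (\<forall>r'<m. r' \<noteq> r \<longrightarrow> coeff (b r') (e r) = 0))"

text \<open>After adding the combination of the earlier polynomials given by \<zeta>, the last one
  vanishes on \<open>E\<close> but not at the new point: the enlarged system is block
  triangular.\<close>

lemma uniquely_solvable_extend:
  fixes p :: int
  assumes p: "prime p" and E: "uniquely_solvable p \<alpha> E m b"
    and \<zeta>: "\<And>n. n \<in> E \<Longrightarrow> p dvd (\<Sum>r<m. \<zeta> r * poly (b r) (\<alpha> n)) + poly (b m) (\<alpha> n)"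
    and new: "\<not> p dvd (\<Sum>r<m. \<zeta> r * poly (b r) (\<alpha> k)) + poly (b m) (\<alpha> k)"
  shows "uniquely_solvable p \<alpha> (insert k E) (Suc m) b"
proof -
  let ?q = "\<lambda>n. (\<Sum>r<m. \<zeta> r * poly (b r) (\<alpha> n)) + poly (b m) (\<alpha> n)"
  have split: "(\<Sum>r<m. z r * poly (b r) (\<alpha> n)) + x * poly (b m) (\<alpha> n) =
    (\<Sum>r<m. (z r - x * \<zeta> r) * poly (b r) (\<alpha> n)) + x * ?q n" for z x n
    by (simp add: algebra_simps sum_distrib_left sum_subtractf sum.distrib)
  have "p dvd z r" if z: "\<forall>n\<in>insert k E. p dvd (\<Sum>r<Suc m. z r * poly (b r) (\<alpha> n))" and r: "r < Suc m" for z r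
  proof -
    have "p dvd (\<Sum>r<m. (z r - z m * \<zeta> r) * poly (b r) (\<alpha> n))" if "n \<in> E" for n
    proof -
      have "p dvd (\<Sum>r<m. (z r - z m * \<zeta> r) * poly (b r) (\<alpha> n)) + z m * ?q n"
        using z that unfolding split[of z n "z m", symmetric] by simp
      then show ?thesis using dvd_add_left_iff[of p "z m * ?q n"] \<zeta>[OF that] dvd_mult by blast
    qed
    then have z': "\<forall>r<m. p dvd z r - z m * \<zeta> r"
      using E unfolding uniquely_solvable_def by (auto dest!: spec[of _ "\<lambda>r. z r - z m * \<zeta> r"])
    then have "p dvd (\<Sum>r<m. (z r - z m * \<zeta> r) * poly (b r) (\<alpha> k))"
      by (intro dvd_sum dvd_mult2) auto
    moreover have "p dvd (\<Sum>r<m. (z r - z m * \<zeta> r) * poly (b r) (\<alpha> k)) + z m * ?q k"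
      using z unfolding split[of z k "z m", symmetric] by simp
    ultimately have "p dvd z m * ?q k" using dvd_add_right_iff by blast
    then have zm: "p dvd z m" using new p by (simp add: prime_dvd_mult_iff)
    show ?thesis
    proof (cases "r = m")
      case False
      then have "p dvd z r - z m * \<zeta> r" using z' r by simp
      then have "p dvd (z r - z m * \<zeta> r) + z m * \<zeta> r" using zm by (intro dvd_add dvd_mult2)
      then show ?thesis by simp
    qed (use zm in simp)
  qed
  moreover have "\<exists>z. \<forall>n\<in>insert k E. p dvd (\<Sum>r<Suc m. z r * poly (b r) (\<alpha> n)) - t n" for t
  proof -
    obtain y where y: "\<And>n. n \<in> E \<Longrightarrow> p dvd (\<Sum>r<m. y r * poly (b r) (\<alpha> n)) - t n"
      using E[unfolded uniquely_solvable_def, THEN conjunct2, rule_format, of t] by blast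
    have "coprime (?q k) p"
      using new p by (metis coprime_commute prime_imp_coprime)
    then obtain x where x: "[?q k * x = 1] (mod p)" using coprime_iff_invertible_int by blast
    define c where "c = x * (t k - (\<Sum>r<m. y r * poly (b r) (\<alpha> k)))"
    define z where "z = (\<lambda>r. if r < m then y r + c * \<zeta> r else c)"
    have z: "(\<Sum>r<Suc m. z r * poly (b r) (\<alpha> n)) = (\<Sum>r<m. y r * poly (b r) (\<alpha> n)) + c * ?q n" for n
      by (simp add: z_def algebra_simps sum_distrib_left sum.distrib)
    have "p dvd (\<Sum>r<Suc m. z r * poly (b r) (\<alpha> n)) - t n" if "n \<in> E" for n
    proof -
      have "p dvd ((\<Sum>r<m. y r * poly (b r) (\<alpha> n)) - t n) + c * ?q n"
        by (rule dvd_add[OF y[OF that] dvd_mult[OF \<zeta>[OF that]]])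
      then show ?thesis unfolding z by (simp add: algebra_simps)
    qed
    moreover have "p dvd (\<Sum>r<Suc m. z r * poly (b r) (\<alpha> k)) - t k"
    proof -
      have "p dvd ?q k * x - 1" using x by (simp add: cong_iff_dvd_diff)
      then have "p dvd (?q k * x - 1) * (t k - (\<Sum>r<m. y r * poly (b r) (\<alpha> k)))" by (rule dvd_mult2)
      also have "\<dots> = (\<Sum>r<Suc m. z r * poly (b r) (\<alpha> k)) - t k"
        unfolding z c_def by (simp only: algebra_simps)
      finally show ?thesis .
    qed
    ultimately show ?thesis by blast
  qed
  ultimately show ?thesis unfolding uniquely_solvable_def by blast
qed

text \<open>Points are chosen one at a time, each avoiding the roots of finitely many polynomials.
  The claim covers all sets of size at most \<open>m\<close> with the corresponding initial segment
  of \<open>b\<close>, so that every system met in the induction extends a solvable one.\<close>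

lemma general_position_exists:
  fixes Fam :: "(nat \<times> (nat \<Rightarrow> int poly)) set" and p :: int
  assumes p: "prime p" and fin: "finite Fam" and sep: "\<And>m b. (m, b) \<in> Fam \<Longrightarrow> separated d m b"
    and large: "int (card Fam * 2 ^ N * d) < p"
  shows "\<exists>\<alpha>. \<forall>(m, b)\<in>Fam. \<forall>E. E \<subseteq> {1..N} \<and> card E \<le> m \<longrightarrow> uniquely_solvable p \<alpha> E (card E) b"
  using large
proof (induction N)
  case 0
  then show ?case by (auto simp: uniquely_solvable_def)
next
  case (Suc N)
  have "int (card Fam * 2 ^ N * d) \<le> int (card Fam * 2 ^ Suc N * d)"
    by (simp del: of_nat_mult add: of_nat_le_iff)
  then have "int (card Fam * 2 ^ N * d) < p" using Suc.prems by linarith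
  then obtain \<alpha> where \<alpha>: "\<And>m b E. (m, b) \<in> Fam \<Longrightarrow> E \<subseteq> {1..N} \<Longrightarrow> card E \<le> m \<Longrightarrow>
      uniquely_solvable p \<alpha> E (card E) b"
    using Suc.IH by (metis (no_types, lifting) case_prodD)
  define I where "I = {((m, b), E). (m, b) \<in> Fam \<and> E \<subseteq> {1..N} \<and> card E < m}"
  have "\<exists>\<zeta>. \<forall>n\<in>E. p dvd (\<Sum>r<card E. \<zeta> r * poly (b r) (\<alpha> n)) - (- poly (b (card E)) (\<alpha> n))"
    if "((m, b), E) \<in> I" for m b E
  proof -
    have "uniquely_solvable p \<alpha> E (card E) b" using \<alpha>[of m b E] that by (auto simp: I_def)
    then show ?thesis unfolding uniquely_solvable_def by meson
  qed
  then have ex: "\<exists>\<zeta>. \<forall>n\<in>E. p dvd (\<Sum>r<card E. \<zeta> r * poly (b r) (\<alpha> n)) + poly (b (card E)) (\<alpha> n)"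
    if "((m, b), E) \<in> I" for m b E
    using that unfolding diff_minus_eq_add by blast
  define \<zeta> where "\<zeta> = (\<lambda>(m :: nat) b E. SOME \<zeta>.
    \<forall>n\<in>E. p dvd (\<Sum>r<card E. \<zeta> r * poly (b r) (\<alpha> n)) + poly (b (card E)) (\<alpha> n))"
  have \<zeta>: "p dvd (\<Sum>r<card E. \<zeta> m b E r * poly (b r) (\<alpha> n)) + poly (b (card E)) (\<alpha> n)"
    if "((m, b), E) \<in> I" "n \<in> E" for m b E n
    using someI_ex[OF ex[OF that(1)]] that(2) unfolding \<zeta>_def by blast
  \<comment> \<open>The combination of the first \<open>card E + 1\<close> polynomials that vanishes
    on \<open>E\<close>. Its coefficient at the monomial owned by \<open>b (card E)\<close> is 1,
    hence it has at most \<open>d\<close> roots modulo \<open>p\<close>.\<close>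
  define q where "q = (\<lambda>((m, b :: nat \<Rightarrow> int poly), E). (\<Sum>r<card E. smult (\<zeta> m b E r) (b r)) + b (card E))"
  have poly_q: "poly (q ((m, b), E)) x = (\<Sum>r<card E. \<zeta> m b E r * poly (b r) x) + poly (b (card E)) x" for m b E x
    by (simp add: q_def poly_sum)
  have few: "card {x \<in> {0..<p}. p dvd poly (q i) x} \<le> d" if "i \<in> I" for i
  proof -
    obtain m b E where i: "i = ((m, b), E)" by (metis surj_pair)
    have mb: "(m, b) \<in> Fam" "card E < m" using that by (auto simp: I_def i)
    from sep[OF mb(1)] obtain e where e: "\<And>r. r < m \<Longrightarrow> coeff (b r) (e r) = 1"
        "\<And>r r'. r < m \<Longrightarrow> r' < m \<Longrightarrow> r' \<noteq> r \<Longrightarrow> coeff (b r') (e r) = 0"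
      and deg: "\<And>r. r < m \<Longrightarrow> degree (b r) \<le> d"
      unfolding separated_def by blast
    have "coeff (q i) (e (card E)) = 1"
      using e mb(2) by (simp add: q_def i coeff_sum)
    then have "\<not> p dvd coeff (q i) (e (card E))" using p not_prime_unit[of p] by metis
    moreover have "degree (q i) \<le> d"
      unfolding q_def i using deg mb(2)
      by (auto intro!: degree_add_le degree_sum_le order_trans[OF degree_smult_le])
    ultimately show ?thesis using card_roots_mod_prime[OF p] by blast
  qed
  have finI: "finite I" and cardI: "card I \<le> card Fam * 2 ^ N"
  proof -
    have sub: "I \<subseteq> Fam \<times> Pow {1..N}" by (auto simp: I_def)
    then show "finite I" by (rule finite_subset) (use fin in auto)
    from sub have "card I \<le> card (Fam \<times> Pow {1..N})" using fin by (intro card_mono) auto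
    then show "card I \<le> card Fam * 2 ^ N" by (simp add: card_cartesian_product card_Pow)
  qed
  have "card (\<Union>i\<in>I. {x \<in> {0..<p}. p dvd poly (q i) x}) \<le> card I * d"
  proof -
    have "card (\<Union>i\<in>I. {x \<in> {0..<p}. p dvd poly (q i) x}) \<le> (\<Sum>i\<in>I. card {x \<in> {0..<p}. p dvd poly (q i) x})"
      by (rule card_UN_le[OF finI])
    also have "\<dots> \<le> of_nat (card I) * d" by (rule sum_bounded_above) (rule few)
    finally show ?thesis by simp
  qed
  also have "\<dots> \<le> card Fam * 2 ^ N * d" using cardI by simp
  also have "\<dots> \<le> card Fam * 2 ^ Suc N * d" by simp
  also have "\<dots> < card {0..<p}"
    using Suc.prems by (simp only: card_atLeastLessThan_int diff_zero zless_nat_eq_int_zless)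
  finally have "card (\<Union>i\<in>I. {x \<in> {0..<p}. p dvd poly (q i) x}) < card {0..<p}" .
  then have "\<not> {0..<p} \<subseteq> (\<Union>i\<in>I. {x \<in> {0..<p}. p dvd poly (q i) x})"
  proof -
    have "finite (\<Union>i\<in>I. {x \<in> {0..<p}. p dvd poly (q i) x})"
      by (rule finite_subset[of _ "{0..<p}"]) auto
    then show ?thesis using \<open>card (\<Union>i\<in>I. {x \<in> {0..<p}. p dvd poly (q i) x}) < card {0..<p}\<close> by (meson card_mono leD)
  qed
  then obtain x where x: "\<And>i. i \<in> I \<Longrightarrow> \<not> p dvd poly (q i) x" by blast
  define \<beta> where "\<beta> = \<alpha>(Suc N := x)"
  have old: "uniquely_solvable p \<beta> E k b \<longleftrightarrow> uniquely_solvable p \<alpha> E k b" if "E \<subseteq> {1..N}" for E k b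
  proof -
    have "\<beta> n = \<alpha> n" if "n \<in> E" for n using \<open>E \<subseteq> {1..N}\<close> that by (auto simp: \<beta>_def)
    then have "(\<forall>n\<in>E. P (\<beta> n) n) \<longleftrightarrow> (\<forall>n\<in>E. P (\<alpha> n) n)" for P :: "int \<Rightarrow> nat \<Rightarrow> bool"
      by (intro ball_cong) simp_all
    from this[of "\<lambda>x n. p dvd (\<Sum>r<k. z r * poly (b r) x)" for z]
      this[of "\<lambda>x n. p dvd (\<Sum>r<k. z r * poly (b r) x) - t n" for z t]
    show ?thesis unfolding uniquely_solvable_def by (simp only:)
  qed
  have "uniquely_solvable p \<beta> E (card E) b" if mb: "(m, b) \<in> Fam" and E: "E \<subseteq> {1..Suc N}" "card E \<le> m" for m b E
  proof (cases "Suc N \<in> E")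
    case False
    then have "E \<subseteq> {1..N}" using E by (auto simp: subset_iff le_Suc_eq)
    then show ?thesis using \<alpha>[OF mb _ E(2)] old by blast
  next
    case True
    define E' where "E' = E - {Suc N}"
    have E': "E' \<subseteq> {1..N}" using E by (auto simp: E'_def subset_iff le_Suc_eq)
    have finE: "finite E" using E finite_subset by blast
    have c: "card E = Suc (card E')" unfolding E'_def using True finE by (metis card_Suc_Diff1)
    have I: "((m, b), E') \<in> I" using mb E' E c by (simp add: I_def)
    have "uniquely_solvable p \<beta> (insert (Suc N) E') (Suc (card E')) b"
    proof (rule uniquely_solvable_extend[OF p, where \<zeta> = "\<zeta> m b E'"])
      show "uniquely_solvable p \<beta> E' (card E') b" using \<alpha>[OF mb E'] c E old[OF E'] by simp
      show "p dvd (\<Sum>r<card E'. \<zeta> m b E' r * poly (b r) (\<beta> n)) + poly (b (card E')) (\<beta> n)" if "n \<in> E'" for n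
        using \<zeta>[OF I that] E' that by (auto simp: \<beta>_def)
      show "\<not> p dvd (\<Sum>r<card E'. \<zeta> m b E' r * poly (b r) (\<beta> (Suc N))) + poly (b (card E')) (\<beta> (Suc N))"
        using x[OF I] by (simp add: \<beta>_def poly_q)
    qed
    moreover have "insert (Suc N) E' = E" using True by (auto simp: E'_def)
    ultimately show ?thesis using c by simp
  qed
  then show ?case by blast
qed


subsection \<open>Staircase codes\<close>

text \<open>Column \<open>c\<close> of a codeword is the value at \<open>\<alpha> n\<close> of a polynomial. Its low coefficients are
  the \<open>R c\<close> free symbols of the column. For every place \<open>(i, c)\<close> with \<open>T c \<le> i\<close>, the coefficient of
  \<open>h + i\<close> is the sum of the free symbols at the places in columns \<open>\<ge> c\<close> that carry the same label.
  The message symbol \<open>w\<close> is the sum over all places labelled \<open>w\<close>.\<close>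

locale staircase_code =
  fixes p :: int and N M h L :: nat and T R :: "nat \<Rightarrow> nat" and pl :: "nat \<Rightarrow> nat \<Rightarrow> bool"
    and lab :: "nat \<Rightarrow> nat \<Rightarrow> nat" and \<alpha> :: "nat \<Rightarrow> int"
  assumes p: "prime p"
    and lab_lt: "c < M \<Longrightarrow> pl i c \<Longrightarrow> lab i c < L"
    and lab_inj: "c < M \<Longrightarrow> pl i c \<Longrightarrow> pl i' c \<Longrightarrow> lab i c = lab i' c \<Longrightarrow> i = i'"
    and lab_top: "i < T c \<Longrightarrow> pl i c \<Longrightarrow> c < c' \<Longrightarrow> c' < M \<Longrightarrow> pl i' c' \<Longrightarrow> lab i' c' \<noteq> lab i c"
    and T_le: "c < M \<Longrightarrow> T c \<le> R c"
    and gp_read: "c < M \<Longrightarrow> T c \<le> k \<Longrightarrow> (\<And>i. i < k \<Longrightarrow> pl i c) \<Longrightarrow> E \<subseteq> {1..N} \<Longrightarrow>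
      card E = R c + k - T c \<Longrightarrow>
      (\<And>n. n \<in> E \<Longrightarrow> p dvd (\<Sum>i<R c. u i * \<alpha> n ^ i) + (\<Sum>i | T c \<le> i \<and> pl i c. v i * \<alpha> n ^ (h + i))) \<Longrightarrow>
      (\<And>i. k \<le> i \<Longrightarrow> pl i c \<Longrightarrow> p dvd v i - (if i < R c then u i else 0)) \<Longrightarrow>
      (\<forall>i<R c. p dvd u i) \<and> (\<forall>i\<ge>T c. pl i c \<longrightarrow> p dvd v i)"
    and gp_write: "c < M \<Longrightarrow> k \<le> R c \<Longrightarrow> E \<subseteq> {1..N} \<Longrightarrow> card E = R c - k \<Longrightarrow>
      (\<And>n. n \<in> E \<Longrightarrow> p dvd (\<Sum>i=k..<R c. u i * \<alpha> n ^ i)) \<Longrightarrow> (\<forall>i\<in>{k..<R c}. p dvd u i)"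
begin

definition colsum :: "(nat \<times> nat \<Rightarrow> int) \<Rightarrow> nat \<Rightarrow> nat \<Rightarrow> int" where
  "colsum st w c = (\<Sum>i | i < R c \<and> pl i c \<and> lab i c = w. st (i, c))"

definition tail :: "(nat \<times> nat \<Rightarrow> int) \<Rightarrow> nat \<Rightarrow> nat \<Rightarrow> int" where
  "tail st w c = (\<Sum>c'=c..<M. colsum st w c')"

definition msg :: "(nat \<times> nat \<Rightarrow> int) \<Rightarrow> nat \<Rightarrow> int" where
  "msg st w = tail st w 0"

definition enc :: "(nat \<times> nat \<Rightarrow> int) \<Rightarrow> nat \<Rightarrow> nat \<Rightarrow> int" where
  "enc st n c = (\<Sum>i<R c. st (i, c) * \<alpha> n ^ i) +
     (\<Sum>i | T c \<le> i \<and> pl i c. tail st (lab i c) c * \<alpha> n ^ (h + i))"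

lemma colsum_add: "colsum (\<lambda>x. a x + b x) w c = colsum a w c + colsum b w c"
  by (simp add: colsum_def sum.distrib)

lemma colsum_diff: "colsum (\<lambda>x. a x - b x) w c = colsum a w c - colsum b w c"
  by (simp add: colsum_def sum_subtractf)

lemma tail_add: "tail (\<lambda>x. a x + b x) w c = tail a w c + tail b w c"
  by (simp add: tail_def sum.distrib colsum_add)

lemma tail_diff: "tail (\<lambda>x. a x - b x) w c = tail a w c - tail b w c"
  by (simp add: tail_def sum_subtractf colsum_diff)

lemma msg_add: "msg (\<lambda>x. a x + b x) w = msg a w + msg b w"
  by (simp add: msg_def tail_add)

lemma msg_diff: "msg (\<lambda>x. a x - b x) w = msg a w - msg b w"
  by (simp add: msg_def tail_diff)

lemma enc_add: "enc (\<lambda>x. a x + b x) n c = enc a n c + enc b n c"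
  by (simp add: enc_def tail_add sum.distrib algebra_simps)

lemma enc_diff: "enc (\<lambda>x. a x - b x) n c = enc a n c - enc b n c"
  by (simp add: enc_def tail_diff sum_subtractf algebra_simps)

lemma dvd_colsum: "(\<And>i. i < R c \<Longrightarrow> p dvd st (i, c)) \<Longrightarrow> p dvd colsum st w c"
  unfolding colsum_def by (rule dvd_sum) auto

lemma dvd_tail: "(\<And>i c'. c \<le> c' \<Longrightarrow> c' < M \<Longrightarrow> i < R c' \<Longrightarrow> p dvd st (i, c')) \<Longrightarrow> p dvd tail st w c"
  unfolding tail_def by (intro dvd_sum dvd_colsum) auto

lemma dvd_msg: "(\<And>i c. c < M \<Longrightarrow> i < R c \<Longrightarrow> p dvd st (i, c)) \<Longrightarrow> p dvd msg st w"
  unfolding msg_def by (intro dvd_tail) auto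

lemma dvd_enc:
  assumes "\<And>i c. c < M \<Longrightarrow> i < R c \<Longrightarrow> p dvd st (i, c)" "c < M"
  shows "p dvd enc st n c"
  unfolding enc_def using assms by (intro dvd_add dvd_sum dvd_mult2 dvd_tail) auto

text \<open>Labels differ within a column, so a column contributes at most one symbol to a sum.\<close>

lemma colsum_place:
  assumes "c < M" "pl i c"
  shows "colsum st (lab i c) c = (if i < R c then st (i, c) else 0)"
proof -
  have "{i'. i' < R c \<and> pl i' c \<and> lab i' c = lab i c} = (if i < R c then {i} else {})"
    using assms lab_inj[of c _ i] by auto
  then show ?thesis by (simp add: colsum_def)
qed

lemma colsum_no_place: "(\<And>i. pl i c \<Longrightarrow> lab i c \<noteq> w) \<Longrightarrow> colsum st w c = 0"
  unfolding colsum_def by (rule sum.neutral) auto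

lemma tail_Suc: "c < M \<Longrightarrow> tail st w c = colsum st w c + tail st w (Suc c)"
  unfolding tail_def by (rule sum.atLeast_Suc_lessThan)

lemma tail_skip:
  assumes "c \<le> c'" "c' \<le> M" "\<And>d i. c \<le> d \<Longrightarrow> d < c' \<Longrightarrow> pl i d \<Longrightarrow> lab i d \<noteq> w"
  shows "tail st w c = tail st w c'"
proof -
  have "tail st w c = (\<Sum>d=c..<c'. colsum st w d) + tail st w c'"
    unfolding tail_def using assms(1,2) by (rule sum.atLeastLessThan_concat[symmetric])
  moreover have "(\<Sum>d=c..<c'. colsum st w d) = 0"
    using assms(3) by (intro sum.neutral ballI colsum_no_place) auto
  ultimately show ?thesis by simp
qed

lemma tail_place:
  assumes "c < M" "pl i c"
  shows "tail st (lab i c) c = (if i < R c then st (i, c) else 0) + tail st (lab i c) (Suc c)"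
  using assms by (simp add: tail_Suc colsum_place)

definition same_label :: "nat \<Rightarrow> nat \<Rightarrow> nat \<Rightarrow> bool" where
  "same_label i c c' \<longleftrightarrow> (\<exists>i'. pl i' c' \<and> lab i' c' = lab i c)"

text \<open>Closure under going back along chains. For reads it brings in the immediate successor of
  a place once any successor is present; for updates it makes all columns outside the set
  vanish.\<close>

definition closed_cols :: "nat set \<Rightarrow> bool" where
  "closed_cols Rd \<longleftrightarrow> Rd \<subseteq> {..<M} \<and>
     (\<forall>c\<in>Rd. \<forall>c'<c. \<forall>i. pl i c \<and> same_label i c c' \<longrightarrow> c' \<in> Rd)"

text \<open>Decoding proceeds from the last column to the first: a place of row \<open>\<ge> k c\<close> has a successor
  with the same label that is already decoded.\<close>

lemma read_columns:
  assumes closed: "closed_cols Rd"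
    and k: "\<And>c. c \<in> Rd \<Longrightarrow> T c \<le> k c" "\<And>c i. c \<in> Rd \<Longrightarrow> i < k c \<Longrightarrow> pl i c"
    and succ: "\<And>c i. c \<in> Rd \<Longrightarrow> k c \<le> i \<Longrightarrow> pl i c \<Longrightarrow> \<exists>c'\<in>Rd. c < c' \<and> same_label i c c'"
    and E: "\<And>c. c \<in> Rd \<Longrightarrow> E c \<subseteq> {1..N}" "\<And>c. c \<in> Rd \<Longrightarrow> card (E c) = R c + k c - T c"
    and zero: "\<And>c n. c \<in> Rd \<Longrightarrow> n \<in> E c \<Longrightarrow> p dvd enc st n c"
  shows "c \<in> Rd \<Longrightarrow> (\<forall>i<R c. p dvd st (i, c)) \<and> (\<forall>i. pl i c \<longrightarrow> p dvd tail st (lab i c) c)"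
proof (induction "M - c" arbitrary: c rule: less_induct)
  case less
  have cM: "c < M" using less.prems closed by (auto simp: closed_cols_def)
  have later: "p dvd tail st (lab i c) (Suc c)" if i: "k c \<le> i" "pl i c" for i
  proof -
    let ?P = "\<lambda>d. c < d \<and> same_label i c d"
    obtain c' where c': "c' \<in> Rd" "?P c'" using succ[OF less.prems i] by auto
    \<comment> \<open>The next column on the chain. No column strictly between \<open>c\<close> and
      \<open>d\<close> contributes to the partial sum.\<close>
    define d where "d = (LEAST d. ?P d)"
    have d: "?P d" unfolding d_def by (rule LeastI[of ?P, OF c'(2)])
    have "d \<le> c'" unfolding d_def by (rule Least_le[of ?P, OF c'(2)])
    obtain j where j: "pl j d" "lab j d = lab i c" using d by (auto simp: same_label_def)
    have "d \<in> Rd"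
    proof (cases "d = c'")
      case False
      then have "d < c'" using \<open>d \<le> c'\<close> by simp
      obtain i' where i': "pl i' c'" "lab i' c' = lab i c" using c'(2) by (auto simp: same_label_def)
      then have "same_label i' c' d" using j by (auto simp: same_label_def)
      then show ?thesis using closed c'(1) \<open>d < c'\<close> i' unfolding closed_cols_def by blast
    qed (use c' in simp)
    then have dM: "d < M" using closed by (auto simp: closed_cols_def)
    have "M - d < M - c" using d dM cM by auto
    from less.hyps[OF this \<open>d \<in> Rd\<close>] have "p dvd tail st (lab j d) d" using j by blast
    moreover have "tail st (lab i c) (Suc c) = tail st (lab i c) d"
    proof (rule tail_skip)
      fix e i' assume e: "Suc c \<le> e" "e < d" "pl i' e"
      then have "\<not> ?P e" unfolding d_def by (metis not_less_Least)
      then show "lab i' e \<noteq> lab i c" using e by (auto simp: same_label_def)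
    qed (use d dM in auto)
    ultimately show ?thesis using j by simp
  qed
  let ?u = "\<lambda>i. st (i, c)" and ?v = "\<lambda>i. tail st (lab i c) c"
  have dec: "(\<forall>i<R c. p dvd ?u i) \<and> (\<forall>i\<ge>T c. pl i c \<longrightarrow> p dvd ?v i)"
  proof (rule gp_read[OF cM, of "k c" "E c"])
    fix n assume "n \<in> E c"
    then show "p dvd (\<Sum>i<R c. ?u i * \<alpha> n ^ i) + (\<Sum>i | T c \<le> i \<and> pl i c. ?v i * \<alpha> n ^ (h + i))"
      using zero[OF less.prems] by (simp add: enc_def)
  next
    fix i assume "k c \<le> i" "pl i c"
    then show "p dvd ?v i - (if i < R c then ?u i else 0)"
      using later[of i] by (simp add: tail_place[OF cM])
  qed (use k E less.prems in auto)
  \<comment> \<open>In rows below \<open>T c\<close> the chain ends at \<open>c\<close>, so the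
    partial sum is the free symbol itself and no high coefficient carries it.\<close>
  moreover have "p dvd ?v i" if "pl i c" "i < T c" for i
  proof -
    have "tail st (lab i c) (Suc c) = tail st (lab i c) M"
      using lab_top[OF that(2,1)] cM by (intro tail_skip) auto
    also have "\<dots> = 0" by (simp add: tail_def)
    finally show ?thesis using dec that T_le[OF cM] by (simp add: tail_place[OF cM])
  qed
  ultimately show ?case by (metis not_le)
qed

text \<open>The message symbol equals the partial sum at the first column of \<open>Rd\<close> on
  its chain, since closure leaves no earlier column on the chain.\<close>

lemma read_msg:
  assumes closed: "closed_cols Rd"
    and k: "\<And>c. c \<in> Rd \<Longrightarrow> T c \<le> k c" "\<And>c i. c \<in> Rd \<Longrightarrow> i < k c \<Longrightarrow> pl i c"
    and succ: "\<And>c i. c \<in> Rd \<Longrightarrow> k c \<le> i \<Longrightarrow> pl i c \<Longrightarrow> \<exists>c'\<in>Rd. c < c' \<and> same_label i c c'"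
    and E: "\<And>c. c \<in> Rd \<Longrightarrow> E c \<subseteq> {1..N}" "\<And>c. c \<in> Rd \<Longrightarrow> card (E c) = R c + k c - T c"
    and zero: "\<And>c n. c \<in> Rd \<Longrightarrow> n \<in> E c \<Longrightarrow> p dvd enc st n c"
    and hit: "\<exists>c\<in>Rd. \<exists>i. pl i c \<and> lab i c = w"
  shows "p dvd msg st w"
proof -
  let ?P = "\<lambda>c. c \<in> Rd \<and> (\<exists>i. pl i c \<and> lab i c = w)"
  define c where "c = (LEAST c. ?P c)"
  have "?P c" unfolding c_def by (rule LeastI_ex) (use hit in blast)
  then obtain i where i: "c \<in> Rd" "pl i c" "lab i c = w" by blast
  have "msg st w = tail st w c"
    unfolding msg_def
  proof (rule tail_skip)
    fix d j assume d: "d < c" "pl j d"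
    show "lab j d \<noteq> w"
    proof
      assume "lab j d = w"
      then have "same_label i c d" using d i by (auto simp: same_label_def)
      then have "d \<in> Rd" using closed i d unfolding closed_cols_def by blast
      then have "?P d" using d \<open>lab j d = w\<close> by blast
      then show False using d(1) not_less_Least unfolding c_def by blast
    qed
  qed (use i closed in \<open>auto simp: closed_cols_def\<close>)
  moreover have "(\<forall>i<R c. p dvd st (i, c)) \<and> (\<forall>i. pl i c \<longrightarrow> p dvd tail st (lab i c) c)"
    using i(1) by (rule read_columns[OF closed k succ E zero, rotated -1])
  ultimately show ?thesis using i by auto
qed

text \<open>Conversely, for a codeword of message zero the columns vanish from the first to the last.\<close>

lemma write_columns:
  assumes Wr: "Wr \<subseteq> {..<M}"
    and k: "\<And>c. c \<in> Wr \<Longrightarrow> k c \<le> R c" "\<And>c i. c \<in> Wr \<Longrightarrow> i < k c \<Longrightarrow> pl i c"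
    and last: "\<And>c c' i. c \<in> Wr \<Longrightarrow> c' \<in> Wr \<Longrightarrow> c < c' \<Longrightarrow> i < k c \<Longrightarrow> \<not> same_label i c c'"
    and E: "\<And>c. c \<in> Wr \<Longrightarrow> E c \<subseteq> {1..N}" "\<And>c. c \<in> Wr \<Longrightarrow> card (E c) = R c - k c"
    and zero: "\<And>c n. c \<in> Wr \<Longrightarrow> n \<in> E c \<Longrightarrow> p dvd enc st n c"
    and supp: "\<And>i c. c < M \<Longrightarrow> i < R c \<Longrightarrow> c \<notin> Wr \<Longrightarrow> p dvd st (i, c)"
    and msg: "\<And>w. w < L \<Longrightarrow> p dvd msg st w"
  shows "c < M \<Longrightarrow> \<forall>i<R c. p dvd st (i, c)"
proof (induction c rule: less_induct)
  case (less c)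
  show ?case
  proof (cases "c \<in> Wr")
    case True
    note cM = less.prems
    have tail0: "p dvd tail st (lab i c) c" if "pl i c" for i
    proof -
      have "msg st (lab i c) = (\<Sum>d=0..<c. colsum st (lab i c) d) + tail st (lab i c) c"
        unfolding msg_def tail_def using cM by (intro sum.atLeastLessThan_concat[symmetric]) auto
      moreover have "p dvd (\<Sum>d=0..<c. colsum st (lab i c) d)"
        using less.IH cM by (intro dvd_sum dvd_colsum) auto
      ultimately show ?thesis using msg[OF lab_lt[OF cM that]] by (simp add: dvd_add_right_iff)
    qed
    \<comment> \<open>No later column of \<open>Wr\<close> carries the label, so modulo
      \<open>p\<close> the free symbol equals the partial sum, which is already known to
      vanish.\<close>
    have low: "p dvd st (i, c)" if i: "i < k c" for i
    proof -
      have "p dvd tail st (lab i c) (Suc c)"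
        unfolding tail_def
      proof (rule dvd_sum)
        fix c' assume c': "c' \<in> {Suc c..<M}"
        show "p dvd colsum st (lab i c) c'"
        proof (cases "c' \<in> Wr")
          case True
          then have "\<not> same_label i c c'" using last[OF \<open>c \<in> Wr\<close> True _ i] c' by simp
          then have "colsum st (lab i c) c' = 0"
            by (intro colsum_no_place) (auto simp: same_label_def)
          then show ?thesis by simp
        next
          case False
          then show ?thesis using c' by (intro dvd_colsum supp) auto
        qed
      qed
      moreover have "tail st (lab i c) c = st (i, c) + tail st (lab i c) (Suc c)"
        using tail_place[OF cM k(2)[OF True i]] k(1)[OF True] i by simp
      ultimately show ?thesis
        using tail0[OF k(2)[OF True i]] by (simp add: dvd_add_left_iff)
    qed
    \<comment> \<open>With the lowest \<open>k c\<close> coefficients and all high ones gone,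
      \<open>R c - k c\<close> monomials remain against as many prescribed zeros.\<close>
    have "p dvd (\<Sum>i=k c..<R c. st (i, c) * \<alpha> n ^ i)" if n: "n \<in> E c" for n
    proof -
      have "(\<Sum>i<R c. st (i, c) * \<alpha> n ^ i) =
          (\<Sum>i=0..<k c. st (i, c) * \<alpha> n ^ i) + (\<Sum>i=k c..<R c. st (i, c) * \<alpha> n ^ i)"
        unfolding lessThan_atLeast0 using k(1)[OF True] by (intro sum.atLeastLessThan_concat[symmetric]) auto
      then have eq: "enc st n c = (\<Sum>i=k c..<R c. st (i, c) * \<alpha> n ^ i) + ((\<Sum>i=0..<k c. st (i, c) * \<alpha> n ^ i) +
        (\<Sum>i | T c \<le> i \<and> pl i c. tail st (lab i c) c * \<alpha> n ^ (h + i)))"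
        unfolding enc_def by simp
      have "p dvd (\<Sum>i=0..<k c. st (i, c) * \<alpha> n ^ i) +
          (\<Sum>i | T c \<le> i \<and> pl i c. tail st (lab i c) c * \<alpha> n ^ (h + i))"
        using low tail0 by (intro dvd_add dvd_sum dvd_mult2) auto
      from dvd_add_left_iff[OF this] show ?thesis using zero[OF True n] unfolding eq by blast
    qed
    then have "\<forall>i\<in>{k c..<R c}. p dvd st (i, c)"
      using gp_write[OF cM k(1)[OF True] E(1)[OF True] E(2)[OF True], of "\<lambda>i. st (i, c)"] by blast
    then show ?thesis using low by (metis atLeastLessThan_iff not_le)
  qed (use supp less.prems in simp)
qed

section \<open>Finite sets of states and existence of codewords by counting\<close>

definition idx :: "(nat \<times> nat) set" where
  "idx = (SIGMA c:{..<M}. {..<R c})\<inverse>"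

definition states :: "(nat \<times> nat \<Rightarrow> int) set" where
  "states = idx \<rightarrow>\<^sub>E {0..<p}"

definition states_on :: "nat set \<Rightarrow> (nat \<times> nat \<Rightarrow> int) set" where
  "states_on Wr = {st \<in> states. \<forall>(i, c)\<in>idx. c \<notin> Wr \<longrightarrow> st (i, c) = 0}"

lemma mem_idx: "(i, c) \<in> idx \<longleftrightarrow> c < M \<and> i < R c"
  by (auto simp: idx_def)

lemma finite_idx: "finite idx"
  by (auto simp: idx_def)

lemma p_pos: "0 < p" using p prime_gt_0_int by blast

lemma finite_states: "finite states"
  unfolding states_def using finite_idx by (intro finite_PiE) auto

lemma states_onD: "st \<in> states_on Wr \<Longrightarrow> c < M \<Longrightarrow> i < R c \<Longrightarrow> c \<notin> Wr \<Longrightarrow> st (i, c) = 0"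
  unfolding states_on_def using mem_idx by fastforce

lemma card_states_on:
  assumes "Wr \<subseteq> {..<M}"
  shows "card (states_on Wr) = nat p ^ (\<Sum>c\<in>Wr. R c)"
proof -
  let ?I = "(SIGMA c:Wr. {..<R c})\<inverse>"
  have sub: "?I \<subseteq> idx" using assms by (auto simp: idx_def)
  have finW: "finite Wr" using assms finite_subset by blast
  have "states_on Wr = (\<Pi>\<^sub>E x\<in>idx. if snd x \<in> Wr then {0..<p} else {0})"
  proof (intro equalityI subsetI)
    fix st assume st: "st \<in> states_on Wr"
    then show "st \<in> (\<Pi>\<^sub>E x\<in>idx. if snd x \<in> Wr then {0..<p} else {0})"
      unfolding states_on_def states_def by (intro PiE_I) (auto simp: PiE_iff extensional_def)
  next
    fix st assume st: "st \<in> (\<Pi>\<^sub>E x\<in>idx. if snd x \<in> Wr then {0..<p} else {0})"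
    then have val: "st x \<in> (if snd x \<in> Wr then {0..<p} else {0})" if "x \<in> idx" for x
      using that by (rule PiE_mem)
    have "st \<in> states"
      unfolding states_def
    proof (rule PiE_I)
      fix x assume "x \<in> idx"
      from val[OF this] show "st x \<in> {0..<p}" using p_pos by (auto split: if_splits)
    next
      fix x assume "x \<notin> idx"
      then show "st x = undefined" using st by (rule_tac PiE_arb)
    qed
    moreover have "st (i, c) = 0" if "(i, c) \<in> idx" "c \<notin> Wr" for i c
      using val[OF that(1)] that(2) by simp
    ultimately show "st \<in> states_on Wr" unfolding states_on_def by auto
  qed
  then have "card (states_on Wr) = (\<Prod>x\<in>idx. card (if snd x \<in> Wr then {0..<p} else {0}))"
    by (simp only: card_PiE finite_idx)
  also have "\<dots> = (\<Prod>x\<in>idx. if snd x \<in> Wr then nat p else 1)" by (intro prod.cong) auto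
  also have "\<dots> = (\<Prod>x\<in>?I. nat p)"
    using sub by (intro prod.mono_neutral_cong_right finite_idx) (auto simp: idx_def)
  also have "\<dots> = nat p ^ card (SIGMA c:Wr. {..<R c})" by simp
  also have "card (SIGMA c:Wr. {..<R c}) = (\<Sum>c\<in>Wr. R c)" using finW by simp
  finally show ?thesis .
qed

text \<open>By \<open>write_columns\<close> the prescribed values and the message determine a state
  supported on \<open>Wr\<close>. Since \<open>R c - k c\<close> and \<open>k c\<close> add up to
  \<open>R c\<close>, states and targets are equally many, and injectivity gives
  surjectivity.\<close>

lemma write_exists:
  assumes Wr: "Wr \<subseteq> {..<M}"
    and k: "\<And>c. c \<in> Wr \<Longrightarrow> k c \<le> R c" "\<And>c i. c \<in> Wr \<Longrightarrow> i < k c \<Longrightarrow> pl i c"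
    and last: "\<And>c c' i. c \<in> Wr \<Longrightarrow> c' \<in> Wr \<Longrightarrow> c < c' \<Longrightarrow> i < k c \<Longrightarrow> \<not> same_label i c c'"
    and E: "\<And>c. c \<in> Wr \<Longrightarrow> E c \<subseteq> {1..N}" "\<And>c. c \<in> Wr \<Longrightarrow> card (E c) = R c - k c"
    and count: "(\<Sum>c\<in>Wr. k c) = L"
    and d: "\<And>w. w < L \<Longrightarrow> d w \<in> {0..<p}"
  shows "\<exists>st\<in>states_on Wr. (\<forall>c\<in>Wr. \<forall>n\<in>E c. p dvd enc st n c) \<and> (\<forall>w<L. msg st w mod p = d w)"
proof -
  let ?A = "SIGMA c:Wr. E c"
  let ?X = "(?A <+> {..<L}) \<rightarrow>\<^sub>E {0..<p}"
  define f where "f = (\<lambda>st. restrict (\<lambda>x. case x of Inl (c, n) \<Rightarrow> enc st n c mod p | Inr w \<Rightarrow> msg st w mod p) (?A <+> {..<L}))"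
  have finW: "finite Wr" using Wr finite_subset by blast
  have finE: "finite (E c)" if "c \<in> Wr" for c using E(1)[OF that] finite_subset by blast
  have finA: "finite ?A" using finW finE by auto
  have "(\<Sum>c\<in>Wr. card (E c)) + L = (\<Sum>c\<in>Wr. R c)"
  proof -
    have "(\<Sum>c\<in>Wr. card (E c)) + (\<Sum>c\<in>Wr. k c) = (\<Sum>c\<in>Wr. R c)"
      unfolding sum.distrib[symmetric] using E(2) k(1) by (intro sum.cong) auto
    then show ?thesis using count by simp
  qed
  then have cardX: "card ?X = card (states_on Wr)"
    using finA finE finW by (simp add: card_PiE card_Plus card_SigmaI card_states_on[OF Wr] prod_constant)
  have fX: "f ` states_on Wr \<subseteq> ?X"
  proof (intro image_subsetI)
    fix st
    show "f st \<in> ?X" unfolding f_def using p_pos by (auto split: sum.split)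
  qed
  have "inj_on f (states_on Wr)"
  proof (rule inj_onI)
    fix a b assume a: "a \<in> states_on Wr" and b: "b \<in> states_on Wr" and eq: "f a = f b"
    have enc_eq: "enc a n c mod p = enc b n c mod p" if "c \<in> Wr" "n \<in> E c" for c n
      using fun_cong[OF eq, of "Inl (c, n)"] that by (simp add: f_def InlI InrI)
    have msg_eq: "msg a w mod p = msg b w mod p" if "w < L" for w
      using fun_cong[OF eq, of "Inr w"] that by (simp add: f_def InlI InrI)
    have dvd: "\<forall>i<R c. p dvd a (i, c) - b (i, c)" if "c < M" for c
    proof (rule write_columns[OF Wr k last E _ _ _ that, where st = "\<lambda>x. a x - b x"])
      show "p dvd enc (\<lambda>x. a x - b x) n c" if "c \<in> Wr" "n \<in> E c" for c n
        unfolding enc_diff using enc_eq[OF that] by (simp add: mod_eq_dvd_iff)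
      show "p dvd msg (\<lambda>x. a x - b x) w" if "w < L" for w
        unfolding msg_diff using msg_eq[OF that] by (simp add: mod_eq_dvd_iff)
      show "p dvd a (i, c) - b (i, c)" if "c < M" "i < R c" "c \<notin> Wr" for i c
        using states_onD[OF a that] states_onD[OF b that] by simp
    qed
    have ab: "a \<in> idx \<rightarrow>\<^sub>E {0..<p}" "b \<in> idx \<rightarrow>\<^sub>E {0..<p}"
      using a b by (auto simp: states_on_def states_def)
    show "a = b"
    proof (rule PiE_ext[OF ab])
      fix x assume x: "x \<in> idx"
      then have "p dvd a x - b x" using dvd by (cases x) (auto simp: mem_idx)
      then have "a x mod p = b x mod p" by (simp add: mod_eq_dvd_iff)
      then show "a x = b x" using PiE_mem[OF ab(1) x] PiE_mem[OF ab(2) x] by simp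
    qed
  qed
  then have "f ` states_on Wr = ?X"
    using fX cardX finA by (intro card_subset_eq) (auto simp: card_image intro!: finite_PiE)
  moreover have "restrict (\<lambda>x. case x of Inl _ \<Rightarrow> 0 | Inr w \<Rightarrow> d w) (?A <+> {..<L}) \<in> ?X"
    using d p_pos by (auto split: sum.split)
  ultimately obtain st where st: "st \<in> states_on Wr"
    and eq: "f st = restrict (\<lambda>x. case x of Inl _ \<Rightarrow> 0 | Inr w \<Rightarrow> d w) (?A <+> {..<L})"
    by (metis (no_types, lifting) imageE)
  have "p dvd enc st n c" if "c \<in> Wr" "n \<in> E c" for c n
    using fun_cong[OF eq, of "Inl (c, n)"] that by (simp add: f_def InlI dvd_eq_mod_eq_0)
  moreover have "msg st w mod p = d w" if "w < L" for w
    using fun_cong[OF eq, of "Inr w"] that by (simp add: f_def InlI InrI)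
  ultimately show ?thesis using st by blast
qed

text \<open>A later column of \<open>Wr\<close> on a chain through \<open>c\<close> would force
  \<open>c\<close> into \<open>Wr\<close>, so the partial sums at \<open>c\<close> involve only
  symbols that are zero.\<close>

lemma enc_outside:
  assumes Wr: "closed_cols Wr" and st: "st \<in> states_on Wr" and c: "c < M" "c \<notin> Wr"
  shows "enc st n c = 0"
proof -
  have "tail st (lab i c) c = 0" if "pl i c" for i
    unfolding tail_def
  proof (rule sum.neutral, rule ballI)
    fix c' assume c': "c' \<in> {c..<M}"
    show "colsum st (lab i c) c' = 0"
    proof (cases "c' \<in> Wr")
      case True
      then have "c < c'" using c' c by (metis atLeastLessThan_iff le_neq_implies_less)
      have "\<not> (pl i' c' \<and> lab i' c' = lab i c)" for i'
      proof
        assume i': "pl i' c' \<and> lab i' c' = lab i c"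
        then have "same_label i' c' c" using that by (auto simp: same_label_def)
        then show False using Wr True \<open>c < c'\<close> i' c unfolding closed_cols_def by blast
      qed
      then show ?thesis by (intro colsum_no_place) blast
    next
      case False
      then show ?thesis
        unfolding colsum_def using states_onD[OF st] c' by (intro sum.neutral) auto
    qed
  qed
  then show ?thesis unfolding enc_def using states_onD[OF st c(1) _ c(2)] by (auto intro!: sum.neutral)
qed

end

text \<open>Alphabet size of answers and uploads, which vanish outside the columns in
  \<open>P\<close>; its logarithm bounds their entropies.\<close>

lemma card_sparse_lists:
  fixes p :: int and m :: nat and P :: "nat set"
  assumes "0 < p"
  defines "Z \<equiv> {xs. length xs = m \<and> set xs \<subseteq> {0..<p} \<and> (\<forall>c<m. c \<notin> P \<longrightarrow> xs ! c = 0)}"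
  shows "finite Z" and "card Z \<le> nat p ^ card (P \<inter> {..<m})"
proof -
  let ?A = "P \<inter> {..<m}"
  have fin: "finite (?A \<rightarrow>\<^sub>E {0..<p})" by (intro finite_PiE) auto
  have inj: "inj_on (\<lambda>xs. restrict (nth xs) ?A) Z"
  proof (rule inj_onI)
    fix xs ys assume xs: "xs \<in> Z" and ys: "ys \<in> Z" and eq: "restrict (nth xs) ?A = restrict (nth ys) ?A"
    show "xs = ys"
    proof (rule nth_equalityI)
      fix c assume "c < length xs"
      then have c: "c < m" using xs by (simp add: Z_def)
      show "xs ! c = ys ! c"
      proof (cases "c \<in> P")
        case True
        then show ?thesis using fun_cong[OF eq, of c] c by simp
      next
        case False
        then show ?thesis using xs ys c by (simp add: Z_def)
      qed
    qed (use xs ys in \<open>simp add: Z_def\<close>)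
  qed
  have sub: "(\<lambda>xs. restrict (nth xs) ?A) ` Z \<subseteq> ?A \<rightarrow>\<^sub>E {0..<p}"
  proof (intro image_subsetI)
    fix xs assume "xs \<in> Z"
    then show "restrict (nth xs) ?A \<in> ?A \<rightarrow>\<^sub>E {0..<p}"
      unfolding restrict_PiE_iff by (auto simp: Z_def subset_iff)
  qed
  show "finite Z" using inj_on_finite[OF inj sub fin] .
  have "card Z \<le> card (?A \<rightarrow>\<^sub>E {0..<p})" by (rule card_inj_on_le[OF inj sub fin])
  also have "\<dots> = nat p ^ card ?A" by (simp add: card_PiE prod_constant)
  finally show "card Z \<le> nat p ^ card ?A" .
qed


subsection \<open>The families of polynomials that occur in decoding\<close>

text \<open>The system of one column once later columns are decoded. In rows
  \<open>i \<ge> k\<close> the high coefficient is then the free symbol of that row, or zero if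
  there is none; the remaining unknowns are the free symbols and the high coefficients of rows
  \<open>T\<close> to \<open>k - 1\<close>.\<close>

definition read_basis :: "nat \<Rightarrow> nat \<Rightarrow> nat \<Rightarrow> nat \<Rightarrow> nat set \<Rightarrow> nat \<Rightarrow> int poly" where
  "read_basis h R T k P r =
     (if r < R then monom 1 r + (if k \<le> r \<and> r \<in> P then monom 1 (h + r) else 0)
      else monom 1 (h + T + (r - R)))"

text \<open>The owned degrees are those below \<open>R \<le> h\<close> and those from
  \<open>h + T\<close> to \<open>h + k - 1\<close>; the extra monomials attached to free symbols
  have degree at least \<open>h + k\<close>.\<close>

lemma separated_read_basis:
  assumes "R \<le> h" "T \<le> R" "T \<le> k" "k \<le> J"
  shows "separated (2 * h + J) (R + k - T) (read_basis h R T k P)"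
  unfolding separated_def
proof
  have deg: "degree (monom (1 :: int) e) \<le> 2 * h + J" if "e \<le> 2 * h + J" for e
    using that degree_monom_le[of "1 :: int" e] by linarith
  show "\<forall>r<R + k - T. degree (read_basis h R T k P r) \<le> 2 * h + J"
    using assms by (auto simp: read_basis_def intro!: degree_add_le deg)
  let ?e = "\<lambda>r. if r < R then r else h + T + (r - R)"
  have "coeff (read_basis h R T k P r') (?e r) = (if r' = r then 1 else 0)"
    if "r < R + k - T" "r' < R + k - T" for r r'
  proof (cases "r' < R")
    case True
    then have "coeff (read_basis h R T k P r') (?e r) =
        (if r' = ?e r then 1 else 0) + (if k \<le> r' \<and> r' \<in> P \<and> h + r' = ?e r then 1 else 0)"
      by (simp add: read_basis_def)
    moreover have "\<not> (k \<le> r' \<and> h + r' = ?e r)" "r' = ?e r \<longleftrightarrow> r' = r"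
      using assms that True by (auto split: if_splits)
    ultimately show ?thesis by auto
  next
    case False
    then show ?thesis using assms that by (auto simp: read_basis_def)
  qed
  then show "\<exists>e. \<forall>r<R + k - T. coeff (read_basis h R T k P r) (e r) = 1 \<and>
      (\<forall>r'<R + k - T. r' \<noteq> r \<longrightarrow> coeff (read_basis h R T k P r') (e r) = 0)"
    by (intro exI[of _ ?e]) simp
qed

lemma read_basis_zero:
  fixes p :: int and \<alpha> :: "nat \<Rightarrow> int"
  assumes uniq: "uniquely_solvable p \<alpha> E (card E) (read_basis h R T k P)"
    and R: "R \<le> h" "T \<le> R" "T \<le> k" and P: "finite P" "{..<k} \<subseteq> P" and E: "card E = R + k - T"
    and zero: "\<And>n. n \<in> E \<Longrightarrow> p dvd (\<Sum>i<R. u i * \<alpha> n ^ i) + (\<Sum>i | T \<le> i \<and> i \<in> P. v i * \<alpha> n ^ (h + i))"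
    and dep: "\<And>i. k \<le> i \<Longrightarrow> i \<in> P \<Longrightarrow> p dvd v i - (if i < R then u i else 0)"
  shows "(\<forall>i<R. p dvd u i) \<and> (\<forall>i\<ge>T. i \<in> P \<longrightarrow> p dvd v i)"
proof -
  define z where "z = (\<lambda>r. if r < R then u r else v (T + (r - R)))"
  let ?Q = "{i \<in> P. k \<le> i}"
  have split: "{i. T \<le> i \<and> i \<in> P} = {T..<k} \<union> ?Q" using P R by auto
  have "p dvd (\<Sum>r<card E. z r * poly (read_basis h R T k P r) (\<alpha> n))" if n: "n \<in> E" for n
  proof -
    let ?a = "\<alpha> n"
    let ?w = "\<Sum>i\<in>?Q. (if i < R then u i else 0) * ?a ^ (h + i)"
    have "(\<Sum>i<R. z i * poly (read_basis h R T k P i) ?a) =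
        (\<Sum>i<R. u i * ?a ^ i) + (\<Sum>i<R. if k \<le> i \<and> i \<in> P then u i * ?a ^ (h + i) else 0)"
      unfolding sum.distrib[symmetric]
      by (intro sum.cong) (auto simp: z_def read_basis_def poly_monom algebra_simps)
    also have "(\<Sum>i<R. if k \<le> i \<and> i \<in> P then u i * ?a ^ (h + i) else 0) =
        (\<Sum>i\<in>{..<R} \<inter> ?Q. u i * ?a ^ (h + i))"
      by (subst sum.inter_restrict) (auto intro!: sum.cong)
    also have "\<dots> = (\<Sum>i\<in>?Q. if i < R then u i * ?a ^ (h + i) else 0)"
      using P by (subst Int_commute, subst sum.inter_restrict) auto
    also have "\<dots> = ?w" by (intro sum.cong) auto
    finally have low: "(\<Sum>i<R. z i * poly (read_basis h R T k P i) ?a) = (\<Sum>i<R. u i * ?a ^ i) + ?w" .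
    have "(\<Sum>i=R..<R + (k - T). z i * poly (read_basis h R T k P i) ?a) =
        (\<Sum>i=T..<k. v i * ?a ^ (h + i))"
      by (rule sum.reindex_bij_witness[where i = "\<lambda>i. i + R - T" and j = "\<lambda>i. i + T - R"])
        (use R in \<open>auto simp: z_def read_basis_def poly_monom add.commute add.left_commute\<close>)
    moreover have "(\<Sum>r<card E. z r * poly (read_basis h R T k P r) ?a) =
        (\<Sum>i<R. z i * poly (read_basis h R T k P i) ?a) +
        (\<Sum>i=R..<R + (k - T). z i * poly (read_basis h R T k P i) ?a)"
      unfolding E lessThan_atLeast0 using R by (subst sum.atLeastLessThan_concat) auto
    ultimately have eq: "(\<Sum>r<card E. z r * poly (read_basis h R T k P r) ?a) =
        (\<Sum>i<R. u i * ?a ^ i) + (\<Sum>i=T..<k. v i * ?a ^ (h + i)) + ?w"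
      using low by simp
    have "(\<Sum>i | T \<le> i \<and> i \<in> P. v i * ?a ^ (h + i)) =
        (\<Sum>i=T..<k. v i * ?a ^ (h + i)) + (\<Sum>i\<in>?Q. v i * ?a ^ (h + i))"
      unfolding split using P by (intro sum.union_disjoint) auto
    then have "p dvd (\<Sum>i<R. u i * ?a ^ i) + ((\<Sum>i=T..<k. v i * ?a ^ (h + i)) + (\<Sum>i\<in>?Q. v i * ?a ^ (h + i)))"
      using zero[OF n] by simp
    moreover have "p dvd (\<Sum>i\<in>?Q. (v i - (if i < R then u i else 0)) * ?a ^ (h + i))"
      using dep by (intro dvd_sum dvd_mult2) auto
    then have "p dvd (\<Sum>i\<in>?Q. v i * ?a ^ (h + i)) - ?w"
      by (simp add: left_diff_distrib sum_subtractf)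
    ultimately have "p dvd (\<Sum>i<R. u i * ?a ^ i) + ((\<Sum>i=T..<k. v i * ?a ^ (h + i)) +
        (\<Sum>i\<in>?Q. v i * ?a ^ (h + i))) - ((\<Sum>i\<in>?Q. v i * ?a ^ (h + i)) - ?w)"
      by (rule dvd_diff)
    then show ?thesis unfolding eq by (simp only: algebra_simps) (simp add: algebra_simps)
  qed
  then have z: "p dvd z r" if "r < R + (k - T)" for r
    using uniq that R E unfolding uniquely_solvable_def by auto
  have u: "p dvd u i" if "i < R" for i using z[of i] that by (simp add: z_def)
  have "p dvd v i" if i: "T \<le> i" "i \<in> P" for i
  proof (cases "i < k")
    case True
    have "z (R + (i - T)) = v i" using i by (simp only: z_def) auto
    then show ?thesis using z[of "R + (i - T)"] i True by simp
  next
    case False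
    then have "p dvd v i - (if i < R then u i else 0)" using dep i by simp
    then have "p dvd (v i - (if i < R then u i else 0)) + (if i < R then u i else 0)"
      by (rule dvd_add) (use u in auto)
    then show ?thesis by simp
  qed
  then show ?thesis using u by blast
qed

lemma separated_monom: "k + m \<le> Suc d \<Longrightarrow> separated d m (\<lambda>r. monom 1 (k + r))"
  unfolding separated_def
  by (auto intro!: exI[of _ "\<lambda>r. k + r"] order_trans[OF degree_monom_le])

lemma monom_zero:
  fixes p :: int and \<alpha> :: "nat \<Rightarrow> int"
  assumes uniq: "uniquely_solvable p \<alpha> E (card E) (\<lambda>r. monom 1 (k + r))"
    and E: "k \<le> R" "card E = R - k"
    and zero: "\<And>n. n \<in> E \<Longrightarrow> p dvd (\<Sum>i=k..<R. u i * \<alpha> n ^ i)"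
  shows "\<forall>i\<in>{k..<R}. p dvd u i"
proof -
  have "(\<Sum>r<card E. u (k + r) * poly (monom 1 (k + r)) (\<alpha> n)) = (\<Sum>i=k..<R. u i * \<alpha> n ^ i)" for n
    unfolding E(2)
    by (rule sum.reindex_bij_witness[where i = "\<lambda>i. i - k" and j = "\<lambda>i. k + i"]) (auto simp: poly_monom)
  then have "\<forall>r<card E. p dvd u (k + r)"
    using uniq zero unfolding uniquely_solvable_def by (auto dest!: spec[of _ "\<lambda>r. u (k + r)"])
  then show ?thesis
    using E by (metis atLeastLessThan_iff diff_less_mono le_add_diff_inverse)
qed

lemma decoding_points_exist:
  fixes N h J :: nat
  shows "\<exists>(p :: int) \<alpha> :: nat \<Rightarrow> int. prime p \<and>
    (\<forall>R T k P E. R \<le> h \<and> T \<le> R \<and> T \<le> k \<and> k \<le> J \<and> P \<subseteq> {..<J} \<and> E \<subseteq> {1..N} \<and> card E = R + k - T \<longrightarrow>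
       uniquely_solvable p \<alpha> E (card E) (read_basis h R T k P)) \<and>
    (\<forall>k E. k + card E \<le> h \<and> E \<subseteq> {1..N} \<longrightarrow> uniquely_solvable p \<alpha> E (card E) (\<lambda>r. monom 1 (k + r)))"
proof -
  \<comment> \<open>\<open>A\<close> collects the systems of reads and \<open>B\<close> those of
    updates. Both families are finite, so one prime and one choice of points serve all of
    them.\<close>
  define A where "A = (\<lambda>(R, T, k, P). (R + k - T, read_basis h R T k P)) `
     {(R, T, k, P). R \<le> h \<and> T \<le> R \<and> T \<le> k \<and> k \<le> J \<and> P \<subseteq> {..<J}}"
  define B where "B = (\<lambda>(k, m). (m, \<lambda>r. monom (1 :: int) (k + r))) ` {(k, m). k + m \<le> h}"
  let ?d = "2 * h + J"
  have "finite A"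
    unfolding A_def by (intro finite_imageI, rule finite_subset[of _ "{..h} \<times> {..h} \<times> {..J} \<times> Pow {..<J}"]) auto
  moreover have "finite B"
    unfolding B_def by (intro finite_imageI, rule finite_subset[of _ "{..h} \<times> {..h}"]) auto
  ultimately have fin: "finite (A \<union> B)" by simp
  obtain q :: nat where q: "prime q" "card (A \<union> B) * 2 ^ N * ?d < q" using bigger_prime by blast
  have sep: "separated ?d m b" if "(m, b) \<in> A \<union> B" for m b
    using that by (auto simp: A_def B_def intro!: separated_read_basis separated_monom)
  have "prime (int q)" using q by simp
  moreover have "int (card (A \<union> B) * 2 ^ N * ?d) < int q" using q by (simp only: of_nat_less_iff)
  ultimately obtain \<alpha> where "\<forall>(m, b)\<in>A \<union> B. \<forall>E. E \<subseteq> {1..N} \<and> card E \<le> m \<longrightarrow>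
      uniquely_solvable (int q) \<alpha> E (card E) b"
    using general_position_exists[OF _ fin sep] by blast
  then have \<alpha>: "uniquely_solvable (int q) \<alpha> E (card E) b"
    if "(m, b) \<in> A \<union> B" "E \<subseteq> {1..N}" "card E \<le> m" for m b E
    using that by blast
  have read: "uniquely_solvable (int q) \<alpha> E (card E) (read_basis h R T k P)"
    if "R \<le> h" "T \<le> R" "T \<le> k" "k \<le> J" "P \<subseteq> {..<J}" "E \<subseteq> {1..N}" "card E = R + k - T" for R T k P E
  proof -
    have "(R + k - T, read_basis h R T k P) \<in> A" unfolding A_def using that by (intro image_eqI[of _ _ "(R, T, k, P)"]) auto
    then show ?thesis using that by (intro \<alpha>[of "R + k - T"]) auto
  qed
  have monoms: "uniquely_solvable (int q) \<alpha> E (card E) (\<lambda>r. monom 1 (k + r))"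
    if "k + card E \<le> h" "E \<subseteq> {1..N}" for k E
  proof -
    have "(card E, \<lambda>r. monom 1 (k + r)) \<in> B" unfolding B_def using that by (intro image_eqI[of _ _ "(k, card E)"]) auto
    then show ?thesis using \<alpha>[of "card E"] that by simp
  qed
  show ?thesis
    by (intro exI[of _ "int q"] exI[of _ \<alpha>] conjI allI impI; (elim conjE)?)
      (rule \<open>prime (int q)\<close>, rule read, assumption+, rule monoms, assumption+)
qed


subsection \<open>Properties of staircase labellings\<close>

locale staircase_labels =
  fixes T J L :: nat and l :: "nat \<Rightarrow> nat \<Rightarrow> nat"
  assumes T: "1 \<le> T" "T \<le> J" and J_dvd: "\<And>k. 1 \<le> k \<Longrightarrow> k \<le> J \<Longrightarrow> k dvd L" and L: "0 < L"
    and l0: "\<And>i c. i < T \<Longrightarrow> l i c = i * (L div T) + c"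
    and bij: "\<And>k. T \<le> k \<Longrightarrow> k \<le> J \<Longrightarrow> bij_betw (\<lambda>(i, c). l i c) ({..<k} \<times> {..<L div k}) {..<L}"
begin

text \<open>The union of the blocks of \<open>k\<close> rows and \<open>L div k\<close> columns over
  \<open>T \<le> k \<le> J\<close>.\<close>

definition place :: "nat \<Rightarrow> nat \<Rightarrow> bool" where
  "place i c \<longleftrightarrow> i < J \<and> c < L div T \<and> c < L div Suc i"

lemma place_block: "T \<le> k \<Longrightarrow> k \<le> J \<Longrightarrow> i < k \<Longrightarrow> c < L div k \<Longrightarrow> place i c"
proof -
  assume k: "T \<le> k" "k \<le> J" "i < k" and c: "c < L div k"
  have "L div k \<le> L div T" "L div k \<le> L div Suc i" using k T by (auto intro!: div_le_mono2)
  then show ?thesis unfolding place_def using k c by auto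
qed

lemma place_lt: "place i c \<Longrightarrow> l i c < L"
proof -
  assume pl: "place i c"
  let ?k = "max T (Suc i)"
  have "(i, c) \<in> {..<?k} \<times> {..<L div ?k}" using pl by (auto simp: place_def max_def)
  moreover have "T \<le> ?k" "?k \<le> J" using pl T by (auto simp: place_def)
  ultimately show ?thesis using bij_betwE[OF bij[of ?k]] by fastforce
qed

text \<open>Both cells lie in the block of \<open>max k (Suc i')\<close> rows, where labels are
  distinct; for the cell in column \<open>c\<close> this uses \<open>c \<le> c'\<close>.\<close>

lemma label_unique:
  assumes k: "T \<le> k" "k \<le> J" "i < k" and c: "c \<le> c'" "c' < L div k" and pl: "place i' c'"
    and eq: "l i' c' = l i c"
  shows "i' = i \<and> c' = c"
proof -
  let ?k = "max k (Suc i')"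
  have "T \<le> ?k" "?k \<le> J" using k pl by (auto simp: place_def)
  then have "inj_on (\<lambda>(i, c). l i c) ({..<?k} \<times> {..<L div ?k})"
    using bij bij_betw_imp_inj_on by blast
  moreover have "(i', c') \<in> {..<?k} \<times> {..<L div ?k}" "(i, c) \<in> {..<?k} \<times> {..<L div ?k}"
    using c k pl by (auto simp: place_def max_def)
  ultimately have "(i', c') = (i, c)"
    using eq inj_onD[of "\<lambda>(i, c). l i c" _ "(i', c')" "(i, c)"] by simp
  then show ?thesis by simp
qed

lemma label_inj: "place i c \<Longrightarrow> place i' c \<Longrightarrow> l i c = l i' c \<Longrightarrow> i = i'"
proof (induction i i' rule: linorder_wlog)
  case (le i i')
  then have "i' = i \<and> c = c"
    using T by (intro label_unique[of "max T (Suc i)"]) (auto simp: place_def max_def)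
  then show ?case by simp
qed auto

text \<open>The block of \<open>i\<close> rows contains every label, hence also that of row
  \<open>i\<close>, in a row above. If this occurrence were not to the right of \<open>c\<close>,
  both cells would lie in the block of \<open>Suc i\<close> rows.\<close>

lemma label_succ:
  assumes k: "T \<le> k" "k \<le> i" and c: "c < L div k" and pl: "place i c"
  shows "\<exists>c' i'. c < c' \<and> c' < L div k \<and> place i' c' \<and> l i' c' = l i c"
proof -
  have i: "T \<le> i" "i \<le> J" "Suc i \<le> J" using k pl by (auto simp: place_def)
  have "l i c \<in> (\<lambda>(i, c). l i c) ` ({..<i} \<times> {..<L div i})"
    using place_lt[OF pl] bij[OF i(1,2)] by (auto simp: bij_betw_def)
  then obtain i' c' where i': "i' < i" "c' < L div i" "l i' c' = l i c" by auto
  have pl': "place i' c'" using place_block[OF i(1,2)] i' by simp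
  have "c < c'"
  proof (rule ccontr)
    assume "\<not> c < c'"
    then have "i = i' \<and> c = c'"
      using i i' pl by (intro label_unique[of "Suc i"]) (auto simp: place_def)
    then show False using i' by simp
  qed
  moreover have "c' < L div k" using i'(2) k T by (meson div_le_mono2 le_trans less_le_trans not_less_eq_eq zero_less_one)
  ultimately show ?thesis using i' pl' by blast
qed

lemma label_hit:
  assumes "T \<le> k" "k \<le> J" "w < L"
  shows "\<exists>c<L div k. \<exists>i<k. place i c \<and> l i c = w"
proof -
  have "w \<in> (\<lambda>(i, c). l i c) ` ({..<k} \<times> {..<L div k})"
    using bij[OF assms(1,2)] assms(3) by (auto simp: bij_betw_def)
  then show ?thesis using place_block[OF assms(1,2)] by auto
qed

end


subsection \<open>The code of the scheme\<close>

text \<open>With \<open>K0 = Rr - Om = min Kc (S + 1)\<close>, the main block of \<open>len = L / Kc\<close> columns is held by all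
  servers. For \<open>K0 < Kc\<close> there are \<open>Kc - K0\<close> further blocks of \<open>len\<close> columns, held by the
  unconstrained servers only. Block \<open>b\<close> continues the labels of row \<open>K0 + b - 1\<close> of the main block.\<close>

locale rdcds_code =
  fixes N Rr Kc S :: nat and p :: int and \<alpha> :: "nat \<Rightarrow> int" and l1 l2 :: "nat \<Rightarrow> nat \<Rightarrow> nat"
    and J len L om K0 M :: nat
  defines "J \<equiv> N + Kc" and "len \<equiv> fact (N + Kc)" and "L \<equiv> Kc * fact (N + Kc)"
    and "om \<equiv> Om Rr Kc S" and "K0 \<equiv> Rr - Om Rr Kc S"
    and "M \<equiv> (Kc - (Rr - Om Rr Kc S) + 1) * fact (N + Kc)"
  assumes feas: "feasible N Rr Kc S" and p: "prime p"
    and l1: "staircase_labels Kc J L l1" and l2: "staircase_labels (Suc 0) J len l2"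
    and points_read: "\<And>R T k P E. R \<le> Rr \<Longrightarrow> T \<le> R \<Longrightarrow> T \<le> k \<Longrightarrow> k \<le> J \<Longrightarrow> P \<subseteq> {..<J} \<Longrightarrow> E \<subseteq> {1..N} \<Longrightarrow>
      card E = R + k - T \<Longrightarrow> uniquely_solvable p \<alpha> E (card E) (read_basis Rr R T k P)"
    and points_write: "\<And>k E. k + card E \<le> Rr \<Longrightarrow> E \<subseteq> {1..N} \<Longrightarrow>
      uniquely_solvable p \<alpha> E (card E) (\<lambda>r. monom 1 (k + r))"
begin

sublocale main: staircase_labels Kc J L l1 by (rule l1)
sublocale extra: staircase_labels "Suc 0" J len l2 by (rule l2)

lemma K0: "1 \<le> K0" "K0 \<le> Kc" "om + K0 = Rr" "1 \<le> Kc" "S < Kc \<Longrightarrow> K0 = S + 1" "Kc \<le> S \<Longrightarrow> K0 = Kc"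
  and NRS: "Rr \<le> N" "S \<le> N"
  using feas by (auto simp: feasible_def Om_def K0_def om_def)

lemma len_pos: "0 < len" by (simp add: len_def)

lemma L_eq: "L = Kc * len" by (simp add: L_def len_def)

lemma L_pos: "0 < L" using K0 len_pos by (simp add: L_eq)

lemma L_div: "L div Kc = len" using K0 by (simp add: L_eq)

lemma M_eq: "M = (Kc - K0 + 1) * len" by (simp add: M_def K0_def len_def)

lemma len_le_M: "len \<le> M" by (simp add: M_eq)

definition blk where "blk c = c div len"
definition pos where "pos c = c mod len"

text \<open>The number of rows in which chains end. Main rows from \<open>K0\<close> on continue,
  either in the main block or in an extra one; within an extra block only row 0 has no
  continuation.\<close>

definition T where "T c = (if c < len then K0 else 1)"
text \<open>The \<open>om\<close> symbols beyond the chain ends are the room for vanishing on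
  dropouts and for hiding the increment, as \<open>card D + X \<le> om\<close>.\<close>

definition R where "R c = om + T c"
definition pl where "pl i c = (if c < len then main.place i c else extra.place i (pos c))"
definition lab where "lab i c = (if c < len then l1 i c else (K0 + blk c - 1) * len + l2 i (pos c))"

lemma pos_lt: "pos c < len" using len_pos by (simp add: pos_def)

lemma blk_ge_1: "\<not> c < len \<Longrightarrow> 1 \<le> blk c" using len_pos by (simp add: blk_def div_greater_zero_iff Suc_le_eq)

lemma blk_le: "c < M \<Longrightarrow> blk c \<le> Kc - K0"
  using len_pos unfolding M_eq blk_def by (metis less_mult_imp_div_less less_Suc_eq_le Suc_eq_plus1)

lemma blk_pos: "c = blk c * len + pos c" by (simp add: blk_def pos_def)

lemma l1_low: "i < Kc \<Longrightarrow> l1 i c = i * len + c"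
  using main.l0 L_div by simp

lemma extra_lab_bounds:
  assumes "\<not> c < len" "pl i c"
  shows "(K0 + blk c - 1) * len \<le> lab i c" "lab i c < (K0 + blk c) * len"
proof -
  have "l2 i (pos c) < len" using assms by (intro extra.place_lt) (simp add: pl_def)
  moreover have "(K0 + blk c - 1) * len + len = (K0 + blk c) * len"
    using K0 by (metis Suc_eq_plus1 Suc_pred' add_mult_distrib add_gr_0 mult_1 less_le_trans zero_less_one)
  ultimately show "(K0 + blk c - 1) * len \<le> lab i c" "lab i c < (K0 + blk c) * len"
    using assms by (auto simp: lab_def)
qed

lemma main_low_lab: "c < len \<Longrightarrow> i < Kc \<Longrightarrow> lab i c < Suc i * len"
  by (simp add: lab_def l1_low)

lemma extra_lab_eq:
  assumes "\<not> c < len" "\<not> c' < len" "pl i c" "pl i' c'" "lab i c = lab i' c'"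
  shows "blk c = blk c' \<and> l2 i (pos c) = l2 i' (pos c')"
proof -
  have "blk d \<le> blk d'" if "\<not> d < len" "\<not> d' < len" "pl j d" "pl j' d'" "lab j d = lab j' d'" for d d' j j'
  proof (rule ccontr)
    assume "\<not> blk d \<le> blk d'"
    then have "(K0 + blk d') * len \<le> (K0 + blk d - 1) * len" by (intro mult_right_mono) auto
    then show False
      using extra_lab_bounds[OF that(1,3)] extra_lab_bounds[OF that(2,4)] that(5) by linarith
  qed
  from this[of c c' i i'] this[of c' c i' i] assms have "blk c = blk c'" by simp
  then show ?thesis using assms by (simp add: lab_def)
qed

lemma block_order:
  assumes "c < c'" "blk c = blk c'"
  shows "pos c < pos c'"
  using assms blk_pos[of c] blk_pos[of c'] by simp

lemma main_lab_ne_extra: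
  assumes "c < len" "i < k" "i < Kc" "\<not> c' < len" "k < K0 + blk c'" "pl i' c'"
  shows "lab i' c' \<noteq> lab i c"
proof -
  have "Suc i * len \<le> (K0 + blk c' - 1) * len" using assms by (intro mult_right_mono) auto
  then show ?thesis
    using main_low_lab[OF assms(1,3)] extra_lab_bounds[OF assms(4,6)] by linarith
qed

lemma pl_lt: "pl i c \<Longrightarrow> i < J"
  by (simp add: pl_def main.place_def extra.place_def split: if_splits)

lemma R_bounds: "T c \<le> R c" "R c \<le> Rr"
  using K0 by (auto simp: R_def T_def)

sublocale staircase_code p N M Rr L T R pl lab \<alpha>
proof
  show "prime p" by (rule p)
  show "lab i c < L" if "c < M" "pl i c" for i c
  proof (cases "c < len")
    case True
    then show ?thesis using main.place_lt that by (simp add: lab_def pl_def)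
  next
    case False
    have "(K0 + blk c) * len \<le> Kc * len" using blk_le[OF that(1)] K0 by (intro mult_right_mono) auto
    then show ?thesis using extra_lab_bounds(2)[OF False that(2)] unfolding L_eq by (rule order.strict_trans2[rotated])
  qed
  show "i = i'" if "c < M" "pl i c" "pl i' c" "lab i c = lab i' c" for i i' c
    using that main.label_inj[of i c i'] extra.label_inj[of i "pos c" i']
    by (auto simp: pl_def lab_def split: if_splits)
  \<comment> \<open>Main rows below \<open>K0\<close> do not recur further right in the main block
    by \<open>main.label_unique\<close>, nor in an extra block, whose labels start at
    \<open>K0 * len\<close>. Within an extra block row 0 is settled by
    \<open>extra.label_unique\<close>.\<close>
  show "lab i' c' \<noteq> lab i c" if "i < T c" "pl i c" "c < c'" "c' < M" "pl i' c'" for i c i' c'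
  proof (cases "c < len")
    case True
    then have i: "i < Kc" "i < K0" using that K0 by (auto simp: T_def)
    show ?thesis
    proof (cases "c' < len")
      case c': True
      then show ?thesis
        using main.label_unique[of Kc i c c' i'] that i True K0
        by (auto simp: lab_def pl_def L_div J_def)
    next
      case False
      then show ?thesis
        using main_lab_ne_extra[OF True i(2,1) False] that blk_ge_1[OF False] by simp
    qed
  next
    case False
    then have c': "\<not> c' < len" using that by simp
    show ?thesis
    proof
      assume eq: "lab i' c' = lab i c"
      then have b: "blk c' = blk c \<and> l2 i' (pos c') = l2 i (pos c)"
        using extra_lab_eq[OF c' False] that by blast
      then have "pos c < pos c'" using block_order that by simp
      moreover have "pos c = pos c'"
        using extra.label_unique[of "Suc 0" i "pos c" "pos c'" i'] that False c' b \<open>pos c < pos c'\<close> pos_lt[of c'] K0(4)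
        by (auto simp: pl_def T_def J_def)
      ultimately show False by simp
    qed
  qed
  show "T c \<le> R c" for c by (rule R_bounds)
  show "(\<forall>i<R c. p dvd u i) \<and> (\<forall>i\<ge>T c. pl i c \<longrightarrow> p dvd v i)"
    if "c < M" "T c \<le> k" "\<And>i. i < k \<Longrightarrow> pl i c" "E \<subseteq> {1..N}" "card E = R c + k - T c"
      "\<And>n. n \<in> E \<Longrightarrow> p dvd (\<Sum>i<R c. u i * \<alpha> n ^ i) + (\<Sum>i | T c \<le> i \<and> pl i c. v i * \<alpha> n ^ (Rr + i))"
      "\<And>i. k \<le> i \<Longrightarrow> pl i c \<Longrightarrow> p dvd v i - (if i < R c then u i else 0)" for c k E u v
  proof -
    let ?P = "{i. pl i c}"
    have P: "?P \<subseteq> {..<J}" using pl_lt by auto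
    then have finP: "finite ?P" by (rule finite_subset) simp
    have "k \<le> J" using pl_lt[OF that(3), of "k - 1"] by (cases k) auto
    then have "uniquely_solvable p \<alpha> E (card E) (read_basis Rr (R c) (T c) k ?P)"
      using that R_bounds P by (intro points_read) auto
    then have "(\<forall>i<R c. p dvd u i) \<and> (\<forall>i\<ge>T c. i \<in> ?P \<longrightarrow> p dvd v i)"
      using that R_bounds P finP by (intro read_basis_zero[where k = k and h = Rr and E = E]) auto
    then show ?thesis by simp
  qed
  show "\<forall>i\<in>{k..<R c}. p dvd u i"
    if "c < M" "k \<le> R c" "E \<subseteq> {1..N}" "card E = R c - k"
      "\<And>n. n \<in> E \<Longrightarrow> p dvd (\<Sum>i=k..<R c. u i * \<alpha> n ^ i)" for c k E u
    using that R_bounds(2)[of c] by (intro monom_zero[OF points_write]) auto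
qed

text \<open>The columns used by reads and updates when \<open>k\<close> is the effective number of servers and
  \<open>k'\<close> that of unconstrained ones.\<close>

definition prof :: "nat \<Rightarrow> nat \<Rightarrow> nat set" where
  "prof k k' = (if Kc \<le> k then {..<L div k}
     else {c. c < M \<and> (len \<le> c \<longrightarrow> k < K0 + blk c \<and> pos c < len div k')})"

text \<open>How many rows of column \<open>c\<close> are used; over the columns of
  \<open>prof\<close> these places carry each label once.\<close>

definition rows :: "nat \<Rightarrow> nat \<Rightarrow> nat \<Rightarrow> nat" where
  "rows k k' c = (if c < len then k else k')"

definition valid :: "nat \<Rightarrow> nat \<Rightarrow> bool" where
  "valid k k' \<longleftrightarrow> K0 \<le> k \<and> k \<le> J \<and> (k < Kc \<longrightarrow> 1 \<le> k' \<and> k' \<le> J)"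

context
  fixes k k' :: nat
  assumes valid: "valid k k'"
begin

lemma L_div_le: "Kc \<le> k \<Longrightarrow> L div k \<le> len"
  using K0 div_le_mono2[of Kc k L] by (simp add: L_div)

lemma prof_main: "c < len \<Longrightarrow> c \<in> prof k k' \<longleftrightarrow> (Kc \<le> k \<longrightarrow> c < L div k)"
  using len_le_M by (auto simp: prof_def)

lemma prof_main': "c < len \<Longrightarrow> c \<in> prof k k' \<longleftrightarrow> c < L div (max k Kc)"
  using L_div prof_main[of c] by (cases "Kc \<le> k") (auto simp: max_def)

lemma prof_extra: "\<not> c < len \<Longrightarrow> c \<in> prof k k' \<longleftrightarrow> c < M \<and> k < Kc \<and> k < K0 + blk c \<and> pos c < len div k'"
  using L_div_le by (auto simp: prof_def)

lemma prof_M: "c \<in> prof k k' \<Longrightarrow> c < M"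
  using L_div_le len_le_M by (auto simp: prof_def split: if_splits)

lemma max_Kc: "Kc \<le> max k Kc" "max k Kc \<le> J"
  using valid by (auto simp: valid_def J_def)

text \<open>Backwards, a chain leaves an extra column for a smaller position in the same block or
  for the main block, which is included entirely as soon as any extra column is.\<close>

lemma closed_prof: "closed_cols (prof k k')"
  unfolding closed_cols_def
proof (intro conjI ballI allI impI)
  show "prof k k' \<subseteq> {..<M}" using prof_M by auto
  fix c c' i assume c: "c \<in> prof k k'" and c': "c' < c" and "pl i c \<and> same_label i c c'"
  then obtain i' where i': "pl i c" "pl i' c'" "lab i' c' = lab i c" by (auto simp: same_label_def)
  show "c' \<in> prof k k'"
  proof (cases "c < len")
    case True
    then show ?thesis using c c' prof_main'[of c] prof_main'[of c'] by simp
  next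
    case False
    note cp = c[unfolded prof_extra[OF False]]
    show ?thesis
    proof (cases "c' < len")
      case True
      then show ?thesis using cp prof_main by simp
    next
      case c'_extra: False
      then have "blk c' = blk c" using extra_lab_eq[OF c'_extra False i'(2,1,3)] by simp
      then show ?thesis
        using cp c' block_order[OF c'] unfolding prof_extra[OF c'_extra] by auto
    qed
  qed
qed

lemma T_le_rows: "c \<in> prof k k' \<Longrightarrow> T c \<le> rows k k' c"
  using valid prof_extra by (auto simp: T_def rows_def valid_def)

lemma rows_pl:
  assumes "c \<in> prof k k'" "i < rows k k' c"
  shows "pl i c"
proof (cases "c < len")
  case True
  then show ?thesis
    using assms max_Kc prof_main'[OF True]
    by (auto simp: pl_def rows_def intro!: main.place_block[of "max k Kc"])
next
  case False
  then show ?thesis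
    using assms valid prof_extra[OF False]
    by (auto simp: pl_def rows_def valid_def intro!: extra.place_block[of k'])
qed

lemma prof_succ:
  assumes c: "c \<in> prof k k'" and i: "rows k k' c \<le> i" and pl: "pl i c"
  shows "\<exists>c'\<in>prof k k'. c < c' \<and> same_label i c c'"
proof (cases "c < len")
  case True
  then have pm: "main.place i c" using pl by (simp add: pl_def)
  show ?thesis
  proof (cases "max k Kc \<le> i")
    case le: True
    obtain c' i' where c': "c < c'" "c' < L div (max k Kc)" "main.place i' c'" "l1 i' c' = l1 i c"
      using main.label_succ[OF max_Kc(1) le _ pm] c prof_main'[OF True] by blast
    have "c' < len"
      using c'(2) L_div div_le_mono2[of Kc "max k Kc" L] K0 by simp
    then show ?thesis
      using c' True prof_main'[of c'] by (intro bexI[of _ c']) (auto simp: same_label_def pl_def lab_def)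
  next
    case False
    then have i': "k \<le> i" "k < Kc" "i < Kc" using i True by (auto simp: rows_def)
    obtain d j where d: "d < len div k'" "j < k'" "extra.place j d" "l2 j d = c"
      using extra.label_hit[of k' c] valid i' True by (auto simp: valid_def)
    have dl: "d < len" using d(1) by (meson div_le_dividend less_le_trans)
    \<comment> \<open>The block that continues main row \<open>i\<close>. Its first
      \<open>len div k'\<close> columns already contain every label of that row.\<close>
    define b where "b = Suc i - K0"
    have b: "1 \<le> b" "b \<le> Kc - K0" "K0 + b = Suc i" using i' valid by (auto simp: b_def valid_def)
    define c' where "c' = b * len + d"
    have bc: "blk c' = b" "pos c' = d" using dl len_pos by (simp_all add: c'_def blk_def pos_def)
    have nc: "\<not> c' < len" using b len_pos by (auto simp: c'_def not_less intro: order_trans[of len "b * len"])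
    have "c' < (b + 1) * len" using dl by (simp add: c'_def)
    also have "\<dots> \<le> M" unfolding M_eq using b by (intro mult_right_mono) auto
    finally have "c' \<in> prof k k'" using nc b bc d i' by (simp add: prof_extra)
    moreover have "lab j c' = lab i c"
      using nc True b bc d l1_low[OF i'(3)] by (simp add: lab_def)
    ultimately show ?thesis
      using nc True bc d by (intro bexI[of _ c']) (auto simp: same_label_def pl_def)
  qed
next
  case False
  note cp = c[unfolded prof_extra[OF False]]
  have pe: "extra.place i (pos c)" using pl False by (simp add: pl_def)
  have k': "Suc 0 \<le> k'" using valid cp by (simp add: valid_def)
  obtain d i' where d: "pos c < d" "d < len div k'" "extra.place i' d" "l2 i' d = l2 i (pos c)"
    using extra.label_succ[OF k' _ _ pe] cp i False by (auto simp: rows_def)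
  have dl: "d < len" using d(2) by (meson div_le_dividend less_le_trans)
  define c' where "c' = blk c * len + d"
  have bc: "blk c' = blk c" "pos c' = d" using dl len_pos by (simp_all add: c'_def blk_def pos_def)
  have cc': "c < c'" using d(1) blk_pos[of c] by (simp add: c'_def)
  have nc: "\<not> c' < len" using cc' False by simp
  have "c' < (blk c + 1) * len" using dl by (simp add: c'_def)
  also have "\<dots> \<le> M" unfolding M_eq using blk_le[of c] cp by (intro mult_right_mono) auto
  finally have "c' \<in> prof k k'" using nc bc d cp by (simp add: prof_extra)
  moreover have "lab i' c' = lab i c" using nc False bc d by (simp add: lab_def)
  ultimately show ?thesis
    using nc bc d cc' by (intro bexI[of _ c']) (auto simp: same_label_def pl_def)
qed

lemma prof_last:
  assumes c: "c \<in> prof k k'" "c' \<in> prof k k'" "c < c'" and i: "i < rows k k' c"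
  shows "\<not> same_label i c c'"
proof
  assume "same_label i c c'"
  then obtain i' where i': "pl i' c'" "lab i' c' = lab i c" by (auto simp: same_label_def)
  show False
  proof (cases "c < len")
    case True
    then have ik: "i < k" using i by (simp add: rows_def)
    show False
    proof (cases "c' < len")
      case c': True
      then have "i' = i \<and> c' = c"
        using main.label_unique[OF max_Kc, of i c c' i'] c ik i' True prof_main'[OF c']
        by (auto simp: pl_def lab_def less_max_iff_disj)
      then show False using c by simp
    next
      case False
      note cp = c(2)[unfolded prof_extra[OF False]]
      then show False
        using main_lab_ne_extra[OF True ik _ False _ i'(1)] ik i'(2) by simp
    qed
  next
    case False
    then have c': "\<not> c' < len" using c by simp
    note cp = c(1)[unfolded prof_extra[OF False]] c(2)[unfolded prof_extra[OF c']]
    have b: "blk c' = blk c \<and> l2 i' (pos c') = l2 i (pos c)"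
      using extra_lab_eq[OF c' False i'(1) rows_pl[OF c(1) i] i'(2)] .
    then have lt: "pos c < pos c'" using block_order c by simp
    have "i' = i \<and> pos c' = pos c"
      using extra.label_unique[of k' i "pos c" "pos c'" i'] i i'(1) b lt cp c' False valid
      by (auto simp: pl_def rows_def valid_def)
    then show False using lt by simp
  qed
qed

lemma prof_hit:
  assumes "w < L"
  shows "\<exists>c\<in>prof k k'. \<exists>i. pl i c \<and> lab i c = w"
proof -
  obtain c i where c: "c < L div (max k Kc)" "main.place i c" "l1 i c = w"
    using main.label_hit[OF max_Kc assms] by blast
  have "c < len" using c(1) L_div div_le_mono2[of Kc "max k Kc" L] K0 by simp
  then show ?thesis using c prof_main' by (intro bexI[of _ c]) (auto simp: pl_def lab_def)
qed

lemma card_block: "b \<le> Kc - K0 \<Longrightarrow> d \<le> len \<Longrightarrow> card {c. blk c = b \<and> pos c < d} = d"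
proof -
  assume d: "d \<le> len"
  have "bij_betw (\<lambda>x. b * len + x) {..<d} {c. blk c = b \<and> pos c < d}"
  proof (rule bij_betw_byWitness[where f' = pos])
    show "(\<lambda>x. b * len + x) ` {..<d} \<subseteq> {c. blk c = b \<and> pos c < d}"
      using d len_pos by (auto simp: blk_def pos_def)
    show "pos ` {c. blk c = b \<and> pos c < d} \<subseteq> {..<d}" by auto
    show "\<forall>a\<in>{..<d}. pos (b * len + a) = a" using d by (auto simp: pos_def)
    show "\<forall>a'\<in>{c. blk c = b \<and> pos c < d}. b * len + pos a' = a'"
      using blk_pos by (metis (mono_tags, lifting) mem_Collect_eq)
  qed
  from bij_betw_same_card[OF this] show ?thesis by simp
qed

lemma prof_small:
  assumes "k < Kc"
  shows "prof k k' = {..<len} \<union> (\<Union>b\<in>{Suc k - K0..Kc - K0}. {c. blk c = b \<and> pos c < len div k'})"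
proof (intro equalityI subsetI)
  fix c assume c: "c \<in> prof k k'"
  show "c \<in> {..<len} \<union> (\<Union>b\<in>{Suc k - K0..Kc - K0}. {c. blk c = b \<and> pos c < len div k'})"
  proof (cases "c < len")
    case False
    then show ?thesis using c blk_le[of c] by (auto simp: prof_extra)
  qed simp
next
  fix c assume "c \<in> {..<len} \<union> (\<Union>b\<in>{Suc k - K0..Kc - K0}. {c. blk c = b \<and> pos c < len div k'})"
  then consider "c < len" | "Suc k - K0 \<le> blk c" "blk c \<le> Kc - K0" "pos c < len div k'" by auto
  then show "c \<in> prof k k'"
  proof cases
    case 1
    then show ?thesis using assms prof_main by simp
  next
    case 2
    then have "1 \<le> blk c" using valid by (auto simp: valid_def)
    then have nc: "\<not> c < len" by (auto simp: blk_def)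
    have "c < (blk c + 1) * len" using blk_pos[of c] pos_lt[of c] by simp
    also have "\<dots> \<le> M" unfolding M_eq using 2 by (intro mult_right_mono) auto
    finally show ?thesis using 2 nc assms valid by (auto simp: prof_extra valid_def)
  qed
qed

lemma disjoint_blocks:
  fixes f :: "nat \<Rightarrow> nat"
  assumes "k < Kc"
  shows "sum f (prof k k') = sum f {..<len} +
    (\<Sum>b\<in>{Suc k - K0..Kc - K0}. sum f {c. blk c = b \<and> pos c < len div k'})"
proof -
  have fin: "finite {c. blk c = b \<and> pos c < len div k'}" for b
    by (rule finite_subset[of _ "{..<(b + 1) * len}"])
      (use blk_pos pos_lt in \<open>auto, metis add.commute add_less_cancel_left\<close>)
  have "1 \<le> Suc k - K0" using valid by (auto simp: valid_def)
  then have disj: "{..<len} \<inter> (\<Union>b\<in>{Suc k - K0..Kc - K0}. {c. blk c = b \<and> pos c < len div k'}) = {}"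
    by (auto simp: blk_def)
  show ?thesis
    unfolding prof_small[OF assms]
    by (subst sum.union_disjoint[OF _ _ disj], use fin in \<open>auto intro!: sum.UNION_disjoint\<close>)
qed

lemma dvd_k: "Kc \<le> k \<Longrightarrow> k * (L div k) = L"
  using main.J_dvd[of k] valid K0 by (simp add: valid_def)

lemma dvd_k': "k < Kc \<Longrightarrow> k' * (len div k') = len"
  using extra.J_dvd[of k'] valid by (simp add: valid_def)

text \<open>For \<open>k < Kc\<close> the main block contributes \<open>k * len\<close> and each of
  the \<open>Kc - k\<close> extra blocks \<open>k' * (len div k') = len\<close>, which adds up to
  \<open>Kc * len\<close>.\<close>

lemma sum_rows: "(\<Sum>c\<in>prof k k'. rows k k' c) = L"
proof (cases "Kc \<le> k")
  case True
  then have "(\<Sum>c\<in>prof k k'. rows k k' c) = (\<Sum>c<L div k. k)"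
    using L_div_le by (intro sum.cong) (auto simp: prof_def rows_def)
  then show ?thesis using dvd_k[OF True] by (simp add: mult.commute)
next
  case False
  have "(\<Sum>c\<in>{c. blk c = b \<and> pos c < len div k'}. rows k k' c) = len"
    if b: "b \<in> {Suc k - K0..Kc - K0}" for b
  proof -
    have "1 \<le> b" using b valid by (auto simp: valid_def)
    then have "(\<Sum>c\<in>{c. blk c = b \<and> pos c < len div k'}. rows k k' c) =
        (\<Sum>c\<in>{c. blk c = b \<and> pos c < len div k'}. k')"
      by (intro sum.cong) (auto simp: rows_def blk_def)
    also have "\<dots> = len"
      using card_block[of b "len div k'"] b dvd_k' False by (simp add: mult.commute)
    finally show ?thesis .
  qed
  moreover have "(\<Sum>c<len. rows k k' c) = len * k" by (simp add: rows_def)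
  ultimately have "(\<Sum>c\<in>prof k k'. rows k k' c) = len * k + (Suc (Kc - K0) - (Suc k - K0)) * len"
    using False by (simp add: disjoint_blocks)
  also have "Suc (Kc - K0) - (Suc k - K0) = Kc - k" using False valid K0 by (auto simp: valid_def)
  also have "len * k + (Kc - k) * len = (k + (Kc - k)) * len"
    by (simp only: add_mult_distrib mult.commute[of len k])
  also have "\<dots> = L" using False by (simp add: L_eq)
  finally show ?thesis .
qed

text \<open>This is \<open>L\<close> times the optimal share of an unconstrained server.\<close>

lemma card_prof:
  assumes "k < Kc"
  shows "card (prof k k') = len + (Kc - k) * (len div k')"
proof -
  have "card (prof k k') = (\<Sum>c\<in>prof k k'. 1)" by simp
  also have "\<dots> = len + (\<Sum>b\<in>{Suc k - K0..Kc - K0}. card {c. blk c = b \<and> pos c < len div k'})"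
    using assms by (subst disjoint_blocks) auto
  also have "(\<Sum>b\<in>{Suc k - K0..Kc - K0}. card {c. blk c = b \<and> pos c < len div k'}) =
      (\<Sum>b\<in>{Suc k - K0..Kc - K0}. len div k')"
    by (intro sum.cong card_block) auto
  also have "\<dots> = (Suc (Kc - K0) - (Suc k - K0)) * (len div k')" by simp
  also have "Suc (Kc - K0) - (Suc k - K0) = Kc - k" using assms valid K0 by (auto simp: valid_def)
  finally show ?thesis .
qed

end

end


section \<open>The scheme over the field with \<open>p\<close> elements and its stationary
  law\<close>

context rdcds_code
begin

abbreviation Fp :: "int ring" where "Fp \<equiv> residue_ring p"

lemma p_gt_1: "1 < p" using p prime_gt_1_int by blast

lemma field_Fp: "field Fp"
proof -
  interpret residues_prime "nat p" "residue_ring (int (nat p))"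
    using p by unfold_locales auto
  show ?thesis using is_field p_gt_1 by simp
qed

lemma carrier_Fp: "carrier Fp = {0..<p}" by (auto simp: residue_ring_def)

lemma finite_Fp: "finite (carrier Fp)" by (simp add: carrier_Fp)

lemma qq_Fp: "qq Fp = real_of_int p" using p_gt_1 by (simp add: carrier_Fp)

lemma qq_Fp_gt_1: "1 < qq Fp" unfolding qq_Fp using p_gt_1 by simp

lemma add_msg_Fp: "add_msg Fp w d = map2 (\<lambda>x y. (x + y) mod p) w d"
  by (simp add: add_msg_def residue_ring_def)

definition ncols :: "nat \<Rightarrow> nat" where "ncols n = (if n \<le> S then len else M)"

text \<open>The default \<open>[]\<close> outside \<open>{1..N}\<close> lets old and new storages
  agree as functions on all of \<open>nat\<close>, as the exact equality of laws in
  \<open>update_step_law\<close> requires.\<close>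

definition slist :: "(nat \<times> nat \<Rightarrow> int) \<Rightarrow> nat \<Rightarrow> int list" where
  "slist st n = (if n \<in> {1..N} then map (\<lambda>c. enc st n c mod p) [0..<ncols n] else [])"

definition wlist :: "(nat \<times> nat \<Rightarrow> int) \<Rightarrow> int list" where
  "wlist st = map (\<lambda>w. msg st w mod p) [0..<L]"

definition PR :: "nat set \<Rightarrow> nat \<Rightarrow> nat set" where
  "PR D k = prof k (k - card ({1..S} - D))"

definition codewords :: "nat set \<Rightarrow> nat \<Rightarrow> (nat \<times> nat \<Rightarrow> int) set" where
  "codewords D X = {st \<in> states_on (PR D (Rr - card D - X)). \<forall>n\<in>D. \<forall>c<ncols n. p dvd enc st n c}"

definition fiber :: "nat set \<Rightarrow> nat \<Rightarrow> int list \<Rightarrow> (nat \<times> nat \<Rightarrow> int) set" where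
  "fiber D X d = {st \<in> codewords D X. wlist st = d}"

text \<open>Answers and uploads keep full length with zeros outside the profile, which adds nothing
  to their entropy. The constant upload merely makes the map total: admissible updates stay in the
  first branch.\<close>

definition the_scheme :: "(int, int list, int list, int list) scheme" where
  "the_scheme = \<lparr>
     init_law = map_pmf (\<lambda>st. (wlist st, slist st)) (pmf_of_set states),
     answer = (\<lambda>D n s. map (\<lambda>c. if c \<in> PR D (N - card D - om) then s ! c else 0) [0..<ncols n]),
     upload = (\<lambda>D X d. if D \<subseteq> {1..N} \<and> card D + X \<le> om \<and> d \<in> messages Fp L
       then map_pmf slist (pmf_of_set (fiber D X d)) else return_pmf (\<lambda>_. [])),
     transition = (\<lambda>D X n s u. map2 (\<lambda>x y. (x + y) mod p) s u)\<rparr>"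

definition law :: "(int list \<times> (nat \<Rightarrow> int list)) pmf" where
  "law = map_pmf (\<lambda>st. (wlist st, slist st)) (pmf_of_set states)"

lemma ncols_le: "ncols n \<le> M" using len_le_M by (simp add: ncols_def)

lemma length_slist: "n \<in> {1..N} \<Longrightarrow> length (slist st n) = ncols n"
  by (simp add: slist_def)

lemma slist_out: "n \<notin> {1..N} \<Longrightarrow> slist st n = []"
  unfolding slist_def by (rule if_not_P)

lemma slist_range: "set (slist st n) \<subseteq> {0..<p}"
  using p_pos by (auto simp: slist_def)

lemma slist_eq_iff: "n \<in> {1..N} \<Longrightarrow> slist a n = slist b n \<longleftrightarrow> (\<forall>c<ncols n. p dvd enc a n c - enc b n c)"
  by (auto simp: slist_def mod_eq_dvd_iff)

lemma wlist_eq_iff: "wlist a = wlist b \<longleftrightarrow> (\<forall>w<L. p dvd msg a w - msg b w)"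
  by (auto simp: wlist_def mod_eq_dvd_iff)

lemma wlist_messages: "wlist st \<in> messages Fp L"
  using p_pos by (auto simp: wlist_def messages_def carrier_Fp)

lemma states_nonempty: "states \<noteq> {}"
  unfolding states_def using p_pos by (auto simp: PiE_eq_empty_iff)

definition padd :: "(nat \<times> nat \<Rightarrow> int) \<Rightarrow> (nat \<times> nat \<Rightarrow> int) \<Rightarrow> nat \<times> nat \<Rightarrow> int" where
  "padd a b = restrict (\<lambda>x. (a x + b x) mod p) idx"

lemma padd_states: "padd a b \<in> states"
  using p_pos by (auto simp: padd_def states_def)

lemma padd_dvd: "c < M \<Longrightarrow> i < R c \<Longrightarrow> p dvd padd a b (i, c) - (a (i, c) + b (i, c))"
  by (simp add: padd_def mem_idx mod_eq_dvd_iff[symmetric])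

lemma enc_padd:
  assumes "c < M"
  shows "p dvd enc (padd a b) n c - (enc a n c + enc b n c)"
proof -
  have "p dvd enc (\<lambda>x. padd a b x - (a x + b x)) n c"
    using assms padd_dvd by (intro dvd_enc)
  then show ?thesis by (simp only: enc_diff enc_add)
qed

lemma msg_padd: "p dvd msg (padd a b) w - (msg a w + msg b w)"
proof -
  have "p dvd msg (\<lambda>x. padd a b x - (a x + b x)) w"
    using padd_dvd by (intro dvd_msg)
  then show ?thesis by (simp only: msg_diff msg_add)
qed

lemma wlist_padd: "wlist (padd a b) = add_msg Fp (wlist a) (wlist b)"
  using msg_padd by (auto simp: wlist_def add_msg_Fp mod_eq_dvd_iff mod_add_eq intro!: nth_equalityI)

lemma slist_padd: "slist (padd a b) n = map2 (\<lambda>x y. (x + y) mod p) (slist a n) (slist b n)"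
proof (cases "n \<in> {1..N}")
  case True
  have "enc (padd a b) n c mod p = (enc a n c mod p + enc b n c mod p) mod p" if "c < ncols n" for c
    using enc_padd[of c a b n] that ncols_le[of n] by (simp add: mod_eq_dvd_iff mod_add_eq)
  then show ?thesis using True by (auto simp: slist_def intro!: nth_equalityI)
next
  case False
  then show ?thesis by (simp add: slist_out[OF False])
qed

lemma slist_padd_zero:
  assumes "\<And>c. c < ncols n \<Longrightarrow> p dvd enc b n c"
  shows "slist (padd a b) n = slist a n"
proof (cases "n \<in> {1..N}")
  case True
  have "p dvd enc (padd a b) n c - enc a n c" if "c < ncols n" for c
  proof -
    have "p dvd (enc (padd a b) n c - (enc a n c + enc b n c)) + enc b n c"
      using enc_padd[of c a b n] ncols_le[of n] assms[OF that] that by (intro dvd_add) auto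
    then show ?thesis by simp
  qed
  then show ?thesis using True by (simp add: slist_eq_iff)
next
  case False
  then show ?thesis by (simp add: slist_out[OF False])
qed

lemma padd_inj: "inj_on (\<lambda>a. padd a b) states"
proof (rule inj_onI)
  fix a a' assume a: "a \<in> states" "a' \<in> states" and eq: "padd a b = padd a' b"
  show "a = a'"
  proof (rule PiE_ext[OF a[unfolded states_def]])
    fix x assume x: "x \<in> idx"
    have "(a x + b x) mod p = (a' x + b x) mod p"
      using fun_cong[OF eq, of x] x by (simp add: padd_def)
    then have "p dvd a x - a' x" by (simp add: mod_eq_dvd_iff)
    then have "a x mod p = a' x mod p" by (simp add: mod_eq_dvd_iff)
    then show "a x = a' x" using a x by (auto simp: states_def PiE_iff)
  qed
qed

lemma map_padd_uniform: "map_pmf (\<lambda>a. padd a b) (pmf_of_set states) = pmf_of_set states"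
proof (rule map_pmf_of_set_bij_betw)
  show "bij_betw (\<lambda>a. padd a b) states states"
    unfolding bij_betw_def using endo_inj_surj[OF finite_states _ padd_inj] padd_inj padd_states by blast
qed (use states_nonempty finite_states in auto)


subsection \<open>Reading\<close>

lemma card_avail:
  assumes "D \<subseteq> {1..N}"
  shows "card ({1..N} - D) = N - card D" "card D \<le> N"
    "card ({Suc S..N} - D) + card ({1..S} - D) = N - card D"
proof -
  have fin: "finite D" using assms finite_subset by blast
  then show c: "card ({1..N} - D) = N - card D" using assms by (simp add: card_Diff_subset)
  show "card D \<le> N" using card_mono[OF _ assms] by simp
  have "{1..N} - D = ({Suc S..N} - D) \<union> ({1..S} - D)" using NRS by auto
  moreover have "({Suc S..N} - D) \<inter> ({1..S} - D) = {}" by auto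
  ultimately show "card ({Suc S..N} - D) + card ({1..S} - D) = N - card D"
    using c card_Un_disjoint[of "{Suc S..N} - D" "{1..S} - D"] by simp
qed

lemma valid_eff:
  assumes "K0 \<le> k" "k \<le> J"
  shows "valid k (k - card ({1..S} - D))" "k < Kc \<Longrightarrow> card ({1..S} - D) < k"
proof -
  have "card ({1..S} - D) \<le> card {1..S}" by (intro card_mono) auto
  then have "card ({1..S} - D) < k" if "k < Kc" using K0 assms that by (cases "S < Kc") auto
  then show "k < Kc \<Longrightarrow> card ({1..S} - D) < k" "valid k (k - card ({1..S} - D))"
    using assms by (auto simp: valid_def)
qed

text \<open>By linearity the difference of the two states is decoded. Main columns are seen by
  \<open>om + k\<close> available servers and extra ones by \<open>om + k'\<close> unconstrained
  ones, which are the numbers of unknowns in such columns.\<close>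

lemma read_determines:
  assumes D: "D \<subseteq> {1..N}" "card D \<le> N - Rr"
    and eq: "\<And>n. n \<in> {1..N} - D \<Longrightarrow>
      answer the_scheme D n (slist a n) = answer the_scheme D n (slist b n)"
  shows "wlist a = wlist b"
proof -
  let ?k = "N - card D - om" and ?c = "card ({1..S} - D)"
  let ?st = "\<lambda>x. a x - b x"
  have k: "K0 \<le> ?k" "?k \<le> J" using D K0 NRS by (auto simp: J_def)
  note v = valid_eff[OF k, of D]
  let ?E = "\<lambda>c. if c < len then {1..N} - D else {Suc S..N} - D"
  have "p dvd msg ?st w" if w: "w < L" for w
  proof (rule read_msg[OF closed_prof[OF v(1)], where k = "rows ?k (?k - ?c)" and E = ?E])
    fix c assume c: "c \<in> prof ?k (?k - ?c)"
    show "T c \<le> rows ?k (?k - ?c) c" by (rule T_le_rows[OF v(1) c])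
    show "?E c \<subseteq> {1..N}" by auto
    show "card (?E c) = R c + rows ?k (?k - ?c) c - T c"
    proof (cases "c < len")
      case True
      then show ?thesis using card_avail(1)[OF D(1)] k K0 NRS D by (auto simp: R_def rows_def)
    next
      case False
      then have "?c < ?k" using c prof_extra[OF v(1) False] v(2) by simp
      then show ?thesis using card_avail(3)[OF D(1)] False by (auto simp: R_def rows_def)
    qed
    fix n assume n: "n \<in> ?E c"
    then have n1: "n \<in> {1..N} - D" using NRS by (auto split: if_splits)
    have cn: "c < ncols n" using n prof_M[OF v(1) c] by (auto simp: ncols_def split: if_splits)
    have "slist a n ! c = slist b n ! c"
      using arg_cong[OF eq[OF n1], of "\<lambda>l. l ! c"] c cn by (simp add: the_scheme_def PR_def)
    then show "p dvd enc ?st n c"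
      using n1 cn by (simp add: slist_def enc_diff mod_eq_dvd_iff)
  next
    fix c i assume "c \<in> prof ?k (?k - ?c)" "i < rows ?k (?k - ?c) c"
    then show "pl i c" by (rule rows_pl[OF v(1)])
  next
    fix c i assume "c \<in> prof ?k (?k - ?c)" "rows ?k (?k - ?c) c \<le> i" "pl i c"
    then show "\<exists>c'\<in>prof ?k (?k - ?c). c < c' \<and> same_label i c c'" by (rule prof_succ[OF v(1)])
  next
    show "\<exists>c\<in>prof ?k (?k - ?c). \<exists>i. pl i c \<and> lab i c = w" by (rule prof_hit[OF v(1) w])
  qed
  then show ?thesis unfolding wlist_eq_iff by (simp add: msg_diff)
qed


subsection \<open>Updating\<close>

lemma obtain_superset_card:
  fixes A B :: "nat set"
  assumes "A \<subseteq> B" "finite B" "card A \<le> m" "m \<le> card B"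
  obtains Z where "A \<subseteq> Z" "Z \<subseteq> B" "card Z = m"
proof -
  have finA: "finite A" using assms finite_subset by blast
  have "m - card A \<le> card (B - A)" using assms finA by (simp add: card_Diff_subset)
  then obtain V where V: "V \<subseteq> B - A" "card V = m - card A" "finite V"
    by (rule obtain_subset_with_card_n)
  have "card (A \<union> V) = m" using V finA assms by (subst card_Un_disjoint) auto
  then show ?thesis using that[of "A \<union> V"] V assms by blast
qed

text \<open>Zeros are prescribed on \<open>D \<union> Y\<close> in the main columns. Extra columns
  exist only on unconstrained servers; there \<open>Z\<close> enlarges the relevant part of
  \<open>D \<union> Y\<close> until the system is square.\<close>

lemma codeword_exists:
  assumes D: "D \<subseteq> {1..N}" and Y: "Y \<subseteq> {1..N} - D" and DY: "card D + card Y \<le> om"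
    and d: "d \<in> messages Fp L"
  shows "\<exists>e\<in>fiber D (card Y) d. \<forall>n\<in>Y. \<forall>c<ncols n. p dvd enc e n c"
proof -
  let ?k = "Rr - card D - card Y" and ?c = "card ({1..S} - D)"
  have k: "K0 \<le> ?k" "?k \<le> J" using DY K0 NRS by (auto simp: J_def)
  note v = valid_eff[OF k, of D]
  have fin: "finite D" "finite Y" using D Y finite_subset by blast+
  have cDY: "card (D \<union> Y) = card D + card Y" using fin Y by (intro card_Un_disjoint) auto
  have k'_le: "?k - ?c \<le> om + 1 \<and> (\<exists>Z. (D \<union> Y) \<inter> {Suc S..N} \<subseteq> Z \<and> Z \<subseteq> {Suc S..N} \<and> card Z = om + 1 - (?k - ?c))"
    if "?k < Kc"
  proof -
    have K0S: "K0 = S + 1" using that k K0 by (cases "S < Kc") auto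
    have "card ({Suc S..N} - D) = N - S - card (D \<inter> {Suc S..N})"
      using fin by (simp add: card_Diff_subset_Int Int_commute)
    moreover have "card (D \<inter> {Suc S..N}) \<le> card {Suc S..N}" by (intro card_mono) auto
    ultimately have 1: "card ({Suc S..N} - D) + card (D \<inter> {Suc S..N}) = N - S" by simp
    have 2: "card ({Suc S..N} - D) + ?c = N - card D" "card D \<le> N" using card_avail[OF D] by auto
    have "card ((D \<union> Y) \<inter> {Suc S..N}) \<le> card ((D \<inter> {Suc S..N}) \<union> Y)" using fin by (intro card_mono) auto
    also have "\<dots> \<le> card (D \<inter> {Suc S..N}) + card Y" by (rule card_Un_le)
    finally have 3: "card ((D \<union> Y) \<inter> {Suc S..N}) \<le> card (D \<inter> {Suc S..N}) + card Y" .
    have "?c + card D = S + card (D \<inter> {Suc S..N})" using 1 2 NRS(2) by linarith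
    moreover have "?k + card D + card Y = om + (S + 1)" using DY K0(3) K0S by simp
    \<comment> \<open>The constrained dropouts cancel. Members of \<open>Y\<close> that are
      constrained count here although they hold no extra columns, so \<open>Z\<close> may have to be
      a proper superset.\<close>
    ultimately have "(?k - ?c) + card (D \<inter> {Suc S..N}) + card Y = om + 1"
      using v(2)[OF that] by linarith
    then have 4: "om + 1 - (?k - ?c) = card (D \<inter> {Suc S..N}) + card Y" "?k - ?c \<le> om + 1"
      "1 \<le> ?k - ?c" using v(2)[OF that] by linarith+
    have "om + 1 - (?k - ?c) \<le> om" using 4(3) by linarith
    also have "om \<le> N - S" using K0(3) K0S NRS by linarith
    finally have "om + 1 - (?k - ?c) \<le> card {Suc S..N}" by simp
    moreover have "card ((D \<union> Y) \<inter> {Suc S..N}) \<le> om + 1 - (?k - ?c)" using 3 4(1) by linarith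
    ultimately obtain Z where "(D \<union> Y) \<inter> {Suc S..N} \<subseteq> Z" "Z \<subseteq> {Suc S..N}" "card Z = om + 1 - (?k - ?c)"
      using obtain_superset_card[OF Int_lower2 finite_atLeastAtMost] by metis
    then show ?thesis using 4 by blast
  qed
  obtain Z where Z: "?k < Kc \<Longrightarrow> (D \<union> Y) \<inter> {Suc S..N} \<subseteq> Z" "?k < Kc \<Longrightarrow> Z \<subseteq> {Suc S..N}"
      "?k < Kc \<Longrightarrow> card Z = om + 1 - (?k - ?c)"
    using k'_le by (cases "?k < Kc") auto
  let ?P = "prof ?k (?k - ?c)" and ?E = "\<lambda>c. if c < len then D \<union> Y else Z"
  have "\<exists>st\<in>states_on ?P. (\<forall>c\<in>?P. \<forall>n\<in>?E c. p dvd enc st n c) \<and> (\<forall>w<L. msg st w mod p = d ! w)"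
  proof (rule write_exists[where k = "rows ?k (?k - ?c)"])
    show "?P \<subseteq> {..<M}" using prof_M[OF v(1)] by auto
    show "(\<Sum>c\<in>?P. rows ?k (?k - ?c) c) = L" by (rule sum_rows[OF v(1)])
    show "d ! w \<in> {0..<p}" if "w < L" for w
    proof -
      have "d ! w \<in> set d" using d that by (simp add: messages_def)
      then show ?thesis using d by (auto simp: messages_def carrier_Fp)
    qed
    fix c assume c: "c \<in> ?P"
    have small: "?k < Kc" if "\<not> c < len" using c that prof_extra[OF v(1)] by blast
    show "rows ?k (?k - ?c) c \<le> R c"
      using k'_le small K0 by (auto simp: rows_def R_def T_def)
    show "?E c \<subseteq> {1..N}"
    proof (cases "c < len")
      case False
      then have "Z \<subseteq> {Suc S..N}" using Z(2) small by blast
      then show ?thesis using False by fastforce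
    qed (use D Y in auto)
    show "card (?E c) = R c - rows ?k (?k - ?c) c"
      using cDY Z(3) small K0 DY by (auto simp: rows_def R_def T_def)
  next
    fix c i assume "c \<in> ?P" "i < rows ?k (?k - ?c) c"
    then show "pl i c" by (rule rows_pl[OF v(1)])
  next
    fix c c' i assume "c \<in> ?P" "c' \<in> ?P" "c < c'" "i < rows ?k (?k - ?c) c"
    then show "\<not> same_label i c c'" by (rule prof_last[OF v(1)])
  qed
  then obtain st where st: "st \<in> states_on ?P" and enc0: "\<And>c n. c \<in> ?P \<Longrightarrow> n \<in> ?E c \<Longrightarrow> p dvd enc st n c"
    and msg: "\<And>w. w < L \<Longrightarrow> msg st w mod p = d ! w" by blast
  have zero: "p dvd enc st n c" if "n \<in> D \<union> Y" "c < ncols n" for n c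
  proof (cases "c \<in> ?P")
    case True
    have "n \<in> {1..N}" using that D Y by auto
    have "n \<in> ?E c"
    proof (cases "c < len")
      case False
      then have "?k < Kc" "\<not> n \<le> S"
        using prof_extra[OF v(1) False] True that(2) by (auto simp: ncols_def split: if_splits)
      then have "n \<in> (D \<union> Y) \<inter> {Suc S..N}" using that(1) \<open>n \<in> {1..N}\<close> by simp
      then show ?thesis using Z(1)[OF \<open>?k < Kc\<close>] False by auto
    qed (use that in simp)
    then show ?thesis using enc0 True by blast
  next
    case False
    then show ?thesis using enc_outside[OF closed_prof[OF v(1)] st _ False] that ncols_le[of n] by simp
  qed
  have "wlist st = d" using msg d by (auto simp: wlist_def messages_def intro!: nth_equalityI)
  then show ?thesis using st zero by (intro bexI[of _ st]) (auto simp: fiber_def codewords_def PR_def)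
qed

lemma codewords_states: "codewords D X \<subseteq> states"
  by (auto simp: codewords_def states_on_def)

lemma finite_fiber: "finite (fiber D X d)"
  by (rule finite_subset[OF _ finite_states]) (use codewords_states in \<open>auto simp: fiber_def\<close>)

lemma fiber_nonempty:
  assumes "D \<subseteq> {1..N}" "card D + X \<le> om" "d \<in> messages Fp L"
  shows "fiber D X d \<noteq> {}"
proof -
  have "X \<le> card ({1..N} - D)" using card_avail[OF assms(1)] assms(2) K0 NRS by linarith
  then obtain Y where "Y \<subseteq> {1..N} - D" "card Y = X" by (metis obtain_subset_with_card_n)
  then show ?thesis using codeword_exists[of D Y d] assms by auto
qed

lemma padd_codewords:
  assumes "a \<in> codewords D X" "e \<in> codewords D X"
  shows "padd a e \<in> codewords D X"
proof -
  have "p dvd enc (padd a e) n c" if "n \<in> D" "c < ncols n" for n c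
  proof -
    have "p dvd (enc (padd a e) n c - (enc a n c + enc e n c)) + (enc a n c + enc e n c)"
      using assms that enc_padd[of c a e n] ncols_le[of n] by (intro dvd_add) (auto simp: codewords_def)
    then show ?thesis by simp
  qed
  moreover have "padd a e (i, c) = 0" if "(i, c) \<in> idx" "c \<notin> PR D (Rr - card D - X)" for i c
  proof -
    have "a (i, c) = 0" "e (i, c) = 0"
      using assms that unfolding codewords_def states_on_def by blast+
    then show ?thesis using that by (simp add: padd_def)
  qed
  then have "padd a e \<in> states_on (PR D (Rr - card D - X))"
    using padd_states unfolding states_on_def by auto
  ultimately show ?thesis unfolding codewords_def by blast
qed

text \<open>Adding a codeword that vanishes on \<open>Y\<close> maps one fiber onto another and keeps the uploads
  to \<open>Y\<close>.\<close>

lemma security: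
  assumes D: "D \<subseteq> {1..N}" and Y: "Y \<subseteq> {1..N} - D" and DY: "card D + card Y \<le> om"
    and d: "d \<in> messages Fp L" "d' \<in> messages Fp L"
  shows "map_pmf (\<lambda>u. restrict u Y) (upload the_scheme D (card Y) d) =
    map_pmf (\<lambda>u. restrict u Y) (upload the_scheme D (card Y) d')"
proof -
  let ?f = "fiber D (card Y)"
  have shift: "\<exists>e. (\<forall>n\<in>Y. \<forall>c<ncols n. p dvd enc e n c) \<and> (\<lambda>a. padd a e) ` ?f x \<subseteq> ?f x'"
    if x: "x \<in> messages Fp L" "x' \<in> messages Fp L" for x x'
  proof -
    obtain y where y: "y \<in> messages Fp L" "x' = add_msg Fp x y"
      using bij_betw_add_msg[OF field_Fp finite_Fp x(1)] x(2) by (auto simp: bij_betw_def)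
    obtain e where e: "e \<in> ?f y" "\<And>n c. n \<in> Y \<Longrightarrow> c < ncols n \<Longrightarrow> p dvd enc e n c"
      using codeword_exists[OF D Y DY y(1)] by blast
    have "padd a e \<in> ?f x'" if "a \<in> ?f x" for a
      using that e(1) y padd_codewords by (auto simp: fiber_def wlist_padd)
    then show ?thesis using e(2) by blast
  qed
  have inj: "inj_on (\<lambda>a. padd a e) (?f x)" for e x
    by (rule inj_on_subset[OF padd_inj]) (use codewords_states in \<open>auto simp: fiber_def\<close>)
  have card: "card (?f x) \<le> card (?f x')" if x: "x \<in> messages Fp L" "x' \<in> messages Fp L" for x x'
    using shift[OF x] card_inj_on_le[OF inj _ finite_fiber] by blast
  obtain e where e: "\<And>n c. n \<in> Y \<Longrightarrow> c < ncols n \<Longrightarrow> p dvd enc e n c"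
    and sub: "(\<lambda>a. padd a e) ` ?f d \<subseteq> ?f d'" using shift[OF d] by blast
  \<comment> \<open>Translations inject each fiber into the other, so the fibers have equal size and
    this translation is onto.\<close>
  have "(\<lambda>a. padd a e) ` ?f d = ?f d'"
    using card[OF d(2,1)] by (intro card_seteq[OF finite_fiber sub]) (simp add: card_image[OF inj])
  then have bij: "bij_betw (\<lambda>a. padd a e) (?f d) (?f d')" using inj by (simp add: bij_betw_def)
  have ne: "?f x \<noteq> {}" if "x \<in> messages Fp L" for x using fiber_nonempty[OF D _ that] DY by simp
  have "map_pmf slist (pmf_of_set (?f d')) = map_pmf (\<lambda>a. slist (padd a e)) (pmf_of_set (?f d))"
    using arg_cong[OF map_pmf_of_set_bij_betw[OF bij ne[OF d(1)] finite_fiber], of "map_pmf slist"]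
    by (simp add: map_pmf_comp)
  moreover have "restrict (slist (padd a e)) Y = restrict (slist a) Y" for a
    using slist_padd_zero[OF e] by (intro restrict_ext) auto
  ultimately show ?thesis using D DY d by (simp add: the_scheme_def map_pmf_comp)
qed

lemma finite_upload: "finite (set_pmf (upload the_scheme D X d))"
  using finite_fiber[of D X d] fiber_nonempty[of D X d] by (auto simp: the_scheme_def)

lemma finite_law: "finite (set_pmf law)"
  using finite_states states_nonempty by (simp add: law_def)

lemma fst_law: "fst ` set_pmf law \<subseteq> messages Fp L"
  using finite_states states_nonempty by (auto simp: law_def wlist_messages)

text \<open>The new message and storages are those of the translated state, and translation by any
  fixed codeword permutes the states. The law is thus unchanged for each drawn codeword, and so
  after averaging.\<close>

lemma update_step_law:
  assumes D: "D \<subseteq> {1..N}" and X: "card D + X \<le> om"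
  shows "update_step N Fp L the_scheme D X law = law"
proof -
  let ?U = "pmf_of_set states" and ?M = "pmf_of_set (messages Fp L)"
  let ?W = "\<lambda>d. pmf_of_set (fiber D X d)"
  have next_eq: "next_storage N the_scheme D X (slist a) (slist e) = slist (padd a e)"
    if "e \<in> fiber D X d" for a e d
  proof
    fix n
    have "slist (padd a e) n = slist a n" if "n \<in> D"
      using \<open>e \<in> fiber D X d\<close> that by (intro slist_padd_zero) (auto simp: fiber_def codewords_def)
    moreover have "slist (padd a e) n = slist a n" if "n \<notin> {1..N}"
      by (simp add: slist_out[OF that])
    ultimately show "next_storage N the_scheme D X (slist a) (slist e) n = slist (padd a e) n"
    proof (cases "n \<in> {1..N} - D")
      case True
      then show ?thesis by (simp add: next_storage_def the_scheme_def slist_padd)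
    next
      case False
      then have "slist (padd a e) n = slist a n"
        using \<open>n \<in> D \<Longrightarrow> _\<close> \<open>n \<notin> {1..N} \<Longrightarrow> _\<close> by blast
      moreover have "next_storage N the_scheme D X (slist a) (slist e) n = slist a n"
        unfolding next_storage_def by (rule if_not_P[OF False])
      ultimately show ?thesis by simp
    qed
  qed
  have "update_step N Fp L the_scheme D X law =
    bind_pmf ?U (\<lambda>a. bind_pmf ?M (\<lambda>d. bind_pmf (upload the_scheme D X d) (\<lambda>u.
      return_pmf (add_msg Fp (wlist a) d, next_storage N the_scheme D X (slist a) u))))"
    by (simp add: update_law_def law_def map_bind_pmf bind_map_pmf case_prod_unfold)
  also have "\<dots> = bind_pmf ?U (\<lambda>a. bind_pmf ?M (\<lambda>d. bind_pmf (?W d) (\<lambda>e.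
      return_pmf (wlist (padd a e), slist (padd a e)))))"
  proof (intro bind_pmf_cong refl)
    fix a d assume "d \<in> set_pmf ?M"
    then have d: "d \<in> messages Fp L"
      using finite_messages[OF finite_Fp] messages_nonempty[OF field_Fp finite_Fp] by simp
    then have "bind_pmf (upload the_scheme D X d) (\<lambda>u.
        return_pmf (add_msg Fp (wlist a) d, next_storage N the_scheme D X (slist a) u)) =
      bind_pmf (?W d) (\<lambda>e. return_pmf (add_msg Fp (wlist a) d, next_storage N the_scheme D X (slist a) (slist e)))"
      using D X by (simp add: the_scheme_def bind_map_pmf)
    also have "\<dots> = bind_pmf (?W d) (\<lambda>e. return_pmf (wlist (padd a e), slist (padd a e)))"
    proof (intro bind_pmf_cong refl)
      fix e assume "e \<in> set_pmf (?W d)"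
      then have e: "e \<in> fiber D X d" using fiber_nonempty[OF D X d] finite_fiber by simp
      then show "return_pmf (add_msg Fp (wlist a) d, next_storage N the_scheme D X (slist a) (slist e)) =
          return_pmf (wlist (padd a e), slist (padd a e))"
        using next_eq[OF e] by (simp add: wlist_padd fiber_def)
    qed
    finally show "bind_pmf (upload the_scheme D X d) (\<lambda>u.
        return_pmf (add_msg Fp (wlist a) d, next_storage N the_scheme D X (slist a) u)) =
      bind_pmf (?W d) (\<lambda>e. return_pmf (wlist (padd a e), slist (padd a e)))" .
  qed
  also have "\<dots> = bind_pmf ?M (\<lambda>d. bind_pmf (?W d) (\<lambda>e. bind_pmf ?U (\<lambda>a.
      return_pmf (wlist (padd a e), slist (padd a e)))))"
    by (subst bind_commute_pmf, subst (2) bind_commute_pmf) (rule refl)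
  also have "\<dots> = bind_pmf ?M (\<lambda>d. bind_pmf (?W d) (\<lambda>e.
      map_pmf (\<lambda>st. (wlist st, slist st)) (map_pmf (\<lambda>a. padd a e) ?U)))"
    by (simp add: map_pmf_def bind_assoc_pmf bind_return_pmf)
  also have "\<dots> = law" by (simp add: map_padd_uniform law_def)
  finally show ?thesis .
qed




lemma set_law: "set_pmf law = (\<lambda>st. (wlist st, slist st)) ` states"
  using finite_states states_nonempty by (simp add: law_def)

lemma ent_le_sparse:
  assumes "finite (set_pmf q)"
    and "\<And>\<omega>. \<omega> \<in> set_pmf q \<Longrightarrow> length (X \<omega>) = m \<and> set (X \<omega>) \<subseteq> {0..<p} \<and> (\<forall>c<m. c \<notin> P \<longrightarrow> X \<omega> ! c = 0)"
  shows "ent (qq Fp) q X \<le> real (card (P \<inter> {..<m}))"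
proof -
  let ?Z = "{xs. length xs = m \<and> set xs \<subseteq> {0..<p} \<and> (\<forall>c<m. c \<notin> P \<longrightarrow> xs ! c = 0)}"
  have Z: "finite ?Z" "card ?Z \<le> nat p ^ card (P \<inter> {..<m})"
    using card_sparse_lists[OF p_pos] by blast+
  have sub: "X ` set_pmf q \<subseteq> ?Z" using assms(2) by blast
  then have "?Z \<noteq> {}" using set_pmf_not_empty[of q] by blast
  then have pos: "0 < card ?Z" using Z(1) by (simp add: card_gt_0_iff)
  have "ent (qq Fp) q X \<le> log (qq Fp) (card ?Z)"
    using sub Z(1) by (rule ent_le_log_card[OF qq_Fp_gt_1 assms(1)])
  also have "\<dots> \<le> log (qq Fp) (real (nat p ^ card (P \<inter> {..<m})))"
    using qq_Fp_gt_1 pos Z(2) p_gt_1 by (subst log_le_cancel_iff) (auto simp: of_nat_le_iff simp del: of_nat_power)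
  also have "\<dots> = real (card (P \<inter> {..<m}))"
    using p_gt_1 by (simp add: qq_Fp log_nat_power)
  finally show ?thesis .
qed

lemma read_ok_law:
  assumes D: "D \<subseteq> {1..N}" "card D \<le> N - Rr"
  shows "read_ok N Fp the_scheme law D"
  unfolding read_ok_def
proof (intro conjI ballI)
  fix n
  show "cond_ent (qq Fp) law (\<lambda>(w, s). answer the_scheme D n (s n)) (\<lambda>(w, s). s n) = 0"
    by (rule cond_ent_fun_eq_0[OF qq_Fp_gt_1 finite_law, where f = "answer the_scheme D n"]) auto
next
  show "cond_ent (qq Fp) law (\<lambda>(w, s). w)
    (\<lambda>(w, s). restrict (\<lambda>n. answer the_scheme D n (s n)) ({1..N} - D)) = 0"
  proof (rule cond_ent_eq_0I[OF qq_Fp_gt_1 finite_law])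
    fix \<omega> \<omega>' assume "\<omega> \<in> set_pmf law" "\<omega>' \<in> set_pmf law"
      and eq: "(\<lambda>(w, s). restrict (\<lambda>n. answer the_scheme D n (s n)) ({1..N} - D)) \<omega> =
        (\<lambda>(w, s). restrict (\<lambda>n. answer the_scheme D n (s n)) ({1..N} - D)) \<omega>'"
    then obtain a a' where a: "\<omega> = (wlist a, slist a)" "\<omega>' = (wlist a', slist a')"
      by (auto simp: set_law)
    have "wlist a = wlist a'"
    proof (rule read_determines[OF D])
      fix n assume "n \<in> {1..N} - D"
      then show "answer the_scheme D n (slist a n) = answer the_scheme D n (slist a' n)"
        using fun_cong[OF eq, of n] by (simp only: a prod.case restrict_apply')
    qed
    then show "(\<lambda>(w, s). w) \<omega> = (\<lambda>(w, s). w) \<omega>'" by (simp add: a)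
  qed
qed

lemma coded_storage_law: "coded_storage N Rr Kc S Fp L law fst snd"
  unfolding coded_storage_def
proof (intro conjI allI impI ballI)
  fix R' assume R': "R' \<subseteq> {1..N} \<and> card R' = Rr"
  then have "finite R'" using finite_subset by blast
  then have "card ({1..N} - R') = N - Rr" using R' by (simp add: card_Diff_subset)
  show "cond_ent (qq Fp) law fst (\<lambda>\<omega>. restrict (snd \<omega>) R') = 0"
  proof (rule cond_ent_eq_0I[OF qq_Fp_gt_1 finite_law])
    fix \<omega> \<omega>' assume "\<omega> \<in> set_pmf law" "\<omega>' \<in> set_pmf law"
      and eq: "restrict (snd \<omega>) R' = restrict (snd \<omega>') R'"
    then obtain a a' where a: "\<omega> = (wlist a, slist a)" "\<omega>' = (wlist a', slist a')"
      by (auto simp: set_law)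
    have "wlist a = wlist a'"
    proof (rule read_determines)
      fix n assume "n \<in> {1..N} - ({1..N} - R')"
      then have "slist a n = slist a' n" using fun_cong[OF eq, of n] by (simp add: a)
      then show "answer the_scheme ({1..N} - R') n (slist a n) = answer the_scheme ({1..N} - R') n (slist a' n)"
        by simp
    qed (use \<open>card ({1..N} - R') = N - Rr\<close> in auto)
    then show "fst \<omega> = fst \<omega>'" by (simp add: a)
  qed
next
  fix n assume n: "n \<in> {1..S}"
  then have n1: "n \<in> {1..N}" using NRS by auto
  have "ent (qq Fp) law (\<lambda>\<omega>. snd \<omega> n) \<le> real (card (UNIV \<inter> {..<len}))"
  proof (rule ent_le_sparse[OF finite_law])
    fix \<omega> assume "\<omega> \<in> set_pmf law"
    then obtain a where "\<omega> = (wlist a, slist a)" by (auto simp: set_law)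
    then show "length (snd \<omega> n) = len \<and> set (snd \<omega> n) \<subseteq> {0..<p} \<and> (\<forall>c<len. c \<notin> UNIV \<longrightarrow> snd \<omega> n ! c = 0)"
      using length_slist[OF n1] slist_range[of a n] n by (simp add: ncols_def)
  qed
  then show "ent (qq Fp) law (\<lambda>\<omega>. snd \<omega> n) \<le> real L / real Kc"
    using K0 by (simp add: L_eq)
qed

lemma update_ok_law:
  assumes D: "D \<subseteq> {1..N}" and X: "card D + X \<le> om"
  shows "update_ok N Rr Kc S Fp L the_scheme law D X"
proof -
  let ?p = "update_law Fp L the_scheme law D X" and ?M = "pmf_of_set (messages Fp L)"
  have finp: "finite (set_pmf ?p)"
    by (rule finite_update_law[OF field_Fp finite_Fp finite_law finite_upload])
  have M: "finite (messages Fp L)" "messages Fp L \<noteq> {}"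
    by (rule finite_messages[OF finite_Fp], rule messages_nonempty[OF field_Fp finite_Fp])
  show ?thesis
    unfolding update_ok_def Let_def
  proof (intro conjI allI impI ballI)
    fix Y assume Y: "Y \<subseteq> {1..N} - D \<and> card Y = X"
    obtain d0 where d0: "d0 \<in> messages Fp L" using M by blast
    define Q where "Q = map_pmf (\<lambda>u. restrict u Y) (upload the_scheme D X d0)"
    have "map_pmf (\<lambda>\<omega>. ((\<lambda>(w, s, d, u). d) \<omega>, (\<lambda>(w, s, d, u). restrict u Y) \<omega>)) ?p =
      bind_pmf ?M (\<lambda>d. map_pmf (Pair d) (map_pmf (\<lambda>u. restrict u Y) (upload the_scheme D X d)))"
      by (simp add: update_law_def map_bind_pmf case_prod_unfold map_pmf_comp)
        (simp add: map_pmf_def)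
    also have "\<dots> = bind_pmf ?M (\<lambda>d. map_pmf (Pair d) Q)"
    proof (intro bind_pmf_cong refl)
      fix d assume "d \<in> set_pmf ?M"
      then have "d \<in> messages Fp L" using M by simp
      then show "map_pmf (Pair d) (map_pmf (\<lambda>u. restrict u Y) (upload the_scheme D X d)) = map_pmf (Pair d) Q"
        using security[of D Y d d0] D X Y d0 by (simp add: Q_def)
    qed
    also have "\<dots> = pair_pmf ?M Q" by (simp add: pair_pmf_def map_pmf_def)
    finally show "mut_inf (qq Fp) ?p (\<lambda>(w, s, d, u). d) (\<lambda>(w, s, d, u). restrict u Y) = 0"
      by (intro mut_inf_indep_eq_0[OF qq_Fp_gt_1 finp] map_pair_pmfD)
  next
    fix n assume n: "n \<in> {1..N} - D"
    then show "cond_ent (qq Fp) ?p (\<lambda>(w, s, d, u). next_storage N the_scheme D X s u n)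
        (\<lambda>(w, s, d, u). (s n, u n)) = 0"
      by (intro cond_ent_fun_eq_0[OF qq_Fp_gt_1 finp, where f = "\<lambda>(x, y). transition the_scheme D X n x y"])
        (auto simp: next_storage_def)
  next
    show "mut_inf (qq Fp) ?p (\<lambda>(w, s, d, u). (d, restrict u ({1..N} - D))) (\<lambda>(w, s, d, u). restrict s {1..N}) = 0"
      using update_law_indep'[of "\<lambda>(d, u). (d, restrict u ({1..N} - D))" "\<lambda>(w, s). restrict s {1..N}"
          Fp L the_scheme law D X]
      by (intro mut_inf_indep_eq_0[OF qq_Fp_gt_1 finp]) (simp add: case_prod_unfold)
  next
    have "coded_storage N Rr Kc S Fp L (update_step N Fp L the_scheme D X law) fst snd"
      unfolding update_step_law[OF D X] by (rule coded_storage_law)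
    then show "coded_storage N Rr Kc S Fp L ?p (\<lambda>(w, s, d, u). add_msg Fp w d)
        (\<lambda>(w, s, d, u). next_storage N the_scheme D X s u)"
      unfolding coded_storage_map[OF qq_Fp_gt_1 finp] by (simp add: case_prod_unfold)
  qed
qed


subsection \<open>Costs\<close>

text \<open>The column counts realize the optimal shares; the last case rests on
  \<open>Kc - ?c = (Kc - k) + ?k'\<close>.\<close>

lemma card_PR:
  assumes k: "K0 \<le> k" "k \<le> J"
  shows "real (card (PR D k \<inter> {..<ncols n})) / real L = lp_opt Kc S D k n"
proof -
  let ?c = "card ({1..S} - D)"
  note v = valid_eff[OF k, of D]
  show ?thesis
  proof (cases "Kc \<le> k")
    case True
    have "PR D k \<inter> {..<ncols n} = {..<L div k}"
      using True L_div_le[OF v(1) True] len_le_M by (auto simp: PR_def prof_def ncols_def)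
    moreover have "real k * real (L div k) = real L"
      using dvd_k[OF v(1) True] by (metis of_nat_mult)
    ultimately show ?thesis
      using True K0 L_pos by (simp add: lp_opt_def field_simps)
  next
    case False
    then have c: "?c < k" using v(2) by simp
    show ?thesis
    proof (cases "n \<le> S")
      case True
      have "PR D k \<inter> {..<ncols n} = {..<len}"
        using True False prof_main[OF v(1)] by (auto simp: PR_def ncols_def)
      then show ?thesis using True False K0 len_pos by (simp add: lp_opt_def L_eq)
    next
      case ns: False
      let ?k' = "k - ?c"
      have "PR D k \<inter> {..<ncols n} = PR D k"
        using ns prof_M[OF v(1)] by (auto simp: PR_def ncols_def)
      then have card: "real (card (PR D k \<inter> {..<ncols n})) = real len + (real Kc - real k) * real (len div ?k')"
        using card_prof[OF v(1)] False by (simp add: PR_def of_nat_diff)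
      have "real ?k' * real (len div ?k') = real len"
        using dvd_k'[OF v(1)] False by (metis not_le of_nat_mult)
      then have q: "real (len div ?k') = real len / real ?k'" using c by (simp add: field_simps)
      have kk: "real ?k' = real k - real ?c" "real k - real ?c > 0" using c by (simp_all add: of_nat_diff)
      have "(real len + (real Kc - real k) * (real len / real ?k')) / (real Kc * real len) =
          (1 - real ?c / real Kc) / real ?k'"
        using kk(2) K0(4) len_pos unfolding kk(1) by (simp add: divide_simps) (simp add: algebra_simps)
      then show ?thesis unfolding card q lp_opt_def L_eq using False ns by simp
    qed
  qed
qed

lemma read_cost_le:
  assumes D: "D \<subseteq> {1..N}" "card D \<le> N - Rr"
  shows "read_cost N Fp L the_scheme law D \<le> (\<Sum>n\<in>{1..N} - D. lp_opt Kc S D (N - card D - om) n)"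
  unfolding read_cost_def sum_divide_distrib
proof (rule sum_mono)
  fix n assume n: "n \<in> {1..N} - D"
  let ?P = "PR D (N - card D - om)"
  have k: "K0 \<le> N - card D - om" "N - card D - om \<le> J" using D K0 NRS by (auto simp: J_def)
  have "ent (qq Fp) law (\<lambda>(w, s). answer the_scheme D n (s n)) \<le> real (card (?P \<inter> {..<ncols n}))"
  proof (rule ent_le_sparse[OF finite_law])
    fix \<omega> assume "\<omega> \<in> set_pmf law"
    then obtain a where \<omega>: "\<omega> = (wlist a, slist a)" by (auto simp: set_law)
    have "slist a n ! c \<in> {0..<p}" if "c < ncols n" for c
    proof -
      have "slist a n ! c \<in> set (slist a n)" using length_slist[of n a] n that by simp
      then show ?thesis using slist_range[of a n] by blast
    qed
    then show "length ((\<lambda>(w, s). answer the_scheme D n (s n)) \<omega>) = ncols n \<and>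
      set ((\<lambda>(w, s). answer the_scheme D n (s n)) \<omega>) \<subseteq> {0..<p} \<and>
      (\<forall>c<ncols n. c \<notin> ?P \<longrightarrow> (\<lambda>(w, s). answer the_scheme D n (s n)) \<omega> ! c = 0)"
      using p_pos by (auto simp: \<omega> the_scheme_def)
  qed
  then have "ent (qq Fp) law (\<lambda>(w, s). answer the_scheme D n (s n)) / real L \<le>
      real (card (?P \<inter> {..<ncols n})) / real L"
    by (intro divide_right_mono) auto
  then show "ent (qq Fp) law (\<lambda>(w, s). answer the_scheme D n (s n)) / real L \<le>
      lp_opt Kc S D (N - card D - om) n"
    unfolding card_PR[OF k] .
qed

lemma update_cost_le:
  assumes D: "D \<subseteq> {1..N}" and X: "card D + X \<le> om"
  shows "update_cost N Fp L the_scheme law D X \<le> (\<Sum>n\<in>{1..N} - D. lp_opt Kc S D (Rr - card D - X) n)"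
  unfolding update_cost_def sum_divide_distrib
proof (rule sum_mono)
  fix n assume n: "n \<in> {1..N} - D"
  let ?k = "Rr - card D - X" and ?p = "update_law Fp L the_scheme law D X"
  have k: "K0 \<le> ?k" "?k \<le> J" using X K0 NRS by (auto simp: J_def)
  have "ent (qq Fp) ?p (\<lambda>(w, s, d, u). u n) \<le> real (card (PR D ?k \<inter> {..<ncols n}))"
  proof (rule ent_le_sparse)
    show "finite (set_pmf ?p)"
      by (rule finite_update_law[OF field_Fp finite_Fp finite_law finite_upload])
    fix \<omega> assume "\<omega> \<in> set_pmf ?p"
    then obtain w s d u where \<omega>: "\<omega> = (w, s, d, u)" and d: "d \<in> messages Fp L"
      and u: "u \<in> set_pmf (upload the_scheme D X d)"
      by (auto simp: set_update_law[OF field_Fp finite_Fp])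
    obtain e where e: "e \<in> fiber D X d" "u = slist e"
      using u D X d fiber_nonempty[OF D X d] finite_fiber by (auto simp: the_scheme_def)
    have "e \<in> states_on (PR D ?k)" using e by (simp add: fiber_def codewords_def)
    then have "enc e n c = 0" if "c < ncols n" "c \<notin> PR D ?k" for c
      using enc_outside[OF closed_prof[OF valid_eff(1)[OF k]]] that ncols_le[of n]
      unfolding PR_def by simp
    then show "length ((\<lambda>(w, s, d, u). u n) \<omega>) = ncols n \<and> set ((\<lambda>(w, s, d, u). u n) \<omega>) \<subseteq> {0..<p} \<and>
      (\<forall>c<ncols n. c \<notin> PR D ?k \<longrightarrow> (\<lambda>(w, s, d, u). u n) \<omega> ! c = 0)"
      using n length_slist[of n e] slist_range[of e n] by (auto simp: \<omega> e slist_def)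
  qed
  then have "ent (qq Fp) ?p (\<lambda>(w, s, d, u). u n) / real L \<le> real (card (PR D ?k \<inter> {..<ncols n})) / real L"
    by (intro divide_right_mono) auto
  then show "ent (qq Fp) ?p (\<lambda>(w, s, d, u). u n) / real L \<le> lp_opt Kc S D ?k n"
    unfolding card_PR[OF k] .
qed


subsection \<open>The scheme attains the bounds\<close>

lemmas law_ctx = feas field_Fp finite_Fp L_pos finite_law finite_upload fst_law coded_storage_law

text \<open>An executed update has a threshold of at most \<open>N\<close>, so the converse bound
  applies to every \<open>X\<close> and confines updates to the pairs for which fibers are
  nonempty.\<close>

lemma admissible_update:
  assumes adm: "admissible N Rr Kc S Fp L the_scheme ops" and op: "ops t = Update D X"
    and law: "state_law N Fp L the_scheme ops t = law"
  shows "D \<subseteq> {1..N}" "card D + X \<le> om"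
proof -
  have "case ops t of Read D \<Rightarrow> D \<subseteq> {1..N} \<and> card D \<le> N - Rr
    | Update D X \<Rightarrow> D \<subseteq> {1..N} \<and> X < Rr \<and>
        N - card D \<ge> update_threshold N Rr Kc S Fp L the_scheme (state_law N Fp L the_scheme ops t) X"
    using adm unfolding admissible_def by blast
  then have D: "D \<subseteq> {1..N}" "X < Rr" "N - card D \<ge> update_threshold N Rr Kc S Fp L the_scheme law X"
    using op law by auto
  have "update_threshold N Rr Kc S Fp L the_scheme law X \<le> N" using D(3) by simp
  then have "int N - int om + int X \<le> int (update_threshold N Rr Kc S Fp L the_scheme law X)"
    unfolding om_def by (intro update_threshold_ge[OF law_ctx D(2) disjI2])
  then show "card D + X \<le> om" using D(3) card_avail(2)[OF D(1)] by linarith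
  show "D \<subseteq> {1..N}" by (rule D(1))
qed

lemma state_law_eq:
  assumes adm: "admissible N Rr Kc S Fp L the_scheme ops"
  shows "state_law N Fp L the_scheme ops t = law"
proof (induction t)
  case 0
  show ?case by (simp add: the_scheme_def law_def)
next
  case (Suc t)
  then show ?case
    using admissible_update[OF adm _ Suc] update_step_law by (auto split: operation.split)
qed

text \<open>By stationarity this law is also the law right after an update in which \<open>Y\<close>
  dropped out, which makes the read bound available from slot 0 on.\<close>

lemma uniform_given_law:
  assumes "Y \<subseteq> {1..N}" "card Y \<le> om"
  shows "uniform_given Fp L law Y"
  using uniform_given_dropouts[OF field_Fp finite_Fp fst_law, of Y Y N the_scheme 0]
    update_step_law[of Y 0] assms by simp

text \<open>Obtained as uniformity given an empty set of storages, in place of counting the states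
  of each message.\<close>

lemma map_fst_law: "map_pmf fst law = pmf_of_set (messages Fp L)"
proof -
  have "map_pmf fst (map_pmf (\<lambda>(w, s). (w, restrict s {})) law) = pmf_of_set (messages Fp L)"
    using uniform_given_law[of "{}"] unfolding uniform_given_def by (simp add: map_fst_pair_pmf)
  then show ?thesis by (simp add: map_pmf_comp case_prod_unfold)
qed

lemma rdcds_the_scheme: "rdcds_scheme N Rr Kc S Fp L the_scheme"
proof -
  have init: "init_law the_scheme = law" by (simp add: the_scheme_def law_def)
  show ?thesis
    unfolding rdcds_scheme_def init
    using finite_law finite_upload map_fst_law state_law_eq coded_storage_law read_ok_law by simp
qed

lemma update_threshold_law:
  assumes "X \<le> om"
  shows "int (update_threshold N Rr Kc S Fp L the_scheme law X) = int N - int om + int X"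
proof (rule antisym)
  have "update_threshold N Rr Kc S Fp L the_scheme law X \<le> N - om + X"
    unfolding update_threshold_def
  proof (rule Least_le, intro allI impI, elim conjE)
    fix D assume D: "D \<subseteq> {1..N}" "N - card D \<ge> N - om + X"
    then have "card D + X \<le> om" using card_avail(2)[OF D(1)] K0 NRS by linarith
    then show "update_ok N Rr Kc S Fp L the_scheme law D X" by (rule update_ok_law[OF D(1)])
  qed
  then show "int (update_threshold N Rr Kc S Fp L the_scheme law X) \<le> int N - int om + int X"
    using K0 NRS by linarith
  have "X < Rr" using assms K0 by linarith
  then show "int N - int om + int X \<le> int (update_threshold N Rr Kc S Fp L the_scheme law X)"
    using update_threshold_ge[OF law_ctx, of X] assms by (simp add: om_def)
qed

lemma read_cost_law:
  assumes D: "D \<subseteq> {1..N}" "card D \<le> N - Rr"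
  shows "is_min_over N D (V_read N Rr Kc S D) (read_cost N Fp L the_scheme law D)"
proof -
  have "uniform_given Fp L law Y" if "Y \<subseteq> {1..N} - D" "card Y = Om Rr Kc S" for Y
    using that by (intro uniform_given_law) (auto simp: om_def)
  then have "read_cost N Fp L the_scheme law D = (\<Sum>n\<in>{1..N} - D. lp_opt Kc S D (N - card D - om) n)"
    using read_cost_ge[OF law_ctx D read_ok_law[OF D]] read_cost_le[OF D]
    by (intro antisym) (simp_all add: om_def)
  then show ?thesis using is_min_over_V_read[OF feas D] by (simp add: om_def)
qed

lemma update_cost_law:
  assumes D: "D \<subseteq> {1..N}" and X: "card D + X \<le> om"
  shows "is_min_over N D (V_update N Rr Kc S D X) (update_cost N Fp L the_scheme law D X)"
proof -
  have "update_cost N Fp L the_scheme law D X = (\<Sum>n\<in>{1..N} - D. lp_opt Kc S D (Rr - card D - X) n)"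
    using update_cost_ge[OF law_ctx D _ update_ok_law[OF D X]] update_cost_le[OF D X] X
    by (intro antisym) (simp_all add: om_def)
  then show ?thesis using is_min_over_V_update[OF feas D] X by (simp add: om_def)
qed

lemma achievability:
  "\<exists>(F :: int ring) L (sch :: (int, int list, int list, int list) scheme).
     field F \<and> finite (carrier F) \<and> L > 0 \<and> rdcds_scheme N Rr Kc S F L sch \<and>
     (\<forall>ops t. admissible N Rr Kc S F L sch ops \<longrightarrow>
        (\<forall>X \<le> Om Rr Kc S.
           int (update_threshold N Rr Kc S F L sch (state_law N F L sch ops t) X)
             = int N - int (Om Rr Kc S) + int X) \<and>
        (\<forall>D. ops t = Read D \<longrightarrow>
           is_min_over N D (V_read N Rr Kc S D) (read_cost N F L sch (state_law N F L sch ops t) D)) \<and>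
        (\<forall>D X. ops t = Update D X \<longrightarrow>
           is_min_over N D (V_update N Rr Kc S D X)
             (update_cost N F L sch (state_law N F L sch ops t) D X)))"
proof (intro exI[of _ Fp] exI[of _ L] exI[of _ the_scheme] conjI allI impI)
  fix ops t assume adm: "admissible N Rr Kc S Fp L the_scheme ops"
  show "int (update_threshold N Rr Kc S Fp L the_scheme (state_law N Fp L the_scheme ops t) X)
      = int N - int (Om Rr Kc S) + int X" if "X \<le> Om Rr Kc S" for X
    using update_threshold_law[of X] that by (simp add: state_law_eq[OF adm] om_def)
  show "is_min_over N D (V_read N Rr Kc S D)
      (read_cost N Fp L the_scheme (state_law N Fp L the_scheme ops t) D)" if "ops t = Read D" for D
  proof -
    have "case ops t of Read D \<Rightarrow> D \<subseteq> {1..N} \<and> card D \<le> N - Rr | Update D X \<Rightarrow> True"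
      using adm unfolding admissible_def by (auto split: operation.splits)
    then show ?thesis using that read_cost_law[of D] by (simp add: state_law_eq[OF adm])
  qed
  show "is_min_over N D (V_update N Rr Kc S D X)
      (update_cost N Fp L the_scheme (state_law N Fp L the_scheme ops t) D X)"
    if "ops t = Update D X" for D X
    using admissible_update[OF adm that state_law_eq[OF adm]] update_cost_law by (simp add: state_law_eq[OF adm])
qed (use field_Fp finite_Fp L_pos rdcds_the_scheme in auto)

end

section \<open>Existence of the labellings and evaluation points, and conclusion\<close>

lemma staircase_labels_exist:
  assumes "1 \<le> T" "T \<le> J" "\<And>k. 1 \<le> k \<Longrightarrow> k \<le> J \<Longrightarrow> k dvd L" "0 < L"
  shows "\<exists>l. staircase_labels T J L l"
proof -
  obtain l where l: "\<forall>i<T. \<forall>c. l i c = i * (L div T) + c"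
    "\<forall>k\<in>{T..J}. bij_betw (\<lambda>(i, c). l i c) ({..<k} \<times> {..<L div k}) {..<L}"
    using staircase_labelling[of T J L] assms by auto
  have "staircase_labels T J L l"
    by unfold_locales (use assms l in auto)
  then show ?thesis by blast
qed

lemma rdcds_code_exists:
  assumes "feasible N Rr Kc S"
  shows "\<exists>p \<alpha> l1 l2. rdcds_code N Rr Kc S p \<alpha> l1 l2"
proof -
  have Kc: "1 \<le> Kc" "1 \<le> N" using assms by (auto simp: feasible_def)
  \<comment> \<open>The factorial makes every row number up to \<open>N + Kc\<close> divide both the
    block length and \<open>L\<close>.\<close>
  have dvd: "k dvd Kc * fact (N + Kc)" "k dvd fact (N + Kc)" if "1 \<le> k" "k \<le> N + Kc" for k :: nat
  proof -
    show "k dvd fact (N + Kc)" using that by (intro dvd_fact)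
    then show "k dvd Kc * fact (N + Kc)" by (rule dvd_mult)
  qed
  obtain l1 where l1: "staircase_labels Kc (N + Kc) (Kc * fact (N + Kc)) l1"
    using staircase_labels_exist[of Kc "N + Kc" "Kc * fact (N + Kc)"] Kc dvd(1) by auto
  obtain l2 where l2: "staircase_labels (Suc 0) (N + Kc) (fact (N + Kc)) l2"
    using staircase_labels_exist[of "Suc 0" "N + Kc" "fact (N + Kc)"] Kc dvd(2) by auto
  from decoding_points_exist[of Rr "N + Kc" N] obtain p :: int and \<alpha> :: "nat \<Rightarrow> int" where p: "prime p"
    and r: "\<forall>R T k P E. R \<le> Rr \<and> T \<le> R \<and> T \<le> k \<and> k \<le> N + Kc \<and> P \<subseteq> {..<N + Kc} \<and>
      E \<subseteq> {1..N} \<and> card E = R + k - T \<longrightarrow> uniquely_solvable p \<alpha> E (card E) (read_basis Rr R T k P)"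
    and w: "\<forall>k E. k + card E \<le> Rr \<and> E \<subseteq> {1..N} \<longrightarrow>
      uniquely_solvable p \<alpha> E (card E) (\<lambda>r. monom 1 (k + r))"
    by (elim exE conjE)
  have "rdcds_code N Rr Kc S p \<alpha> l1 l2"
  proof (rule rdcds_code.intro)
    show "feasible N Rr Kc S" "prime p" by (rule assms, rule p)
    show "staircase_labels Kc (N + Kc) (Kc * fact (N + Kc)) l1" by (rule l1)
    show "staircase_labels (Suc 0) (N + Kc) (fact (N + Kc)) l2" by (rule l2)
    show "uniquely_solvable p \<alpha> E (card E) (read_basis Rr R T k P)"
      if "R \<le> Rr" "T \<le> R" "T \<le> k" "k \<le> N + Kc" "P \<subseteq> {..<N + Kc}" "E \<subseteq> {1..N}" "card E = R + k - T"
      for R T k P E by (rule r[rule_format], intro conjI) (rule that)+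
    show "uniquely_solvable p \<alpha> E (card E) (\<lambda>r. monom 1 (k + r))"
      if "k + card E \<le> Rr" "E \<subseteq> {1..N}" for k E by (rule w[rule_format], intro conjI) (rule that)+
  qed
  then show ?thesis by blast
qed

theorem theorem1:
  fixes N Rr Kc S :: nat
  assumes "feasible N Rr Kc S"
  shows "(\<forall>(F :: 'f ring) L (sch :: ('f, 's, 'u, 'a) scheme) ops t0 t.
            field F \<and> finite (carrier F) \<and> L > 0 \<and>
            rdcds_scheme N Rr Kc S F L sch \<and> admissible N Rr Kc S F L sch ops \<and>
            steady_by N Rr Kc S ops t0 \<and> t > t0 \<longrightarrow>
            (\<forall>D X. ops t = Update D X \<longrightarrow>
               int (update_threshold N Rr Kc S F L sch (state_law N F L sch ops t) X)
                 \<ge> int N - int (Om Rr Kc S) + int X) \<and>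
            (\<forall>D. ops t = Read D \<longrightarrow>
               (\<exists>m. is_min_over N D (V_read N Rr Kc S D) m \<and>
                    read_cost N F L sch (state_law N F L sch ops t) D \<ge> m)) \<and>
            (\<forall>D X. ops t = Update D X \<longrightarrow>
               (\<exists>m. is_min_over N D (V_update N Rr Kc S D X) m \<and>
                    update_cost N F L sch (state_law N F L sch ops t) D X \<ge> m)))
       \<and> (\<exists>(F :: int ring) L (sch :: (int, int list, int list, int list) scheme).
            field F \<and> finite (carrier F) \<and> L > 0 \<and>
            rdcds_scheme N Rr Kc S F L sch \<and>
            (\<forall>ops t. admissible N Rr Kc S F L sch ops \<longrightarrow>
               (\<forall>X \<le> Om Rr Kc S.
                  int (update_threshold N Rr Kc S F L sch (state_law N F L sch ops t) X)
                    = int N - int (Om Rr Kc S) + int X) \<and>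
               (\<forall>D. ops t = Read D \<longrightarrow>
                  is_min_over N D (V_read N Rr Kc S D)
                    (read_cost N F L sch (state_law N F L sch ops t) D)) \<and>
               (\<forall>D X. ops t = Update D X \<longrightarrow>
                  is_min_over N D (V_update N Rr Kc S D X)
                    (update_cost N F L sch (state_law N F L sch ops t) D X))))"
proof -
  obtain p \<alpha> l1 l2 where "rdcds_code N Rr Kc S p \<alpha> l1 l2" using rdcds_code_exists[OF assms] by blast
  note ach = rdcds_code.achievability[OF this]
  show ?thesis
    by (rule conjI[OF _ ach]; intro allI impI conjI; elim conjE; rule converse[OF assms]; assumption)
qed

end
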